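(* Let $d\ge 0$. Then $\mathrm{TR}_d$, the space of Markov traces on $\{\mathcal H(S_dB_n)\}_{n=1}^{+\infty}$, is a $\mathbb K(z)$-vector space of dimension $d+1$. In particular, $\{T_0^d,T_1^d,\dots,T_d^d\}$ is a basis of $\mathrm{TR}_d$.
   Context: $\mathbb K=\mathbb C(q)$, with $q$ a variable; $z$ is another variable. $B_n$ is the braid group on $n$ strands. The singular braid monoid $SB_n$ is the monoid with generators $\sigma_1^{\pm1},\dots,\sigma_{n-1}^{\pm1},\tau_1,\dots,\tau_{n-1}$ and relations $\sigma_k\sigma_k^{-1}=\sigma_k^{-1}\sigma_k=1$, $\sigma_k\tau_k=\tau_k\sigma_k$; $\sigma_k\sigma_l\sigma_k=\sigma_l\sigma_k\sigma_l$ and $\sigma_k\sigma_l\tau_k=\tau_l\sigma_k\sigma_l$ if $|k-l|=1$; $\sigma_k\sigma_l=\sigma_l\sigma_k$, $\sigma_k\tau_l=\tau_l\sigma_k$, $\tau_k\tau_l=\tau_l\tau_k$ if $|k-l|\ge2$. $S_dB_n\subset SB_n$ is the set of elements with $d$ singular points, i.e. represented by words with exactly $d$ letters $\tau_i$; $S_0B_n=B_n$. The singular Hecke algebra $\mathcal H(SB_n)$ is the quotient of the monoid algebra $\mathbb K[SB_n]$ by the relations $\sigma_k^2=(q-1)\sigma_k+q$, $1\le k\le n-1$. It is graded, $\mathcal H(SB_n)=\bigoplus_{d\ge0}\mathcal H(S_dB_n)$, where $\mathcal H(S_dB_n)$ is the $\mathbb K$-subspace spanned by $S_dB_n$; $\mathcal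 H(B_n)=\mathcal H(S_0B_n)$. Let $\iota_n:\mathcal H(SB_n)\to\mathcal H(SB_{n+1})$ be the homomorphism induced by the inclusion $SB_n\hookrightarrow SB_{n+1}$. A Markov trace on $\{\mathcal H(S_dB_n)\}_{n\ge1}$ is a collection of $\mathbb K$-linear maps $\mathrm{tr}_n^d:\mathcal H(S_dB_n)\to\mathbb K(z)$, $n\ge1$, such that, for all $n\ge 1$: $\mathrm{tr}_n^d(\alpha\beta)=\mathrm{tr}_n^d(\beta\alpha)$ for all $\alpha\in S_kB_n$, $\beta\in S_lB_n$ with $k+l=d$; $\mathrm{tr}_{n+1}^d\circ\iota_n=\mathrm{tr}_n^d$; and $\mathrm{tr}_{n+1}^d(\iota_n(\beta)\sigma_n)=z\cdot\mathrm{tr}_n^d(\beta)$ for all $\beta\in S_dB_n$. $\mathrm{TR}_d$ denotes the $\mathbb K(z)$-vector space of all such Markov traces. Let $T_0^0$ be the Ocneanu trace: the unique Markov trace $\{\mathrm{tr}_n^0\}$ on $\{\mathcal H(B_n)\}_{n\ge1}$ with $\mathrm{tr}_1^0(1)=1$. Define $\mathbb K$-linear maps $g_0^d,g_1^d:\mathcal H(S_{d+1}B_n)\to\mathcal H(S_dB_n)$ as follows: for $\beta=\alpha_0\tau_{i_1}\alpha_1\cdots\tau_{i_{d+1}}\alpha_{d+1}$ with $\alpha_j\in B_n$, $g_0^d(\beta)$ (resp. $g_1^d(\beta)$) is the sum over $j=1,\dots,d+1$ of the elements obtained from this word by deleting $\tau_{i_j}$ (resp. replacing $\tau_{i_j}$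 by $\sigma_{i_j}$). Define $\mathbb K(z)$-linear maps $\Phi_\varepsilon^d:\mathrm{TR}_d\to\mathrm{TR}_{d+1}$ ($\varepsilon\in\{0,1\}$) by $\Phi_\varepsilon^d(\{\mathrm{tr}_n^d\}_n)=\{\mathrm{tr}_n^d\circ g_\varepsilon^d\}_n$. For $d\ge1$ set inductively $T_k^d=\Phi_0^{d-1}(T_k^{d-1})$ if $0\le k\le d-1$, and $T_d^d=\Phi_1^{d-1}(T_{d-1}^{d-1})$. *)

theory Defs
  imports
    Complex_Main
    "HOL-Algebra.QuotRing"
    "HOL-Library.Poly_Mapping"
    "HOL-Library.Function_Algebras"
    "HOL-Computational_Algebra.Polynomial_Factorial"
begin

section \<open>The fields K = C(q) and K(z)\<close>

type_synonym K = "complex poly fract"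
type_synonym Kz = "K poly fract"

definition q_var :: K
  where "q_var = to_fract [:0, 1:]"

definition z_var :: Kz
  where "z_var = to_fract [:0, 1:]"

definition K_to_Kz :: "K \<Rightarrow> Kz"
  where "K_to_Kz c = to_fract [:c:]"


section \<open>The singular braid monoid\<close>

datatype letter = Sig (idx: nat) | SigInv (idx: nat) | Tau (idx: nat)

type_synonym word = "letter list"

definition words :: "nat \<Rightarrow> word set"
  where "words n = {w. \<forall>x \<in> set w. 1 \<le> idx x \<and> idx x < n}"

inductive defining_relation :: "nat \<Rightarrow> word \<Rightarrow> word \<Rightarrow> bool" for n :: nat
  where
    "\<lbrakk>1 \<le> k; k < n\<rbrakk> \<Longrightarrow> defining_relation n [Sig k, SigInv k] []"
  | "\<lbrakk>1 \<le> k; k < n\<rbrakk> \<Longrightarrow> defining_relation n [SigInv k, Sig k] []"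
  | "\<lbrakk>1 \<le> k; k < n\<rbrakk> \<Longrightarrow> defining_relation n [Sig k, Tau k] [Tau k, Sig k]"
  | "\<lbrakk>1 \<le> k; k < n; 1 \<le> l; l < n; \<bar>int k - int l\<bar> = 1\<rbrakk>
      \<Longrightarrow> defining_relation n [Sig k, Sig l, Sig k] [Sig l, Sig k, Sig l]"
  | "\<lbrakk>1 \<le> k; k < n; 1 \<le> l; l < n; \<bar>int k - int l\<bar> = 1\<rbrakk>
      \<Longrightarrow> defining_relation n [Sig k, Sig l, Tau k] [Tau l, Sig k, Sig l]"
  | "\<lbrakk>1 \<le> k; k < n; 1 \<le> l; l < n; \<bar>int k - int l\<bar> \<ge> 2\<rbrakk>
      \<Longrightarrow> defining_relation n [Sig k, Sig l] [Sig l, Sig k]"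
  | "\<lbrakk>1 \<le> k; k < n; 1 \<le> l; l < n; \<bar>int k - int l\<bar> \<ge> 2\<rbrakk>
      \<Longrightarrow> defining_relation n [Sig k, Tau l] [Tau l, Sig k]"
  | "\<lbrakk>1 \<le> k; k < n; 1 \<le> l; l < n; \<bar>int k - int l\<bar> \<ge> 2\<rbrakk>
      \<Longrightarrow> defining_relation n [Tau k, Tau l] [Tau l, Tau k]"

inductive braid_eq :: "nat \<Rightarrow> word \<Rightarrow> word \<Rightarrow> bool" for n :: nat
  where
    rel: "\<lbrakk>a \<in> words n; b \<in> words n; defining_relation n r s\<rbrakk>
      \<Longrightarrow> braid_eq n (a @ r @ b) (a @ s @ b)"
  | refl: "w \<in> words n \<Longrightarrow> braid_eq n w w"
  | sym: "braid_eq n u v \<Longrightarrow> braid_eq n v u"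
  | trans: "\<lbrakk>braid_eq n u v; braid_eq n v w\<rbrakk> \<Longrightarrow> braid_eq n u w"

definition braid_class :: "nat \<Rightarrow> word \<Rightarrow> word set"
  where "braid_class n w = {v. braid_eq n w v}"

definition SB :: "nat \<Rightarrow> word set monoid"
  where "SB n =
    \<lparr>carrier = braid_class n ` words n,
     monoid.mult = (\<lambda>A B. \<Union>u\<in>A. \<Union>v\<in>B. braid_class n (u @ v)),
     one = braid_class n []\<rparr>"

definition SdB :: "nat \<Rightarrow> nat \<Rightarrow> word set set"
  where "SdB d n = {braid_class n w | w. w \<in> words n \<and> length (filter is_Tau w) = d}"

definition SB_inclusion :: "nat \<Rightarrow> word set \<Rightarrow> word set"
  where "SB_inclusion n A = (\<Union>w\<in>A. braid_class (n + 1) w)"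


section \<open>Monoid algebras and the singular Hecke algebra\<close>

text \<open>The multiplication that the library puts on \<^typ>\<open>'m \<Rightarrow>\<^sub>0 'k\<close> needs \<^typ>\<open>'m\<close> to be of class
  \<^class>\<open>monoid_add\<close>; here the monoid is a record, so the convolution product is spelled out.\<close>

definition monoid_algebra :: "('m, 'x) monoid_scheme \<Rightarrow> ('m \<Rightarrow>\<^sub>0 'k::comm_ring_1) ring"
  where "monoid_algebra M =
    \<lparr>carrier = {f. Poly_Mapping.keys f \<subseteq> carrier M},
     monoid.mult = (\<lambda>f g. \<Sum>u\<in>Poly_Mapping.keys f. \<Sum>v\<in>Poly_Mapping.keys g.
       Poly_Mapping.single (u \<otimes>\<^bsub>M\<^esub> v) (Poly_Mapping.lookup f u * Poly_Mapping.lookup g v)),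
     one = Poly_Mapping.single \<one>\<^bsub>M\<^esub> 1,
     zero = 0,
     add = (+)\<rparr>"

abbreviation KSB :: "nat \<Rightarrow> (word set \<Rightarrow>\<^sub>0 K) ring"
  where "KSB n \<equiv> monoid_algebra (SB n)"

definition hecke_ideal :: "nat \<Rightarrow> (word set \<Rightarrow>\<^sub>0 K) set"
  where "hecke_ideal n = Idl\<^bsub>KSB n\<^esub>
    {Poly_Mapping.single (braid_class n [Sig k, Sig k]) 1
      - (Poly_Mapping.single (braid_class n [Sig k]) (q_var - 1)
         + Poly_Mapping.single (braid_class n []) q_var) | k. 1 \<le> k \<and> k < n}"

type_synonym hecke_elem = "(word set \<Rightarrow>\<^sub>0 K) set"

definition hecke :: "nat \<Rightarrow> hecke_elem ring"
  where "hecke n = KSB n Quot hecke_ideal n"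

definition hecke_proj :: "nat \<Rightarrow> (word set \<Rightarrow>\<^sub>0 K) \<Rightarrow> hecke_elem"
  where "hecke_proj n f = hecke_ideal n +>\<^bsub>KSB n\<^esub> f"

definition hecke_of :: "nat \<Rightarrow> word set \<Rightarrow> hecke_elem"
  where "hecke_of n x = hecke_proj n (Poly_Mapping.single x 1)"

text \<open>The operations on cosets below are unions over representatives, as in
  \<^const>\<open>rcoset_mult\<close>: the united cosets all coincide.\<close>

definition hecke_smult :: "nat \<Rightarrow> K \<Rightarrow> hecke_elem \<Rightarrow> hecke_elem"
  where "hecke_smult n c X = (\<Union>f\<in>X. hecke_proj n (Poly_Mapping.map ((*) c) f))"

definition hecke_incl :: "nat \<Rightarrow> hecke_elem \<Rightarrow> hecke_elem"
  where "hecke_incl n X = (\<Union>f\<in>X. hecke_proj (n + 1)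
    (\<Sum>x\<in>Poly_Mapping.keys f. Poly_Mapping.single (SB_inclusion n x) (Poly_Mapping.lookup f x)))"

text \<open>An element of the monoid algebra with all keys in \<^term>\<open>SdB d n\<close> is exactly a finite
  \<^typ>\<open>K\<close>-linear combination of elements of \<^term>\<open>SdB d n\<close>, so this is the linear span of the image of
  \<^term>\<open>SdB d n\<close> in the quotient.\<close>

definition HSd :: "nat \<Rightarrow> nat \<Rightarrow> hecke_elem set"
  where "HSd d n = hecke_proj n ` {f. Poly_Mapping.keys f \<subseteq> SdB d n}"


section \<open>Markov traces\<close>

text \<open>A family of maps is a function of \<open>n\<close> and of the algebra element. It is normalised to vanish for
  \<open>n = 0\<close> and outside \<^term>\<open>HSd d n\<close>, so that equal families of maps are equal functions.\<close>

type_synonym trace_family = "nat \<Rightarrow> hecke_elem \<Rightarrow> Kz"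

definition TR :: "nat \<Rightarrow> trace_family set"
  where "TR d = {tr.
    (\<forall>n x. (n = 0 \<or> x \<notin> HSd d n) \<longrightarrow> tr n x = 0) \<and>
    (\<forall>n\<ge>1.
      (\<forall>x\<in>HSd d n. \<forall>y\<in>HSd d n. tr n (x \<oplus>\<^bsub>hecke n\<^esub> y) = tr n x + tr n y) \<and>
      (\<forall>c. \<forall>x\<in>HSd d n. tr n (hecke_smult n c x) = K_to_Kz c * tr n x) \<and>
      (\<forall>k l. k + l = d \<longrightarrow> (\<forall>\<alpha>\<in>SdB k n. \<forall>\<beta>\<in>SdB l n.
        tr n (hecke_of n (\<alpha> \<otimes>\<^bsub>SB n\<^esub> \<beta>)) = tr n (hecke_of n (\<beta> \<otimes>\<^bsub>SB n\<^esub> \<alpha>)))) \<and>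
      (\<forall>x\<in>HSd d n. tr (n + 1) (hecke_incl n x) = tr n x) \<and>
      (\<forall>\<beta>\<in>SdB d n.
        tr (n + 1) (hecke_incl n (hecke_of n \<beta>)
                      \<otimes>\<^bsub>hecke (n + 1)\<^esub> hecke_of (n + 1) (braid_class (n + 1) [Sig n]))
          = z_var * tr n (hecke_of n \<beta>)))}"

definition trace_scale :: "Kz \<Rightarrow> trace_family \<Rightarrow> trace_family"
  where "trace_scale c tr = (\<lambda>n x. c * tr n x)"

global_interpretation traces: vector_space trace_scale
  by standard (auto simp: trace_scale_def fun_eq_iff algebra_simps)


section \<open>The maps from degree d to degree d + 1 and the basic traces\<close>

definition ocneanu_trace :: trace_family
  where "ocneanu_trace = (THE tr. tr \<in> TR 0 \<and> tr 1 \<one>\<^bsub>hecke 1\<^esub> = 1)"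

definition desingularize :: "nat \<Rightarrow> word \<Rightarrow> nat \<Rightarrow> word"
  where "desingularize \<epsilon> w j =
    take j w @ (if \<epsilon> = 0 then [] else [Sig (idx (w ! j))]) @ drop (Suc j) w"

text \<open>Words with all their letters stand for the products \<open>\<alpha>\<^sub>0 \<tau> \<alpha>\<^sub>1 \<tau> \<dots>\<close>: each \<open>\<alpha>\<^sub>j\<close> is a subword
  without letters \<open>\<tau>\<close>. The map is pinned down as a function by being \<^term>\<open>undefined\<close> off its domain.\<close>

definition g_map :: "nat \<Rightarrow> nat \<Rightarrow> nat \<Rightarrow> hecke_elem \<Rightarrow> hecke_elem"
  where "g_map \<epsilon> d n = (THE h.
    h \<in> HSd (d + 1) n \<rightarrow>\<^sub>E HSd d n \<and>
    (\<forall>x\<in>HSd (d + 1) n. \<forall>y\<in>HSd (d + 1) n. h (x \<oplus>\<^bsub>hecke n\<^esub> y) = h x \<oplus>\<^bsub>hecke n\<^esub> h y) \<and>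
    (\<forall>c. \<forall>x\<in>HSd (d + 1) n. h (hecke_smult n c x) = hecke_smult n c (h x)) \<and>
    (\<forall>w\<in>words n. length (filter is_Tau w) = d + 1 \<longrightarrow>
      h (hecke_of n (braid_class n w)) =
        (\<Oplus>\<^bsub>hecke n\<^esub>j\<in>{j. j < length w \<and> is_Tau (w ! j)}.
           hecke_of n (braid_class n (desingularize \<epsilon> w j)))))"

definition \<Phi> :: "nat \<Rightarrow> nat \<Rightarrow> trace_family \<Rightarrow> trace_family"
  where "\<Phi> \<epsilon> d tr = (\<lambda>n x. if n \<ge> 1 \<and> x \<in> HSd (d + 1) n then tr n (g_map \<epsilon> d n x) else 0)"

text \<open>\<open>T_trace d k\<close> is meaningful for \<open>k \<le> d\<close>.\<close>

primrec T_trace :: "nat \<Rightarrow> nat \<Rightarrow> trace_family"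
  where
    "T_trace 0 = (\<lambda>k. ocneanu_trace)"
  | "T_trace (Suc d) = (\<lambda>k. if k \<le> d then \<Phi> 0 d (T_trace d k) else \<Phi> 1 d (T_trace d d))"

end

theory Submission
  imports Defs
begin

text \<open>A Markov trace of degree \<open>d\<close> is the same as a function \<open>f\<close> on the union of the monoids
  \<open>SB\<^sub>n\<close>, supported on elements with \<open>d\<close> singular points, that is invariant under cyclic
  permutation and satisfies the Hecke and stabilisation relations. Such an \<open>f\<close> has two contractions
  of degree \<open>d - 1\<close>, \<open>w \<mapsto> f (w \<tau>\<^sub>n)\<close> and \<open>w \<mapsto> f (w \<tau>\<^sub>n \<sigma>\<^sub>n)\<close> with \<open>n\<close> beyond the
  strands of \<open>w\<close>. They do not depend on \<open>n\<close> and, because \<open>\<sigma>\<^sub>n\<^sub>+\<^sub>1 \<sigma>\<^sub>n\<^sup>2 \<sigma>\<^sub>n\<^sub>+\<^sub>1\<close> commutes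
  with \<open>\<tau>\<^sub>n\<close> and \<open>q + (q - 1) z - z\<^sup>2 \<noteq> 0\<close>, they jointly determine \<open>f\<close>. Suitable linear combinations
  \<open>\<Theta>\<^sub>0, \<Theta>\<^sub>1\<close> of the contractions commute and satisfy \<open>\<Theta>\<^sub>i \<Phi>\<^sub>j = \<Phi>\<^sub>j \<Theta>\<^sub>i + \<delta>\<^sub>i\<^sub>j\<close>, like
  partial derivatives and multiplication by variables. Hence \<open>T\<^sub>k\<^sup>d\<close> plays the role of the monomial
  \<open>x\<^sub>0\<^sup>d\<^sup>-\<^sup>k x\<^sub>1\<^sup>k\<close>: applying the \<open>\<Theta>\<^sub>i\<close> gives independence, and Euler's identity
  \<open>d f = \<Phi>\<^sub>0 \<Theta>\<^sub>0 f + \<Phi>\<^sub>1 \<Theta>\<^sub>1 f\<close> gives spanning, by induction from the Ocneanu trace in degree 0.\<close>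

section \<open>The ground fields\<close>

text \<open>The constant q + (q - 1) z - z^2 is a determinant. Contracting with tau_n or tau_n
  sigma_n and then resolving the new point to 1 or sigma_n leaves 1, sigma_n, sigma_n or sigma_n^2,
  whose trace factors form the symmetric matrix with rows (1, z) and (z, (q - 1) z + q); its inverse
  gives the coefficients of the operators \<Theta>. The same constant decides the linear system by
  which the contractions determine f. The obstacle in positive degree is that tau_n satisfies no
  quadratic relation and no Markov rule: all that is known is what it commutes with. Expanding a
  commutation by the Hecke relation leaves a multiple of q - 1, and cancelling this factor yields
  the identity that lets a singular point slide along distant strands and lets any singular point be
  compared with one attached along a single strand. In degree 0 the reduction of braid words proves
  uniqueness but not consistency. Consistency comes from matrices, which exist only for special
  values of z; since there are infinitely many of them, identities between polynomials in z can be
  checked there.\<close>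

lemma K_to_Kz_simps [simp]:
  "K_to_Kz 0 = 0" "K_to_Kz 1 = 1"
  "K_to_Kz (x + y) = K_to_Kz x + K_to_Kz y" "K_to_Kz (x * y) = K_to_Kz x * K_to_Kz y"
  "K_to_Kz (x - y) = K_to_Kz x - K_to_Kz y" "K_to_Kz (- x) = - K_to_Kz x"
  by (simp_all add: K_to_Kz_def pCons_one flip: to_fract_mult to_fract_add to_fract_diff to_fract_uminus)

lemma K_to_Kz_eq_iff [simp]: "K_to_Kz x = K_to_Kz y \<longleftrightarrow> x = y"
  by (simp add: K_to_Kz_def)

abbreviation qq :: Kz where "qq \<equiv> K_to_Kz q_var"

lemma q_var_simps: "q_var \<noteq> 0" "q_var \<noteq> 1"
  unfolding q_var_def to_fract_1[symmetric] to_fract_eq_iff to_fract_eq_0_iff by (simp_all add: one_pCons)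

lemma qq_simps [simp]: "qq \<noteq> 0" "qq \<noteq> 1" "qq - 1 \<noteq> 0"
  using q_var_simps K_to_Kz_eq_iff[of q_var 0] K_to_Kz_eq_iff[of q_var 1] by auto

text \<open>As a polynomial in z over K it has leading coefficient -1. It is inverted in
  \<open>theta_coeff\<close> and cancelled in \<open>psi_injective\<close>.\<close>

lemma discriminant_nonzero: "qq + (qq - 1) * z_var - z_var * z_var \<noteq> 0"
proof -
  have "qq + (qq - 1) * z_var - z_var * z_var = to_fract [:q_var, q_var - 1, -1:]"
    by (simp add: K_to_Kz_def z_var_def to_fract_def[symmetric] one_pCons
        flip: to_fract_mult to_fract_add to_fract_diff to_fract_1)
  then show ?thesis by simp
qed

text \<open>Characteristic 0 is what allows division by the degree in Euler's identity and by the
  exponents produced by differentiation.\<close>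

lemma of_nat_Kz_eq_0_iff [simp]: "(of_nat n :: Kz) = 0 \<longleftrightarrow> n = 0"
proof -
  have "(of_nat n :: K) = to_fract [:of_nat n:]"
    by (induction n) (simp_all add: one_pCons flip: to_fract_add to_fract_1)
  then have "(of_nat n :: K) = 0 \<longleftrightarrow> n = 0"
    by simp
  moreover have "(of_nat n :: Kz) = K_to_Kz (of_nat n)"
    by (induction n) simp_all
  ultimately show ?thesis
    using K_to_Kz_eq_iff[of "of_nat n" 0] by simp
qed

lemma q_var_power_eq_iff: "q_var ^ m = q_var ^ n \<longleftrightarrow> m = n"
proof -
  have *: "q_var ^ m = to_fract (monom 1 m)" for m
    by (induction m) (simp_all add: q_var_def monom_Suc one_pCons flip: to_fract_mult to_fract_1)
  show ?thesis
    unfolding * by (metis degree_monom_eq one_neq_zero to_fract_eq_iff)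
qed


section \<open>The stable singular braid monoid\<close>

text \<open>In \<open>rel\<close> the number \<open>n\<close> is free, so the relations of all
  \<open>SB n\<close> are imposed at once: on words without letters of index 0 this is the direct
  limit along the inclusions. The contexts are arbitrary words; index 0 is excluded afterwards by
  \<open>valid\<close>.\<close>

inductive stable_eq :: "word \<Rightarrow> word \<Rightarrow> bool"
  where
    rel: "defining_relation n r s \<Longrightarrow> stable_eq (a @ r @ b) (a @ s @ b)"
  | refl: "stable_eq w w"
  | sym: "stable_eq u v \<Longrightarrow> stable_eq v u"
  | trans: "stable_eq u v \<Longrightarrow> stable_eq v w \<Longrightarrow> stable_eq u w"

lemma stable_eq_context: "stable_eq u v \<Longrightarrow> stable_eq (a @ u @ b) (a @ v @ b)"
proof (induction rule: stable_eq.induct)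
  case (rel n r s a' b')
  then show ?case
    using stable_eq.rel[of n r s "a @ a'" "b' @ b"] by simp
qed (auto intro: stable_eq.intros)

lemma stable_eq_append:
  assumes "stable_eq u u'" "stable_eq v v'"
  shows "stable_eq (u @ v) (u' @ v')"
  using stable_eq_context[OF assms(1), of "[]" v] stable_eq_context[OF assms(2), of u' "[]"]
  by (auto intro: stable_eq.trans)

quotient_type sbraid = word / stable_eq
  morphisms rep_sbraid cls
  by (intro equivpI reflpI sympI transpI) (auto intro: stable_eq.intros)

lemma cls_eq_iff: "cls u = cls v \<longleftrightarrow> stable_eq u v"
  by (rule sbraid.abs_eq_iff)

lemma cls_rep: "cls (rep_sbraid x) = x"
  by (rule Quotient_abs_rep[OF Quotient_sbraid])

instantiation sbraid :: monoid_mult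
begin

lift_definition one_sbraid :: sbraid is "[]" .

lift_definition times_sbraid :: "sbraid \<Rightarrow> sbraid \<Rightarrow> sbraid" is "(@)"
  by (rule stable_eq_append)

instance
  by standard (transfer, simp add: stable_eq.refl)+

end

lemma cls_Nil: "cls [] = 1"
  by transfer (rule stable_eq.refl)

lemma cls_append: "cls (u @ v) = cls u * cls v"
  by transfer (rule stable_eq.refl)

lemma cls_Cons: "cls (x # v) = cls [x] * cls v"
  using cls_append[of "[x]" v] by simp

definition sg :: "nat \<Rightarrow> sbraid" where "sg k = cls [Sig k]"
definition sgi :: "nat \<Rightarrow> sbraid" where "sgi k = cls [SigInv k]"

text \<open>\<open>ta 0 k\<close> is \<open>\<tau>\<^sub>k\<close> and \<open>ta 1 k\<close> is \<open>\<tau>\<^sub>k \<sigma>\<^sub>k\<close>; both satisfy the same mixed relations.\<close>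

definition ta :: "nat \<Rightarrow> nat \<Rightarrow> sbraid"
  where "ta e k = cls [Tau k] * (if e = 0 then 1 else sg k)"

lemma cls_simps:
  "cls (Sig k # w) = sg k * cls w"
  "cls (SigInv k # w) = sgi k * cls w"
  "cls (Tau k # w) = ta 0 k * cls w"
  by (simp_all add: cls_Cons[of _ w] sg_def sgi_def ta_def)

lemma cls_relation: "defining_relation n r s \<Longrightarrow> cls r = cls s"
  using stable_eq.rel[of n r s "[]" "[]"] by (simp add: cls_eq_iff)

lemma sg_sgi [simp]: "1 \<le> k \<Longrightarrow> sg k * sgi k = 1"
  and sgi_sg [simp]: "1 \<le> k \<Longrightarrow> sgi k * sg k = 1"
  using cls_relation[OF defining_relation.intros(1)[of k "Suc k"]]
    cls_relation[OF defining_relation.intros(2)[of k "Suc k"]]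
  by (simp_all add: cls_simps cls_Nil)

lemma sg_sgi_assoc [simp]: "1 \<le> k \<Longrightarrow> sg k * (sgi k * x) = x"
  and sgi_sg_assoc [simp]: "1 \<le> k \<Longrightarrow> sgi k * (sg k * x) = x"
  by (simp_all flip: mult.assoc)

lemma braid_relation:
  "1 \<le> k \<Longrightarrow> sg k * (sg (Suc k) * sg k) = sg (Suc k) * (sg k * sg (Suc k))"
  using cls_relation[OF defining_relation.intros(4)[of k "Suc (Suc k)" "Suc k"]]
  by (simp add: cls_simps cls_Nil)

lemma ta_alt: "ta e k = ta 0 k * (if e = 0 then 1 else sg k)"
  by (simp add: ta_def)

lemma ta_sg: "1 \<le> k \<Longrightarrow> ta e k * sg k = sg k * ta e k"
  using cls_relation[OF defining_relation.intros(3)[of k "Suc k"]] ta_alt[of e k]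
  by (simp add: cls_simps cls_Nil) (metis mult.assoc)

lemma sg_sg_tau_up:
  assumes "1 \<le> k"
  shows "sg k * (sg (Suc k) * ta e k) = ta e (Suc k) * (sg k * sg (Suc k))"
proof -
  have "sg k * (sg (Suc k) * ta 0 k) = ta 0 (Suc k) * (sg k * sg (Suc k))"
    using cls_relation[OF defining_relation.intros(5)[of k "Suc (Suc k)" "Suc k"]] assms
    by (simp add: cls_simps cls_Nil)
  then show ?thesis
    using braid_relation[OF assms] ta_alt[of e k] ta_alt[of e "Suc k"]
    by (cases "e = 0") (simp_all, metis mult.assoc)
qed

lemma sg_sg_tau_down:
  assumes "1 \<le> k"
  shows "sg (Suc k) * (sg k * ta e (Suc k)) = ta e k * (sg (Suc k) * sg k)"
proof -
  have "sg (Suc k) * (sg k * ta 0 (Suc k)) = ta 0 k * (sg (Suc k) * sg k)"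
    using cls_relation[OF defining_relation.intros(5)[of "Suc k" "Suc (Suc k)" k]] assms
    by (simp add: cls_simps cls_Nil)
  then show ?thesis
    using braid_relation[OF assms] ta_alt[of e k] ta_alt[of e "Suc k"]
    by (cases "e = 0") (simp_all, metis mult.assoc)
qed

lemma commute_mult:
  fixes g x y :: "'a::monoid_mult"
  assumes "g * x = x * g" "g * y = y * g"
  shows "g * (x * y) = x * y * g"
  by (metis assms mult.assoc)

lemma far_commute:
  assumes "1 \<le> k" "1 \<le> l" "k + 2 \<le> l \<or> l + 2 \<le> k"
  shows "sg k * sg l = sg l * sg k" "sg k * ta e l = ta e l * sg k" "ta e k * ta e' l = ta e' l * ta e k"
proof -
  let ?n = "Suc (max k l)"
  have d: "\<bar>int k - int l\<bar> \<ge> 2" "\<bar>int l - int k\<bar> \<ge> 2"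
    using assms(3) by auto
  show 1: "sg k * sg l = sg l * sg k"
    using cls_relation[OF defining_relation.intros(6)[of k ?n l]] d assms
    by (simp add: cls_simps cls_Nil)
  have 2: "sg k * ta 0 l = ta 0 l * sg k" "sg l * ta 0 k = ta 0 k * sg l"
    using cls_relation[OF defining_relation.intros(7)[of k ?n l]]
      cls_relation[OF defining_relation.intros(7)[of l ?n k]] d assms
    by (simp_all add: cls_simps cls_Nil)
  have 3: "ta 0 k * ta 0 l = ta 0 l * ta 0 k"
    using cls_relation[OF defining_relation.intros(8)[of k ?n l]] d assms
    by (simp add: cls_simps cls_Nil)
  have 4: "sg k * ta e l = ta e l * sg k" for e
    unfolding ta_alt[of e] using 1 2 by (intro commute_mult) auto
  have 5: "ta 0 k * ta e l = ta e l * ta 0 k" for e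
    unfolding ta_alt[of e] using 2 3 by (intro commute_mult) auto
  show "sg k * ta e l = ta e l * sg k"
    by (rule 4)
  have "ta e' l * ta e k = ta e k * ta e' l"
    unfolding ta_alt[of e] using 4 5 by (intro commute_mult) auto
  then show "ta e k * ta e' l = ta e' l * ta e k"
    by simp
qed

lemma commute_inverse:
  fixes g h x :: "'a::monoid_mult"
  assumes "g * h = 1" "h * g = 1" "g * x = x * g"
  shows "h * x = x * h"
  by (metis assms mult.assoc mult_1_left mult_1_right)

section \<open>Grading by singular points and filtration by strands\<close>

definition valid :: "word \<Rightarrow> bool" where "valid w \<longleftrightarrow> (\<forall>x \<in> set w. 1 \<le> idx x)"

definition taus :: "word \<Rightarrow> nat" where "taus w = length (filter is_Tau w)"

lemma valid_simps [simp]: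
  "valid []" "valid (x # w) \<longleftrightarrow> 1 \<le> idx x \<and> valid w" "valid (u @ v) \<longleftrightarrow> valid u \<and> valid v"
  by (auto simp: valid_def)

lemma taus_simps [simp]:
  "taus [] = 0" "taus (x # w) = (if is_Tau x then Suc (taus w) else taus w)"
  "taus (u @ v) = taus u + taus v"
  by (auto simp: taus_def)

lemma words_simps [simp]:
  "[] \<in> words n" "x # w \<in> words n \<longleftrightarrow> 1 \<le> idx x \<and> idx x < n \<and> w \<in> words n"
  "u @ v \<in> words n \<longleftrightarrow> u \<in> words n \<and> v \<in> words n"
  by (auto simp: words_def)

lemma words_valid: "w \<in> words n \<Longrightarrow> valid w"
  by (auto simp: words_def valid_def)

lemma words_mono: "w \<in> words m \<Longrightarrow> m \<le> n \<Longrightarrow> w \<in> words n"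
  by (fastforce simp: words_def)

lemma valid_words: "valid w \<Longrightarrow> \<exists>m\<ge>1. \<forall>n\<ge>m. w \<in> words n"
proof (induction w)
  case Nil
  then show ?case by auto
next
  case (Cons x w)
  then obtain m where "m \<ge> 1" "\<forall>n\<ge>m. w \<in> words n"
    by auto
  then show ?case
    using Cons.prems by (intro exI[of _ "max m (Suc (idx x))"]) auto
qed

lemma defining_relation_invariants:
  "defining_relation n r s \<Longrightarrow> r \<in> words n \<and> s \<in> words n \<and> taus r = taus s"
  by (induction rule: defining_relation.induct) auto

lemma defining_relation_mono: "defining_relation m r s \<Longrightarrow> m \<le> n \<Longrightarrow> defining_relation n r s"
  by (induction rule: defining_relation.induct) (auto intro!: defining_relation.intros)

lemma stable_eq_invariants: "stable_eq u v \<Longrightarrow> valid u = valid v \<and> taus u = taus v"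
proof (induction rule: stable_eq.induct)
  case (rel n r s a b)
  then show ?case
    using defining_relation_invariants[OF rel] words_valid[of r n] words_valid[of s n] by auto
qed auto

lemma braid_eq_words: "braid_eq n u v \<Longrightarrow> u \<in> words n \<and> v \<in> words n"
  by (induction rule: braid_eq.induct) (auto dest: defining_relation_invariants)

lemma braid_eq_stable_eq: "braid_eq n u v \<Longrightarrow> stable_eq u v"
  by (induction rule: braid_eq.induct) (auto intro: stable_eq.intros)

text \<open>A derivation of a stable equivalence passes through finitely many words, which all lie
  in \<open>words m\<close> for large m. Validity of \<open>u\<close> spreads along the derivation
  because it is an invariant.\<close>

lemma stable_eq_braid_eq:
  "stable_eq u v \<Longrightarrow> valid u \<Longrightarrow> \<exists>m. \<forall>n\<ge>m. braid_eq n u v"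
proof (induction rule: stable_eq.induct)
  case (rel k r s a b)
  then obtain m where "\<forall>n\<ge>m. a \<in> words n \<and> b \<in> words n"
    using valid_words[of a] valid_words[of b] by (metis max.bounded_iff valid_simps(3))
  then show ?case
    using rel by (intro exI[of _ "max m k"]) (auto intro!: braid_eq.rel dest: defining_relation_mono)
next
  case (refl w)
  then show ?case
    using valid_words[of w] by (auto intro: braid_eq.refl)
next
  case (sym u v)
  then show ?case
    using stable_eq_invariants[of u v] by (blast intro: braid_eq.sym)
next
  case (trans u v w)
  then obtain m m' where "\<forall>n\<ge>m. braid_eq n u v" "\<forall>n\<ge>m'. braid_eq n v w"
    using stable_eq_invariants[of u v] by blast
  then show ?case
    by (intro exI[of _ "max m m'"]) (auto intro: braid_eq.trans)
qed

definition strands :: "nat \<Rightarrow> sbraid set" where "strands n = cls ` words n"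

definition graded :: "nat \<Rightarrow> sbraid set" where "graded d = cls ` {w. valid w \<and> taus w = d}"

lemma cls_graded_iff [simp]: "cls w \<in> graded d \<longleftrightarrow> valid w \<and> taus w = d"
  by (auto simp: graded_def cls_eq_iff dest: stable_eq_invariants)

lemma graded_disjoint: "x \<in> graded d \<Longrightarrow> x \<in> graded d' \<Longrightarrow> d = d'"
  by (metis cls_graded_iff cls_rep)

lemma cls_strands: "w \<in> words n \<Longrightarrow> cls w \<in> strands n"
  by (simp add: strands_def)

lemma strands_one [simp]: "1 \<in> strands n"
  using cls_strands[of "[]" n] by (simp add: cls_Nil)

lemma strands_mult [simp]: "x \<in> strands n \<Longrightarrow> y \<in> strands n \<Longrightarrow> x * y \<in> strands n"
  unfolding strands_def by (auto simp flip: cls_append)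

lemma strands_generators [simp]:
  assumes "1 \<le> k" "k < n"
  shows "sg k \<in> strands n" "sgi k \<in> strands n" "ta e k \<in> strands n"
proof -
  show *: "sg k \<in> strands n" "sgi k \<in> strands n"
    using assms by (auto simp: sg_def sgi_def intro: cls_strands)
  have "cls [Tau k] \<in> strands n"
    using assms by (intro cls_strands) auto
  then show "ta e k \<in> strands n"
    using * by (simp add: ta_def)
qed

lemma strands_mono: "x \<in> strands m \<Longrightarrow> m \<le> n \<Longrightarrow> x \<in> strands n"
  by (auto simp: strands_def intro: words_mono)

lemma graded_strands: "x \<in> graded d \<Longrightarrow> \<exists>n\<ge>1. x \<in> strands n"
  unfolding graded_def using valid_words cls_strands by blast

lemma graded_mult: "x \<in> graded d \<Longrightarrow> y \<in> graded e \<Longrightarrow> x * y \<in> graded (d + e)"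
  unfolding graded_def[of d] graded_def[of e] by (auto simp flip: cls_append)

lemma graded_mult_cases:
  assumes "x * y \<in> graded d"
  obtains k l where "x \<in> graded k" "y \<in> graded l" "k + l = d"
  using assms cls_append[of "rep_sbraid x" "rep_sbraid y"] cls_rep cls_graded_iff
    taus_simps(3) valid_simps(3) by metis

lemma graded_generators [simp]:
  assumes "1 \<le> k"
  shows "1 \<in> graded 0" "sg k \<in> graded 0" "sgi k \<in> graded 0" "ta e k \<in> graded (Suc 0)"
proof -
  show 1: "1 \<in> graded 0" "sg k \<in> graded 0" "sgi k \<in> graded 0"
    using assms by (auto simp: sg_def sgi_def simp flip: cls_Nil)
  have "cls [Tau k] \<in> graded 1"
    using assms by simp
  from graded_mult[OF this 1(1)] graded_mult[OF this 1(2)] show "ta e k \<in> graded (Suc 0)"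
    by (simp add: ta_def)
qed

lemma graded_mult_cancel:
  assumes "y \<in> graded e"
  shows "x * y \<in> graded (d + e) \<longleftrightarrow> x \<in> graded d" "y * x \<in> graded (d + e) \<longleftrightarrow> x \<in> graded d"
  using assms graded_mult[of x d y e] graded_mult[of y e x d]
  by (auto simp: add.commute elim!: graded_mult_cases dest: graded_disjoint)

lemma graded_mult_commute: "x * y \<in> graded d \<longleftrightarrow> y * x \<in> graded d"
proof -
  have "y * x \<in> graded d" if "x * y \<in> graded d" for x y
    by (rule graded_mult_cases[OF that]) (metis add.commute graded_mult)
  then show ?thesis by blast
qed

text \<open>Braid letters are invertible of degree 0. Hence outside degree d all terms of a Hecke
  relation vanish together, which settles the cases without support later on.\<close>

lemma graded_insert_sg:
  "1 \<le> k \<Longrightarrow> x * (sg k * y) \<in> graded d \<longleftrightarrow> x * y \<in> graded d"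
  "1 \<le> k \<Longrightarrow> x * (sgi k * y) \<in> graded d \<longleftrightarrow> x * y \<in> graded d"
  using graded_mult_cancel(2)[of "sg k" 0 "y * x" d] graded_mult_cancel(2)[of "sgi k" 0 "y * x" d]
    graded_mult_commute[of x _ d]
  by (simp_all add: mult.assoc)

lemma common_strands:
  assumes "x * y \<in> graded d"
  obtains n where "m \<le> n" "1 \<le> n" "x \<in> strands n" "y \<in> strands n"
proof -
  obtain k l where "x \<in> graded k" "y \<in> graded l"
    using graded_mult_cases[OF assms] by blast
  then obtain n n' where "x \<in> strands n" "y \<in> strands n'"
    using graded_strands by blast
  then show ?thesis
    by (intro that[of "Suc (max m (max n n'))"]) (auto intro: strands_mono)
qed

text \<open>Letters on n strands have index at most n - 1, so they are at distance at least 2 from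
  every index k > n.\<close>

lemma strands_commute:
  assumes "x \<in> strands n" "n < k"
  shows "sg k * x = x * sg k" "sgi k * x = x * sgi k" "ta e k * x = x * ta e k"
proof -
  have "sg k * cls w = cls w * sg k \<and> ta e k * cls w = cls w * ta e k" if "w \<in> words n" for w
    using that
  proof (induction w)
    case Nil
    then show ?case by (simp add: cls_Nil)
  next
    case (Cons x w)
    let ?i = "idx x"
    have i: "1 \<le> ?i" "?i + 2 \<le> k" "1 \<le> k"
      using Cons.prems assms by auto
    have s: "sg ?i * sg k = sg k * sg ?i" "sg ?i * ta e k = ta e k * sg ?i" for e
      using i by (auto intro: far_commute)
    have si: "sgi ?i * sg k = sg k * sgi ?i" "sgi ?i * ta e k = ta e k * sgi ?i" for e
      by (rule commute_inverse[of "sg ?i"], use i s in auto)+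
    have t: "ta 0 ?i * ta e k = ta e k * ta 0 ?i" "sg k * ta 0 ?i = ta 0 ?i * sg k" for e
      using i by (auto intro: far_commute)
    have *: "sg k * cls w = cls w * sg k" "ta e k * cls w = cls w * ta e k"
      using Cons by auto
    have "g * cls (x # w) = cls (x # w) * g" if "g = sg k \<or> g = ta e k" for g
      unfolding cls_Cons[of x w]
      using that * s si t
      by (intro commute_mult) (cases x; auto simp: cls_simps cls_Nil)+
    then show ?case by auto
  qed
  with assms show s: "sg k * x = x * sg k" and "ta e k * x = x * ta e k"
    by (auto simp: strands_def)
  show "sgi k * x = x * sgi k"
    by (rule commute_inverse[of "sg k"]) (use s assms in auto)
qed

section \<open>Word identities on three adjacent strands\<close>

text \<open>Models a = sigma_n, b = sigma_(n+1), their inverses a', b', and s, t = tau_n, tau_(n+1),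
  or tau_n sigma_n, tau_(n+1) sigma_(n+1). The relations are isolated here so that right-nested
  forms can serve as rewrite rules.\<close>

locale singular_triple =
  fixes a b a' b' s t :: "'a::monoid_mult"
  assumes inv: "a * a' = 1" "a' * a = 1" "b * b' = 1" "b' * b = 1"
    and aba: "a * (b * a) = b * (a * b)"
    and up: "a * (b * s) = t * (a * b)"
    and down: "b * (a * t) = s * (b * a)"
    and sa: "s * a = a * s"
    and tb: "t * b = b * t"
begin

lemma inv_assoc: "a * (a' * x) = x" "a' * (a * x) = x" "b * (b' * x) = x" "b' * (b * x) = x"
  using inv by (simp_all flip: mult.assoc)

lemma sa': "s * a' = a' * s" and tb': "t * b' = b' * t"
  using commute_inverse[OF inv(1,2)] commute_inverse[OF inv(3,4)] sa tb by auto

lemma rel_assoc: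
  "a * (b * (a * x)) = b * (a * (b * x))" "a * (b * (s * x)) = t * (a * (b * x))"
  "b * (a * (t * x)) = s * (b * (a * x))" "s * (a * x) = a * (s * x)" "t * (b * x) = b * (t * x)"
  "s * (a' * x) = a' * (s * x)" "t * (b' * x) = b' * (t * x)"
  using aba up down sa tb sa' tb' by (simp_all flip: mult.assoc)

text \<open>The braid b a a b carries the third strand once around the first two, so whatever
  happens on those two can be moved past it.\<close>

lemma palindrome: "s * (b * (a * (a * b))) = b * (a * (a * (b * s)))"
  by (simp add: up flip: rel_assoc(3))

lemma conj_inner: "a * (b * (a * (s * b'))) = t * (b * a)"
proof -
  have "a * (b * (a * (s * b'))) = t * (a * (b * (a * b')))"
    by (simp add: rel_assoc(2) flip: rel_assoc(4))
  also have "\<dots> = t * (b * a)"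
    by (simp add: rel_assoc(1) inv)
  finally show ?thesis .
qed

lemma conj_b: "b * (s * b') = a' * (t * a)"
proof -
  have "a' * (t * a) = a' * (t * (a * (b * b')))"
    by (simp add: inv)
  also have "\<dots> = b * (s * b')"
    by (simp add: inv_assoc flip: rel_assoc(2))
  finally show ?thesis by simp
qed

lemma conj_ba: "b * (a * b') = a' * (b * a)"
proof -
  have "a' * (b * a) = a' * (b * (a * (b * b')))"
    by (simp add: inv)
  also have "\<dots> = b * (a * b')"
    by (simp add: inv_assoc flip: rel_assoc(1))
  finally show ?thesis by simp
qed

lemma conj_ba': "b * (a' * b') = a' * (b' * a)"
proof -
  have "a' * (b' * a) = a' * (b' * (a * (b * (a * (a' * b')))))"
    by (simp add: inv inv_assoc)
  also have "\<dots> = b * (a' * b')"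
    by (simp only: rel_assoc(1)) (simp add: inv_assoc)
  finally show ?thesis by simp
qed

lemma up': "b' * (a' * t) = s * (b' * a')"
proof -
  have "s * (b' * a') = b' * (a' * (a * (b * (s * (b' * a')))))"
    by (simp only: inv_assoc)
  also have "\<dots> = b' * (a' * t)"
    by (simp only: rel_assoc(2) inv_assoc inv mult_1_right)
  finally show ?thesis by simp
qed

lemma t_eq: "t = a' * (b' * (s * (b * a)))"
  by (simp add: inv_assoc flip: down)

text \<open>Conjugation by the half twist a b a, whose inverse is a' b' a', exchanges the two
  adjacent positions.\<close>

lemma conj_aba: "a * (b * (a * (s * (a' * (b' * a'))))) = t"
proof -
  have "a * (b * (a * (s * (a' * (b' * a'))))) = a * (b * (s * (b' * a')))"
    by (simp add: rel_assoc(6) inv_assoc)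
  also have "\<dots> = t"
    by (simp add: rel_assoc(2) inv inv_assoc)
  finally show ?thesis .
qed

lemma b_conj: "b * (s * (a' * (b' * a'))) = a' * (t * b')"
proof -
  have "b * (s * (a' * (b' * a'))) = b * (a' * (s * (b' * a')))"
    by (simp add: rel_assoc(6))
  also have "\<dots> = b * (a' * (b' * (a' * t)))"
    by (simp add: up')
  also have "\<dots> = a' * (b' * (a * (a' * t)))"
    using conj_ba' by (simp flip: mult.assoc)
  also have "\<dots> = a' * (t * b')"
    by (simp add: inv_assoc tb')
  finally show ?thesis .
qed

end

lemma singular_triple_ta:
  "1 \<le> n \<Longrightarrow> singular_triple (sg n) (sg (Suc n)) (sgi n) (sgi (Suc n)) (ta e n) (ta e (Suc n))"
  by unfold_locales (auto simp: braid_relation sg_sg_tau_up sg_sg_tau_down ta_sg)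


section \<open>Markov functionals\<close>

text \<open>Compatibility with the inclusions is built into the domain: an element has one value, on
  however many strands it is viewed. \<open>support\<close> pins down the other degrees, so that
  traces and functionals correspond bijectively.\<close>

locale markov_functional =
  fixes d :: nat and f :: "sbraid \<Rightarrow> Kz"
  assumes support: "x \<notin> graded d \<Longrightarrow> f x = 0"
    and cyclic: "f (x * y) = f (y * x)"
    and quadratic: "1 \<le> k \<Longrightarrow>
      f (x * (sg k * (sg k * y))) = (qq - 1) * f (x * (sg k * y)) + qq * f (x * y)"
    and stabilise: "1 \<le> n \<Longrightarrow> x \<in> strands n \<Longrightarrow> f (x * sg n) = z_var * f x"
begin

lemma inverse_letter: "1 \<le> k \<Longrightarrow> f (x * (sgi k * y)) = (f (x * (sg k * y)) - (qq - 1) * f (x * y)) / qq"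
  using quadratic[of k x "sgi k * y"] by (simp add: field_simps)

lemma stabilise_inverse:
  "1 \<le> n \<Longrightarrow> x \<in> strands n \<Longrightarrow> f (x * sgi n) = (z_var - (qq - 1)) / qq * f x"
  using inverse_letter[of n x 1] stabilise[of n x] by (simp add: field_simps)

text \<open>\<open>\<sigma>\<^sub>n\<^sub>+\<^sub>1 \<sigma>\<^sub>n\<^sup>2 \<sigma>\<^sub>n\<^sub>+\<^sub>1\<close> commutes with \<open>\<tau>\<^sub>n\<close>; expanding the squares and dividing by \<open>q - 1\<close>
  gives a relation with fewer crossings. It is the source of the upper bound on the dimension.\<close>

lemma exchange:
  fixes e :: nat
  assumes "1 \<le> n"
  defines "a \<equiv> sg n" and "b \<equiv> sg (Suc n)" and "t \<equiv> ta e n"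
  shows "f (u * (t * (a * (b * (a * v))))) + qq * f (u * (t * (b * v)))
    = f (u * (a * (b * (a * (t * v))))) + qq * f (u * (b * (t * v)))"
proof -
  interpret singular_triple a b "sgi n" "sgi (Suc n)" t "ta e (Suc n)"
    unfolding assms using assms(1) by (rule singular_triple_ta)
  note quad = quadratic[of n, folded a_def] quadratic[of "Suc n", folded b_def]
  have aba': "b * (a * (b * x)) = a * (b * (a * x))" for x
    using aba by (metis mult.assoc)
  \<comment> \<open>The inner square is expanded first. In its linear term b a b becomes a b a; in
    its constant term the two b meet and are expanded in turn.\<close>
  have "f (u * (t * (b * (a * (a * (b * v)))))) =
      (qq - 1) * f (u * (t * (a * (b * (a * v))))) + qq * ((qq - 1) * f (u * (t * (b * v))) + qq * f (u * (t * v)))"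
    using quad(1)[of "u * (t * b)" "b * v"] quad(2)[of "u * t" v] assms(1)
    by (simp add: mult.assoc aba')
  moreover have "f (u * (b * (a * (a * (b * (t * v)))))) =
      (qq - 1) * f (u * (a * (b * (a * (t * v))))) + qq * ((qq - 1) * f (u * (b * (t * v))) + qq * f (u * (t * v)))"
    using quad(1)[of "u * b" "b * (t * v)"] quad(2)[of "u" "t * v"] assms(1)
    by (simp add: mult.assoc aba')
  moreover have "u * (t * (b * (a * (a * (b * v))))) = u * (b * (a * (a * (b * (t * v)))))"
    using palindrome by (metis mult.assoc)
  \<comment> \<open>The terms in u t v have coefficient q^2 on both sides and cancel; what remains
    carries the factor q - 1.\<close>
  ultimately have "(qq - 1) * (f (u * (t * (a * (b * (a * v))))) + qq * f (u * (t * (b * v))))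
    = (qq - 1) * (f (u * (a * (b * (a * (t * v))))) + qq * f (u * (b * (t * v))))"
    by (simp add: algebra_simps)
  then show ?thesis
    by simp
qed

text \<open>In \<open>exchange\<close> take v = sigma_n^-1 sigma_(n+1)^-1 sigma_n^-1 x. The half
  twist on three strands then cancels in one main term and conjugates tau_n to tau_(n+1) in the
  other, giving the two sides of the claim. The correction terms both reduce, by
  \<open>stabilise_inverse\<close>, to the same multiple of f (s a' x).\<close>

lemma slide:
  assumes "1 \<le> n" "x \<in> strands n"
  shows "f (x * ta e (Suc n)) = f (x * ta e n)"
proof -
  define a b a' b' s t where "a = sg n" and "b = sg (Suc n)" and "a' = sgi n" and "b' = sgi (Suc n)"
    and "s = ta e n" and "t = ta e (Suc n)"
  interpret singular_triple a b a' b' s t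
    unfolding a_def b_def a'_def b'_def s_def t_def using assms(1) by (rule singular_triple_ta)
  let ?c = "(z_var - (qq - 1)) / qq"
  have S: "x \<in> strands (Suc n)" "a \<in> strands (Suc n)" "a' \<in> strands (Suc n)" "s \<in> strands (Suc n)"
    using assms strands_mono[of x n "Suc n"] by (auto simp: a_def a'_def s_def)
  have comm: "b' * x = x * b'"
    unfolding b'_def using strands_commute[of x n "Suc n"] assms by auto
  have fs: "f (y * b') = ?c * f y" if "y \<in> strands (Suc n)" for y
    unfolding b'_def using that by (intro stabilise_inverse) auto
  have 1: "f (s * (b * (a' * (b' * (a' * x))))) = ?c * f (s * (a' * x))"
  proof -
    have "s * (b * (a' * (b' * (a' * x)))) = s * (a' * x) * b'"
      using conj_ba' comm inv_assoc by (metis mult.assoc)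
    then show ?thesis
      using fs S by simp
  qed
  have 2: "f (b * (s * (a' * (b' * (a' * x))))) = ?c * f (s * (a' * x))"
  proof -
    have "b * (s * (a' * (b' * (a' * x)))) = (a' * (t * x)) * b'"
      using b_conj comm by (metis mult.assoc)
    then have "f (b * (s * (a' * (b' * (a' * x))))) = f (b' * (a' * (t * x)))"
      by (simp only: cyclic[of _ b'])
    also have "b' * (a' * (t * x)) = s * (b' * (a' * x))"
      using up' by (metis mult.assoc)
    also have "f \<dots> = f ((a' * (x * s)) * b')"
      using cyclic[of "s * b'" "a' * x"] cyclic[of "a' * (x * s)" b'] by (simp add: mult.assoc)
    also have "\<dots> = ?c * f (a' * (x * s))"
      using fs S by simp
    also have "f (a' * (x * s)) = f (s * (a' * x))"
      using cyclic[of "a' * x" s] by (simp add: mult.assoc)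
    finally show ?thesis .
  qed
  have 3: "s * (a * (b * (a * (a' * (b' * (a' * x)))))) = s * x"
    by (simp add: inv_assoc)
  have 4: "a * (b * (a * (s * (a' * (b' * (a' * x)))))) = t * x"
    using conj_aba by (metis mult.assoc)
  have "f (s * x) = f (t * x)"
    using exchange[OF assms(1), of 1 e "a' * (b' * (a' * x))", folded a_def b_def s_def] 1 2 3 4
    by simp
  then show ?thesis
    unfolding s_def t_def by (simp add: cyclic[of x])
qed

lemma slide_far: "n \<le> m \<Longrightarrow> 1 \<le> n \<Longrightarrow> x \<in> strands n \<Longrightarrow> f (x * ta e m) = f (x * ta e n)"
proof (induction m rule: dec_induct)
  case (step m)
  then show ?case
    using slide[of m x e] strands_mono[of x n m] by simp
qed simp

text \<open>Equation in which the singular point on the right-hand side is attached to the rest along one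
  strand only.\<close>

lemma detach:
  assumes "1 \<le> n" "x \<in> strands (Suc n)"
  shows "z_var * f (ta 0 n * (sg n * x)) + qq * f (ta 0 n * x)
    = f (ta 0 (Suc n) * (sg (Suc n) * (sg n * x))) + qq * f (ta 0 (Suc n) * (sg n * (x * sgi n)))"
proof -
  define a b a' b' s t where "a = sg n" and "b = sg (Suc n)" and "a' = sgi n" and "b' = sgi (Suc n)"
    and "s = ta 0 n" and "t = ta 0 (Suc n)"
  interpret singular_triple a b a' b' s t
    unfolding a_def b_def a'_def b'_def s_def t_def using assms(1) by (rule singular_triple_ta)
  have S: "a \<in> strands (Suc n)" "s \<in> strands (Suc n)"
    using assms by (auto simp: a_def s_def)
  \<comment> \<open>\<open>exchange\<close> will be applied with v = b' x. On the left this leaves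
    at most one b, which \<open>stabilise\<close> removes; on the right it conjugates tau_n into
    tau_(n+1).\<close>
  have 1: "s * (a * (b * (a * (b' * x)))) = s * (b * (a * x))"
    using aba inv_assoc by (metis mult.assoc)
  have 2: "f (s * (b * (a * x))) = z_var * f (s * (a * x))"
  proof -
    have "f (s * (b * (a * x))) = f ((a * (x * s)) * b)"
      by (metis cyclic mult.assoc)
    also have "\<dots> = z_var * f (a * (x * s))"
      unfolding b_def using S assms by (intro stabilise) auto
    also have "f (a * (x * s)) = f (s * (a * x))"
      by (metis cyclic mult.assoc)
    finally show ?thesis .
  qed
  have 3: "s * (b * (b' * x)) = s * x"
    by (simp add: inv_assoc)
  have 4: "a * (b * (a * (s * (b' * x)))) = t * (b * (a * x))"
    using conj_inner by (metis mult.assoc)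
  have 5: "b * (s * (b' * x)) = a' * (t * (a * x))"
    using conj_b by (metis mult.assoc)
  have 6: "f (a' * (t * (a * x))) = f (t * (a * (x * a')))"
    by (metis cyclic mult.assoc)
  show ?thesis
    using exchange[OF assms(1), of 1 0 "b' * x", folded a_def b_def s_def] 1 2 3 4 5 6
    by (simp flip: a_def b_def a'_def s_def t_def)
qed

end

section \<open>Splitting off a distant singular point\<close>

lemma markov_functional_linear:
  assumes "markov_functional d f" "markov_functional d g"
  shows "markov_functional d (\<lambda>x. c * f x + c' * g x)"
proof -
  interpret F: markov_functional d f by fact
  interpret G: markov_functional d g by fact
  show ?thesis
  proof
    fix x y
    show "c * f (x * y) + c' * g (x * y) = c * f (y * x) + c' * g (y * x)"
      by (simp only: F.cyclic[of x] G.cyclic[of x])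
  qed (simp_all add: F.support G.support F.quadratic G.quadratic F.stabilise G.stabilise algebra_simps)
qed

lemma markov_functional_scale:
  "markov_functional d f \<Longrightarrow> markov_functional d (\<lambda>x. c * f x)"
  using markov_functional_linear[of d f f c 0] by simp

text \<open>The contraction by a distant singular point. The least n is only a canonical choice: by
  \<open>psi_eq\<close> any n such that x lies on n strands will do. Where no such n exists,
  \<open>support\<close> makes the value 0.\<close>

definition psi :: "nat \<Rightarrow> (sbraid \<Rightarrow> Kz) \<Rightarrow> sbraid \<Rightarrow> Kz"
  where "psi e f x = f (x * ta e (LEAST n. 1 \<le> n \<and> x \<in> strands n))"

lemma psi_linear: "psi e (\<lambda>x. c * f x + c' * g x) = (\<lambda>x. c * psi e f x + c' * psi e g x)"
  by (simp add: psi_def fun_eq_iff)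

context markov_functional
begin

lemma psi_eq:
  assumes "1 \<le> n" "x \<in> strands n"
  shows "psi e f x = f (x * ta e n)"
proof -
  define m where "m = (LEAST n. 1 \<le> n \<and> x \<in> strands n)"
  have "1 \<le> m \<and> x \<in> strands m" "m \<le> n"
    unfolding m_def by (rule LeastI[of _ n], use assms in auto) (rule Least_le, use assms in auto)
  then show ?thesis
    unfolding psi_def m_def[symmetric] by (intro slide_far[symmetric]) auto
qed

lemma psi_nonzero:
  assumes "psi e f x \<noteq> 0"
  obtains k where "x \<in> graded k" "d = Suc k"
proof -
  from assms have "x * ta e (LEAST n. 1 \<le> n \<and> x \<in> strands n) \<in> graded d"
    unfolding psi_def using support by blast
  then obtain k where k: "x \<in> graded k"
    by (elim graded_mult_cases)
  then obtain n where n: "1 \<le> n" "x \<in> strands n"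
    using graded_strands by blast
  have "x * ta e n \<in> graded d"
    using assms support unfolding psi_eq[OF n] by blast
  moreover have "x * ta e n \<in> graded (Suc k)"
    using graded_mult[OF k, of "ta e n" "Suc 0"] n by simp
  ultimately show ?thesis
    using k that by (blast dest: graded_disjoint)
qed

end

lemma psi_degree_zero:
  assumes "markov_functional 0 f"
  shows "psi e f = (\<lambda>x. 0)"
proof
  fix x
  interpret markov_functional 0 f by fact
  show "psi e f x = 0"
    by (rule ccontr) (erule psi_nonzero, simp)
qed

text \<open>For the cyclic and quadratic conditions the new singular point is placed beyond all
  letters involved. Only stabilisation is delicate, because sigma_n shares a strand with
  tau_(n+1).\<close>

lemma psi_markov:
  assumes "markov_functional (Suc d) f"
  shows "markov_functional d (psi e f)"
proof -
  interpret markov_functional "Suc d" f by fact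
  have sup: "psi e f x = 0" if "x \<notin> graded d" for x
    using that psi_nonzero[of e x] by blast
  show ?thesis
  proof
    show "psi e f x = 0" if "x \<notin> graded d" for x
      using that by (rule sup)
  next
    fix x y
    show "psi e f (x * y) = psi e f (y * x)"
    proof (cases "x * y \<in> graded d")
      case True
      then obtain n where n: "1 \<le> n" "x \<in> strands n" "y \<in> strands n"
        using common_strands by blast
      have "psi e f (x * y) = f (x * (ta e (Suc n) * y))"
        using n strands_commute(3)[of y n "Suc n" e] strands_mono[of _ n "Suc n"]
        by (simp add: psi_eq[of "Suc n"] mult.assoc)
      also have "\<dots> = f (y * x * ta e (Suc n))"
        using cyclic[of "x * ta e (Suc n)" y] by (simp add: mult.assoc)
      also have "\<dots> = psi e f (y * x)"
        using n strands_mono[of _ n "Suc n"] by (simp add: psi_eq[of "Suc n"])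
      finally show ?thesis .
    next
      case False
      then show ?thesis
        using graded_mult_commute[of x y d] by (simp add: sup)
    qed
  next
    fix k :: nat and x y
    assume k: "1 \<le> k"
    show "psi e f (x * (sg k * (sg k * y))) = (qq - 1) * psi e f (x * (sg k * y)) + qq * psi e f (x * y)"
    proof (cases "x * y \<in> graded d")
      case True
      then obtain n where n: "Suc k \<le> n" "1 \<le> n" "x \<in> strands n" "y \<in> strands n"
        using common_strands by blast
      then show ?thesis
        using quadratic[of k x "y * ta e n"] k by (simp add: psi_eq[of n] mult.assoc)
    next
      case False
      then show ?thesis
        using k by (simp add: sup graded_insert_sg)
    qed
  next
    fix n :: nat and x
    assume n: "1 \<le> n" and x: "x \<in> strands n"
    define a b a' b' s t where "a = sg n" and "b = sg (Suc n)" and "a' = sgi n" and "b' = sgi (Suc n)"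
      and "s = ta e n" and "t = ta e (Suc n)"
    interpret singular_triple a b a' b' s t
      unfolding a_def b_def a'_def b'_def s_def t_def using n by (rule singular_triple_ta)
    have S: "x \<in> strands (Suc n)" "a \<in> strands (Suc n)" "a' \<in> strands (Suc n)" "s \<in> strands (Suc n)"
      using n x strands_mono[of x n "Suc n"] by (auto simp: a_def a'_def s_def)
    have "b' * x = x * b'"
      unfolding b'_def using strands_commute[of x n "Suc n"] x by auto
    then have comm: "b' * (x * y) = x * (b' * y)" for y
      by (simp flip: mult.assoc)
    have "psi e f (x * a) = f (x * (a * t))"
      using S by (simp add: psi_eq[of "Suc n"] mult.assoc t_def)
    \<comment> \<open>By \<open>t_eq\<close>, tau_(n+1) is tau_n conjugated by sigma_(n+1) sigma_n.
      Cycling the leading sigma_(n+1)^-1 to the end and using b a b' = a' b a leaves a single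
      sigma_(n+1), which \<open>stabilise\<close> turns into z.\<close>
    also have "x * (a * t) = b' * (x * (s * (b * a)))"
      by (subst t_eq) (simp add: inv_assoc comm)
    also have "f \<dots> = f (x * (s * (b * (a * b'))))"
      using cyclic[of b' "x * (s * (b * a))"] by (simp add: mult.assoc)
    also have "\<dots> = f (a * (x * (s * a')) * b)"
      unfolding conj_ba using cyclic[of "x * (s * (a' * b))" a] by (simp add: mult.assoc)
    also have "\<dots> = z_var * f (a * (x * (s * a')))"
      unfolding b_def using S by (intro stabilise) auto
    also have "f (a * (x * (s * a'))) = f (x * (s * (a' * a)))"
      using cyclic[of a "x * (s * a')"] by (simp add: mult.assoc)
    finally show "psi e f (x * sg n) = z_var * psi e f x"
      using n x inv by (simp add: psi_eq[of n] a_def s_def)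
  qed
qed

text \<open>The braid exchanging two pairs of adjacent strands.\<close>

lemma block_swap:
  assumes "1 \<le> k"
  defines "w \<equiv> sg (Suc k) * (sg k * (sg (Suc (Suc k)) * sg (Suc k)))"
  shows "w * ta e k = ta e (Suc (Suc k)) * w" "w * ta e (Suc (Suc k)) = ta e k * w"
proof -
  let ?a = "sg k" and ?b = "sg (Suc k)" and ?c = "sg (Suc (Suc k))"
  have ac: "?a * ?c = ?c * ?a"
    using assms by (intro far_commute) auto
  have w: "w = ?b * (?c * (?a * ?b))"
    unfolding w_def using ac by (simp flip: mult.assoc)
  have "w * ta e k = ?b * (?c * (ta e (Suc k) * (?a * ?b)))"
    unfolding w using sg_sg_tau_up[OF assms(1), of e] by (simp add: mult.assoc)
  also have "\<dots> = ta e (Suc (Suc k)) * w"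
    unfolding w using sg_sg_tau_up[of "Suc k" e] by (simp flip: mult.assoc)
  finally show "w * ta e k = ta e (Suc (Suc k)) * w" .
  have "w * ta e (Suc (Suc k)) = ?b * (?a * (ta e (Suc k) * (?c * ?b)))"
    unfolding w_def using sg_sg_tau_down[of "Suc k" e] by (simp add: mult.assoc)
  also have "\<dots> = ta e k * w"
    unfolding w_def using sg_sg_tau_down[OF assms(1), of e] by (simp flip: mult.assoc)
  finally show "w * ta e (Suc (Suc k)) = ta e k * w" .
qed

text \<open>The two contractions attach points at n + 1 and n + 3, on disjoint pairs of strands. The
  block braid exchanging these pairs commutes with x, so conjugating by it exchanges the two points
  without changing the value.\<close>

lemma psi_commute:
  assumes "markov_functional d f"
  shows "psi e (psi e' f) = psi e' (psi e f)"
proof (cases d)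
  case 0
  then show ?thesis
    using assms by (simp add: psi_degree_zero psi_def fun_eq_iff)
next
  case (Suc d')
  interpret markov_functional "Suc d'" f
    using assms Suc by simp
  interpret P: markov_functional d' "psi i f" for i
    by (rule psi_markov) (rule markov_functional_axioms)
  have "psi e (psi e' f) x = psi e' (psi e f) x" for x
    proof (cases "\<exists>l. x \<in> graded l")
      case True
      then obtain n where n: "1 \<le> n" "x \<in> strands n"
        using graded_strands by blast
      have S: "x \<in> strands (Suc n)" "\<And>e. x * ta e (Suc n) \<in> strands (Suc (Suc (Suc n)))"
        using n strands_mono[of x n "Suc n"] strands_mono[of x n "Suc (Suc (Suc n))"] by auto
      have psi2: "psi e (psi e' f) x = f (x * (ta e (Suc n) * ta e' (Suc (Suc (Suc n)))))" for e e'
        using S by (simp add: P.psi_eq[of "Suc n"] psi_eq[of "Suc (Suc (Suc n))"] mult.assoc)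
      define w w' where "w = sg (Suc (Suc n)) * (sg (Suc n) * (sg (Suc (Suc (Suc n))) * sg (Suc (Suc n))))"
        and "w' = sgi (Suc (Suc n)) * (sgi (Suc (Suc (Suc n))) * (sgi (Suc n) * sgi (Suc (Suc n))))"
      have ww': "w * w' = 1" "w' * w = 1"
        by (simp_all add: w_def w'_def mult.assoc)
      have "x * w = w * x"
        unfolding w_def by (intro commute_mult strands_commute(1)[OF n(2), symmetric]) auto
      then have wx: "w * x = x * w" by simp
      have "x * (ta e (Suc n) * ta e' (Suc (Suc (Suc n)))) = w' * (w * (x * (ta e (Suc n) * ta e' (Suc (Suc (Suc n))))))"
        using ww' by (simp flip: mult.assoc)
      also have "\<dots> = w' * (x * (w * ta e (Suc n) * ta e' (Suc (Suc (Suc n)))))"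
        using wx by (simp flip: mult.assoc)
      also have "\<dots> = w' * (x * (ta e (Suc (Suc (Suc n))) * (w * ta e' (Suc (Suc (Suc n))))))"
        by (simp add: block_swap(1)[of "Suc n", folded w_def] mult.assoc)
      also have "\<dots> = w' * (x * (ta e (Suc (Suc (Suc n))) * (ta e' (Suc n) * w)))"
        by (simp add: block_swap(2)[of "Suc n", folded w_def])
      also have "f \<dots> = f (x * (ta e (Suc (Suc (Suc n))) * (ta e' (Suc n) * (w * w'))))"
        using cyclic[of w'] by (simp add: mult.assoc)
      also have "\<dots> = f (x * (ta e' (Suc n) * ta e (Suc (Suc (Suc n)))))"
        using far_commute(3)[of "Suc n" "Suc (Suc (Suc n))" e' e] by (simp add: ww')
      finally show ?thesis
        by (simp add: psi2)
    next
      case False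
      have "psi e (psi e' f) x = 0" for e e'
        using False P.psi_nonzero[of e e' x] by blast
      then show ?thesis by simp
    qed
  then show ?thesis by (rule ext)
qed

text \<open>When the contractions vanish, so does the right-hand side of \<open>detach\<close>. Its
  left-hand side, taken for x and for sigma_n x, is then a linear system for the values at tau_n x
  and tau_n sigma_n x. This kills all words with a singular point at the top index; conjugation and
  cyclicity reduce every other word to that case.\<close>

lemma psi_injective:
  assumes "markov_functional (Suc d) f" "\<And>e x. psi e f x = 0"
  shows "f x = 0"
proof -
  interpret markov_functional "Suc d" f by fact
  have top: "f (ta 0 n * x) = 0" if n: "1 \<le> n" and x: "x \<in> strands (Suc n)" for n x
  proof -
    have eq: "z_var * f (ta 0 n * (sg n * x)) + qq * f (ta 0 n * x) = 0" if "x \<in> strands (Suc n)" for x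
    proof -
      have "f (ta 0 (Suc n) * (sg (Suc n) * (sg n * x))) = psi 1 f (sg n * x)"
        using that n cyclic[of "sg n * x" "ta 1 (Suc n)"]
        by (subst psi_eq[of "Suc n"]) (auto simp: ta_alt[of "Suc 0"] mult.assoc)
      moreover have "f (ta 0 (Suc n) * (sg n * (x * sgi n))) = psi 0 f (sg n * (x * sgi n))"
        using that n by (subst psi_eq[of "Suc n"]) (auto simp: cyclic[of "ta 0 (Suc n)"])
      ultimately show ?thesis
        using detach[OF n that] assms(2) by simp
    qed
    define X Y where "X = f (ta 0 n * x)" and "Y = f (ta 0 n * (sg n * x))"
    have 1: "z_var * Y + qq * X = 0"
      using eq[OF x] by (simp add: X_def Y_def)
    \<comment> \<open>Second equation, from sigma_n x; the Hecke relation brings it back to the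
      unknowns X and Y. Eliminating X leaves the discriminant times Y.\<close>
    have 2: "z_var * ((qq - 1) * Y + qq * X) + qq * Y = 0"
      using eq[of "sg n * x"] n x quadratic[of n "ta 0 n" x] by (simp add: X_def Y_def)
    have "(qq + (qq - 1) * z_var - z_var * z_var) * Y
        = z_var * ((qq - 1) * Y + qq * X) + qq * Y - z_var * (z_var * Y + qq * X)"
      by (simp add: algebra_simps)
    then have "Y = 0"
      using 1 2 discriminant_nonzero by simp
    then show ?thesis
      using 1 by (simp add: X_def)
  qed
  \<comment> \<open>Conjugation by sigma_k sigma_(k+1) raises tau_k to tau_(k+1), so the induction
    runs downwards from the top index n.\<close>
  have all: "f (ta 0 k * x) = 0" if "k \<le> n" "1 \<le> k" "x \<in> strands (Suc n)" for k n x
    using that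
  proof (induction k arbitrary: x rule: inc_induct)
    case base
    then show ?case by (rule top)
  next
    case (step k)
    have "ta 0 k * x = sgi (Suc k) * (sgi k * (sg k * (sg (Suc k) * (ta 0 k * x))))"
      using step by simp
    also have "sg k * (sg (Suc k) * (ta 0 k * x)) = ta 0 (Suc k) * (sg k * (sg (Suc k) * x))"
      using sg_sg_tau_up[of k 0] step by (simp flip: mult.assoc)
    also have "f (sgi (Suc k) * (sgi k * (ta 0 (Suc k) * (sg k * (sg (Suc k) * x)))))
        = f (ta 0 (Suc k) * (sg k * (sg (Suc k) * (x * (sgi (Suc k) * sgi k)))))"
      using cyclic[of "sgi (Suc k) * sgi k"] by (simp add: mult.assoc)
    also have "\<dots> = 0"
      using step by (intro step.IH) auto
    finally show ?case .
  qed
  show ?thesis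
  proof (cases "x \<in> graded (Suc d)")
    case True
    then obtain w where w: "x = cls w" "valid w" "taus w = Suc d"
      by (auto simp: graded_def)
    then have "filter is_Tau w \<noteq> []"
      by (auto simp: taus_def)
    then obtain y where "y \<in> set w" "is_Tau y"
      by (auto simp: filter_empty_conv)
    then obtain u k v where uv: "w = u @ Tau k # v"
      by (metis is_Tau_def split_list)
    obtain n where n: "k \<le> n" "w \<in> words (Suc n)"
      using valid_words[OF w(2)] by (metis le_Suc_eq nat_le_linear)
    have "f x = f (ta 0 k * (cls v * cls u))"
      unfolding w(1) uv by (simp add: cls_append cls_simps cyclic[of "cls u"] mult.assoc)
    also have "\<dots> = 0"
      using n w(2) uv by (intro all[of k n]) (auto intro!: strands_mult cls_strands)
    finally show ?thesis .
  qed (rule support)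
qed

section \<open>Resolving singular points\<close>

text \<open>The values of \<open>g\<close> lie in any commutative monoid, so that the same sum
  serves for functionals in \<open>Phi\<close> and for algebra elements in
  \<open>resolve_ext\<close>.\<close>

definition resolve_sum :: "nat \<Rightarrow> (word \<Rightarrow> 'a::comm_monoid_add) \<Rightarrow> word \<Rightarrow> 'a"
  where "resolve_sum \<epsilon> g w = (\<Sum>j\<in>{j. j < length w \<and> is_Tau (w ! j)}. g (desingularize \<epsilon> w j))"

lemma resolve_sum_Nil [simp]: "resolve_sum \<epsilon> g [] = 0"
  by (simp add: resolve_sum_def)

lemma resolve_sum_Cons [simp]:
  "resolve_sum \<epsilon> g (x # w) =
    (if is_Tau x then g ((if \<epsilon> = 0 then [] else [Sig (idx x)]) @ w) else 0)
      + resolve_sum \<epsilon> (\<lambda>v. g (x # v)) w"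
proof -
  let ?J = "{j. j < length w \<and> is_Tau (w ! j)}"
  have "{j. j < length (x # w) \<and> is_Tau ((x # w) ! j)} = (if is_Tau x then {0} else {}) \<union> Suc ` ?J"
    by (auto simp: less_Suc_eq_0_disj)
  moreover have "(\<Sum>j\<in>Suc ` ?J. g (desingularize \<epsilon> (x # w) j)) = resolve_sum \<epsilon> (\<lambda>v. g (x # v)) w"
    unfolding resolve_sum_def by (subst sum.reindex) (auto simp: desingularize_def intro!: sum.cong)
  ultimately show ?thesis
    by (auto simp: resolve_sum_def desingularize_def sum.union_disjoint)
qed

lemma resolve_sum_append:
  "resolve_sum \<epsilon> g (u @ v) = resolve_sum \<epsilon> (\<lambda>x. g (x @ v)) u + resolve_sum \<epsilon> (\<lambda>y. g (u @ y)) v"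
  by (induction u arbitrary: g) (simp_all add: add.assoc)

lemma desingularize_invariants:
  assumes "j < length w" "is_Tau (w ! j)"
  shows "valid w \<Longrightarrow> valid (desingularize \<epsilon> w j)"
    and "w \<in> words n \<Longrightarrow> desingularize \<epsilon> w j \<in> words n"
    and "Suc (taus (desingularize \<epsilon> w j)) = taus w"
proof -
  have w: "w = take j w @ w ! j # drop (Suc j) w"
    using assms(1) by (rule id_take_nth_drop)
  show "valid w \<Longrightarrow> valid (desingularize \<epsilon> w j)"
    by (subst (asm) w) (auto simp: desingularize_def)
  show "w \<in> words n \<Longrightarrow> desingularize \<epsilon> w j \<in> words n"
    by (subst (asm) w) (auto simp: desingularize_def)
  show "Suc (taus (desingularize \<epsilon> w j)) = taus w"
    by (subst (2) w) (use assms(2) in \<open>auto simp: desingularize_def\<close>)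
qed

lemma resolve_sum_cong:
  assumes "\<And>v. (valid w \<longrightarrow> valid v) \<Longrightarrow> (\<forall>n. w \<in> words n \<longrightarrow> v \<in> words n) \<Longrightarrow> Suc (taus v) = taus w
    \<Longrightarrow> g v = g' v"
  shows "resolve_sum \<epsilon> g w = resolve_sum \<epsilon> g' w"
  unfolding resolve_sum_def using desingularize_invariants by (intro sum.cong assms) auto

lemma resolve_sum_linear:
  fixes g g' :: "word \<Rightarrow> 'a::comm_semiring_0"
  shows "resolve_sum \<epsilon> (\<lambda>x. c * g x + c' * g' x) w = c * resolve_sum \<epsilon> g w + c' * resolve_sum \<epsilon> g' w"
  by (simp add: resolve_sum_def sum.distrib sum_distrib_left)

lemma resolve_sum_scale:
  fixes g :: "word \<Rightarrow> 'a::semiring_0"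
  shows "resolve_sum \<epsilon> (\<lambda>x. c * g x) w = c * resolve_sum \<epsilon> g w"
  by (simp add: resolve_sum_def sum_distrib_left)

text \<open>Resolving one singular point in a defining relation gives a trivial identity or another
  relation: the mixed triple relation becomes the braid relation, far commutation of sigma with tau
  becomes that of two sigma, and far commutation of two tau yields two instances of the mixed
  one.\<close>

lemma resolve_sum_braid_eq:
  assumes "braid_eq n u v" and g: "\<And>x y. braid_eq n x y \<Longrightarrow> g x = g y"
  shows "resolve_sum \<epsilon> g u = resolve_sum \<epsilon> g v"
  using assms(1)
proof (induction rule: braid_eq.induct)
  case (rel a b r s)
  have r: "g (x @ r @ y) = g (x @ s @ y)" if "defining_relation n r s" "x \<in> words n" "y \<in> words n" for x y r s
    using that by (intro g braid_eq.rel)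
  have 1: "resolve_sum \<epsilon> (\<lambda>x. g (x @ r @ b)) a = resolve_sum \<epsilon> (\<lambda>x. g (x @ s @ b)) a"
    using rel by (intro resolve_sum_cong r) auto
  have 2: "resolve_sum \<epsilon> (\<lambda>x. g (a @ r @ x)) b = resolve_sum \<epsilon> (\<lambda>x. g (a @ s @ x)) b"
    using rel by (intro resolve_sum_cong r) auto
  have 3: "resolve_sum \<epsilon> (\<lambda>x. g (a @ x @ b)) r = resolve_sum \<epsilon> (\<lambda>x. g (a @ x @ b)) s"
    using rel(3)
  proof cases
    case (5 k l)
    then show ?thesis
      using r[OF defining_relation.intros(4)[of k n l] rel(1,2)] by simp
  next
    case (7 k l)
    then show ?thesis
      using r[OF defining_relation.intros(6)[of k n l] rel(1,2)] by simp
  next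
    case (8 k l)
    moreover have "\<bar>int l - int k\<bar> \<ge> 2"
      using 8 by simp
    ultimately show ?thesis
      using r[OF defining_relation.intros(7)[of k n l] rel(1,2)]
        r[OF defining_relation.intros(7)[of l n k] rel(1,2)] by (simp add: add.commute)
  qed simp_all
  show ?case
    using 1 2 3 by (simp add: resolve_sum_append)
qed auto

text \<open>Defined on a chosen representative and cut off on invalid words, because invariance is
  inherited from the finite levels, where all words are valid. \<open>Phi_cls\<close> is the working
  form.\<close>

definition Phi :: "nat \<Rightarrow> (sbraid \<Rightarrow> Kz) \<Rightarrow> sbraid \<Rightarrow> Kz"
  where "Phi \<epsilon> f x =
    (if valid (rep_sbraid x) then resolve_sum \<epsilon> (\<lambda>w. f (cls w)) (rep_sbraid x) else 0)"

lemma stable_eq_rep: "stable_eq (rep_sbraid (cls w)) w"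
  by (simp add: cls_rep flip: cls_eq_iff)

lemma Phi_cls:
  assumes "valid w"
  shows "Phi \<epsilon> f (cls w) = resolve_sum \<epsilon> (\<lambda>w. f (cls w)) w"
proof -
  let ?r = "rep_sbraid (cls w)"
  have v: "valid ?r"
    using assms stable_eq_invariants[OF stable_eq_rep[of w]] by simp
  then obtain n where "braid_eq n ?r w"
    using stable_eq_braid_eq[OF stable_eq_rep[of w]] by blast
  then have "resolve_sum \<epsilon> (\<lambda>w. f (cls w)) ?r = resolve_sum \<epsilon> (\<lambda>w. f (cls w)) w"
    by (rule resolve_sum_braid_eq) (metis cls_eq_iff braid_eq_stable_eq)
  then show ?thesis
    using v by (simp add: Phi_def)
qed

lemma Phi_invalid: "\<not> valid w \<Longrightarrow> Phi \<epsilon> f (cls w) = 0"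
  using stable_eq_invariants[OF stable_eq_rep[of w]] by (simp add: Phi_def)

lemma Phi_linear: "Phi \<epsilon> (\<lambda>x. c * f x + c' * g x) = (\<lambda>x. c * Phi \<epsilon> f x + c' * Phi \<epsilon> g x)"
  by (simp add: Phi_def fun_eq_iff resolve_sum_linear)

lemma Phi_scale: "Phi \<epsilon> (\<lambda>x. c * f x) = (\<lambda>x. c * Phi \<epsilon> f x)"
  by (simp add: Phi_def fun_eq_iff resolve_sum_scale)

lemma Phi_zero: "Phi \<epsilon> (\<lambda>x. 0) = (\<lambda>x. 0)"
  by (simp add: Phi_def fun_eq_iff resolve_sum_def)

text \<open>Resolution alters only the letters \<open>Tau\<close>. The crossings involved in a Hecke
  or stabilisation relation stay untouched, so each relation holds summand by summand.\<close>

lemma Phi_markov: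
  assumes "markov_functional d f"
  shows "markov_functional (Suc d) (Phi \<epsilon> f)"
proof -
  interpret markov_functional d f by fact
  show ?thesis
  proof
    fix x
    assume x: "x \<notin> graded (Suc d)"
    obtain w where w: "x = cls w"
      by (metis cls_rep)
    show "Phi \<epsilon> f x = 0"
    proof (cases "valid w")
      case True
      have "resolve_sum \<epsilon> (\<lambda>w. f (cls w)) w = resolve_sum \<epsilon> (\<lambda>w. 0) w"
        using x True w by (intro resolve_sum_cong support) auto
      then show ?thesis
        using True by (simp add: w Phi_cls resolve_sum_def)
    qed (simp add: w Phi_invalid)
  next
    fix x y
    obtain u v where w: "x = cls u" "y = cls v"
      by (metis cls_rep)
    show "Phi \<epsilon> f (x * y) = Phi \<epsilon> f (y * x)"
    proof (cases "valid u \<and> valid v")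
      case True
      then show ?thesis
        by (simp add: w Phi_cls resolve_sum_append cls_append add.commute cyclic flip: cls_append)
          (simp add: cls_append cyclic)
    next
      case False
      then show ?thesis
        by (auto simp add: w Phi_invalid simp flip: cls_append)
    qed
  next
    fix k :: nat and x y
    assume k: "1 \<le> k"
    obtain u v where w: "x = cls u" "y = cls v"
      by (metis cls_rep)
    have prod: "x * (sg k * (sg k * y)) = cls (u @ Sig k # Sig k # v)"
      "x * (sg k * y) = cls (u @ Sig k # v)" "x * y = cls (u @ v)"
      by (simp_all add: w cls_append cls_simps)
    have fq: "f (cls (u @ Sig k # Sig k # v)) = (qq - 1) * f (cls (u @ Sig k # v)) + qq * f (cls (u @ v))" for u v
      using quadratic[OF k, of "cls u" "cls v"] by (simp add: cls_append cls_simps)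
    show "Phi \<epsilon> f (x * (sg k * (sg k * y))) = (qq - 1) * Phi \<epsilon> f (x * (sg k * y)) + qq * Phi \<epsilon> f (x * y)"
    proof (cases "valid u \<and> valid v")
      case True
      then show ?thesis
        unfolding prod using k
        by (simp add: Phi_cls resolve_sum_append fq resolve_sum_linear) (simp add: algebra_simps)
    next
      case False
      then show ?thesis
        unfolding prod by (subst (1 2 3) Phi_invalid) auto
    qed
  next
    fix n :: nat and x
    assume n: "1 \<le> n" and "x \<in> strands n"
    then obtain w where w: "x = cls w" "w \<in> words n"
      by (auto simp: strands_def)
    have "Phi \<epsilon> f (x * sg n) = resolve_sum \<epsilon> (\<lambda>v. f (cls v * sg n)) w"
      using w n words_valid[OF w(2)] Phi_cls[of "w @ [Sig n]" \<epsilon> f]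
      by (simp add: resolve_sum_append cls_append sg_def)
    also have "\<dots> = resolve_sum \<epsilon> (\<lambda>v. z_var * f (cls v)) w"
      using n w by (intro resolve_sum_cong stabilise) (auto simp: cls_strands)
    also have "\<dots> = z_var * Phi \<epsilon> f x"
      using words_valid[OF w(2)] by (simp add: w Phi_cls resolve_sum_scale)
    finally show "Phi \<epsilon> f (x * sg n) = z_var * Phi \<epsilon> f x" .
  qed
qed

lemma Phi_unsupported: "\<nexists>d. x \<in> graded d \<Longrightarrow> Phi \<epsilon> f x = 0"
  by (metis Phi_invalid cls_graded_iff cls_rep)

section \<open>Contraction against resolution: a Weyl algebra\<close>

text \<open>The factor left when the point attached by the contraction is itself resolved: tau or
  tau sigma turns into 1, sigma, sigma or sigma^2, and the last is reduced by the Hecke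
  relation.\<close>

definition resolve_coeff :: "nat \<Rightarrow> nat \<Rightarrow> Kz"
  where "resolve_coeff e \<epsilon> =
    (if e = 0 \<and> \<epsilon> = 0 then 1 else if e = 0 \<or> \<epsilon> = 0 then z_var else (qq - 1) * z_var + qq)"

text \<open>A Leibniz rule: the resolved point is either one of the points of x or the point
  attached by the contraction.\<close>

lemma psi_Phi:
  assumes "markov_functional d f"
  shows "psi e (Phi \<epsilon> f) x = Phi \<epsilon> (psi e f) x + resolve_coeff e \<epsilon> * f x"
proof (cases "\<exists>l. x \<in> graded l")
  case True
  interpret markov_functional d f by fact
  interpret P: markov_functional "Suc d" "Phi \<epsilon> f"
    using assms by (rule Phi_markov)
  obtain n where n: "1 \<le> n" "x \<in> strands n"
    using True graded_strands by blast
  then obtain w where w: "x = cls w" "w \<in> words n"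
    by (auto simp: strands_def)
  note v = words_valid[OF w(2)]
  define t where "t = (if e = 0 then [Tau n] else [Tau n, Sig n])"
  have t: "cls (v @ t) = cls v * ta e n" for v
    by (simp add: t_def cls_append cls_simps ta_alt[of e] cls_Nil)
  have "psi e (Phi \<epsilon> f) x = Phi \<epsilon> f (cls (w @ t))"
    using n by (simp add: P.psi_eq w t)
  also have "\<dots> = resolve_sum \<epsilon> (\<lambda>v. f (cls v * ta e n)) w + resolve_sum \<epsilon> (\<lambda>v. f (cls w * cls v)) t"
  proof -
    have "valid (w @ t)"
      using v n by (simp add: t_def)
    then show ?thesis
      using Phi_cls[of "w @ t" \<epsilon> f] by (simp add: resolve_sum_append t) (simp add: cls_append)
  qed
  also have "resolve_sum \<epsilon> (\<lambda>v. f (cls v * ta e n)) w = resolve_sum \<epsilon> (\<lambda>v. psi e f (cls v)) w"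
    using n w by (intro resolve_sum_cong) (auto simp: psi_eq[of n] cls_strands)
  also have "\<dots> = Phi \<epsilon> (psi e f) x"
    using v by (simp add: w Phi_cls)
  also have "resolve_sum \<epsilon> (\<lambda>v. f (cls w * cls v)) t = resolve_coeff e \<epsilon> * f x"
    using n stabilise[of n x] quadratic[of n x 1]
    by (auto simp: t_def resolve_coeff_def cls_simps cls_Nil w(1) algebra_simps)
  finally show ?thesis .
next
  case False
  then have "f x = 0" "x * ta e n \<notin> graded (Suc d)" for n
    using markov_functional.support[OF assms] by (auto elim!: graded_mult_cases)
  then show ?thesis
    using False markov_functional.support[OF Phi_markov[OF assms]]
    by (simp add: psi_def[of _ "Phi \<epsilon> f"] Phi_unsupported)
qed

text \<open>The combinations of \<open>psi 0\<close> and \<open>psi 1\<close> for which \<open>theta i\<close> and \<open>Phi j\<close> commute up to \<open>\<delta>\<^sub>i\<^sub>j\<close>: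
  \<open>Phi j\<close> behaves like multiplication by a variable and \<open>theta i\<close> like a partial derivative.\<close>

definition theta_coeff :: "nat \<Rightarrow> nat \<Rightarrow> Kz"
  where "theta_coeff i e =
    (if i = 0 then if e = 0 then (qq - 1) * z_var + qq else - z_var else if e = 0 then - z_var else 1)
      / (qq + (qq - 1) * z_var - z_var * z_var)"

definition theta :: "nat \<Rightarrow> (sbraid \<Rightarrow> Kz) \<Rightarrow> sbraid \<Rightarrow> Kz"
  where "theta i f = (\<lambda>x. theta_coeff i 0 * psi 0 f x + theta_coeff i 1 * psi 1 f x)"

lemma theta_linear: "theta i (\<lambda>x. c * f x + c' * g x) = (\<lambda>x. c * theta i f x + c' * theta i g x)"
  unfolding theta_def by (simp add: psi_linear fun_eq_iff algebra_simps)

lemma theta_scale: "theta i (\<lambda>x. c * f x) = (\<lambda>x. c * theta i f x)"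
  using theta_linear[of i c f 0 f] by simp

lemma theta_sum: "theta i (\<lambda>x. \<Sum>k\<in>A. c k * g k x) = (\<lambda>x. \<Sum>k\<in>A. c k * theta i (g k) x)"
proof (induction A rule: infinite_finite_induct)
  case (insert k A)
  then show ?case
    using theta_linear[of i "c k" "g k" 1 "\<lambda>x. \<Sum>k\<in>A. c k * g k x"] by simp
qed (use theta_scale[of i 0 "\<lambda>x. 0"] in auto)

lemma theta_markov: "markov_functional (Suc d) f \<Longrightarrow> markov_functional d (theta i f)"
  unfolding theta_def by (intro markov_functional_linear psi_markov)

lemma theta_degree_zero: "markov_functional 0 f \<Longrightarrow> theta i f = (\<lambda>x. 0)"
  unfolding theta_def by (simp add: psi_degree_zero)

lemma theta_commute: "markov_functional d f \<Longrightarrow> theta i (theta j f) = theta j (theta i f)"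
  unfolding theta_def
  by (simp only: psi_linear psi_commute[of d f 1 0]) (simp add: fun_eq_iff algebra_simps)

text \<open>The coefficient matrix of the \<open>theta i\<close> is invertible, so vanishing passes
  to both contractions and \<open>psi_injective\<close> applies.\<close>

lemma theta_injective:
  assumes "markov_functional (Suc d) f" "theta 0 f = (\<lambda>x. 0)" "theta 1 f = (\<lambda>x. 0)"
  shows "f x = 0"
proof (rule psi_injective[OF assms(1)])
  fix e x
  define D where "D = qq + (qq - 1) * z_var - z_var * z_var"
  have D: "D \<noteq> 0"
    using discriminant_nonzero by (simp add: D_def)
  have "theta 0 f x = 0" "theta 1 f x = 0"
    using assms by simp_all
  moreover have "D * theta 0 f x = ((qq - 1) * z_var + qq) * psi 0 f x - z_var * psi 1 f x"
    "D * theta 1 f x = psi 1 f x - z_var * psi 0 f x"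
    using D by (simp_all add: theta_def theta_coeff_def right_diff_distrib flip: D_def)
  ultimately have 1: "((qq - 1) * z_var + qq) * psi 0 f x - z_var * psi 1 f x = 0"
    and 2: "psi 1 f x - z_var * psi 0 f x = 0"
    by simp_all
  have "D * psi 0 f x = ((qq - 1) * z_var + qq) * psi 0 f x - z_var * psi 1 f x
      + z_var * (psi 1 f x - z_var * psi 0 f x)"
    by (simp add: D_def algebra_simps)
  then have "psi 0 f x = 0" "psi 1 f x = 0"
    using 1 2 D by simp_all
  \<comment> \<open>\<open>ta e k\<close> depends only on whether e = 0, so two contractions
    represent all values of e.\<close>
  moreover have "psi e f = psi 1 f" if "e \<noteq> 0"
    using that by (simp add: psi_def fun_eq_iff ta_def)
  ultimately show "psi e f x = 0"
    by (cases "e = 0") simp_all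
qed

text \<open>\<open>theta_coeff\<close> is the inverse of the matrix \<open>resolve_coeff\<close>,
  which turns the extra term of the Leibniz rule into the Kronecker delta.\<close>

lemma theta_Phi:
  assumes "markov_functional d f" "i \<le> 1" "j \<le> 1"
  shows "theta i (Phi j f) x = Phi j (theta i f) x + (if i = j then f x else 0)"
proof -
  define D where "D = qq + (qq - 1) * z_var - z_var * z_var"
  have D: "D \<noteq> 0"
    using discriminant_nonzero by (simp add: D_def)
  have "D * (theta_coeff i 0 * resolve_coeff 0 j + theta_coeff i 1 * resolve_coeff 1 j)
      = (if i = j then D else 0)"
    using D assms(2,3)
    by (auto simp: le_Suc_eq theta_coeff_def resolve_coeff_def distrib_left simp flip: D_def)
      (simp_all add: D_def algebra_simps)
  then have *: "theta_coeff i 0 * resolve_coeff 0 j + theta_coeff i 1 * resolve_coeff 1 j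
      = (if i = j then 1 else 0)"
    using D by (auto split: if_splits)
  have "theta i (Phi j f) x = Phi j (theta i f) x
      + (theta_coeff i 0 * resolve_coeff 0 j + theta_coeff i 1 * resolve_coeff 1 j) * f x"
    by (simp add: theta_def Phi_linear psi_Phi[OF assms(1)] algebra_simps)
  then show ?thesis
    unfolding * by simp
qed


section \<open>The basic functionals\<close>

text \<open>Copies the recursion of \<open>T_trace\<close> at the level of functionals, with the
  degree-0 functional left as a parameter.\<close>

primrec basic :: "(sbraid \<Rightarrow> Kz) \<Rightarrow> nat \<Rightarrow> nat \<Rightarrow> sbraid \<Rightarrow> Kz"
  where
    "basic f 0 = (\<lambda>k. f)"
  | "basic f (Suc d) = (\<lambda>k. if k \<le> d then Phi 0 (basic f d k) else Phi 1 (basic f d d))"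

context
  fixes f :: "sbraid \<Rightarrow> Kz"
  assumes f: "markov_functional 0 f"
begin

lemma basic_markov: "markov_functional d (basic f d k)"
  by (induction d arbitrary: k) (simp_all add: f Phi_markov)

text \<open>The derivative of a monomial by its first variable, from \<open>theta_Phi\<close> by
  induction. At k = d + 1 the factor is 0 and absorbs the out-of-range
  \<open>basic f d k\<close>.\<close>

lemma theta_0_basic:
  "k \<le> Suc d \<Longrightarrow> theta 0 (basic f (Suc d) k) = (\<lambda>x. of_nat (Suc d - k) * basic f d k x)"
proof (induction d arbitrary: k)
  case 0
  then show ?case
    using theta_Phi[OF f] by (auto simp: fun_eq_iff theta_degree_zero[OF f] Phi_zero le_Suc_eq)
next
  case (Suc d)
  have *: "theta 0 (Phi j (basic f (Suc d) l)) x
      = of_nat (Suc d - l) * Phi j (basic f d l) x + (if j = 0 then basic f (Suc d) l x else 0)"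
    if "l \<le> Suc d" "j \<le> 1" for j l x
    using that theta_Phi[OF basic_markov, of 0 j "Suc d" l] Suc.IH by (simp add: Phi_scale)
  show ?case
    using Suc.prems *[of k 0] *[of "Suc d" 1]
    by (auto simp: fun_eq_iff le_Suc_eq algebra_simps Suc_diff_le simp del: basic.simps(2)
        simp: basic.simps(2)[of f "Suc d"]) (auto simp: Suc_diff_le)
qed

text \<open>The derivative by the second variable. At k = 0 the factor is 0 and absorbs the
  truncated index k - 1.\<close>

lemma theta_1_basic:
  "k \<le> Suc d \<Longrightarrow> theta 1 (basic f (Suc d) k) = (\<lambda>x. of_nat k * basic f d (k - 1) x)"
proof (induction d arbitrary: k)
  case 0
  then show ?case
    using theta_Phi[OF f] by (auto simp: fun_eq_iff theta_degree_zero[OF f] Phi_zero le_Suc_eq)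
next
  case (Suc d)
  have *: "theta 1 (Phi j (basic f (Suc d) l)) x
      = of_nat l * Phi j (basic f d (l - 1)) x + (if j = 1 then basic f (Suc d) l x else 0)"
    if "l \<le> Suc d" "j \<le> 1" for j l x
    using that theta_Phi[OF basic_markov, of 1 j "Suc d" l] Suc.IH by (simp add: Phi_scale)
  show ?case
  proof
    fix x
    show "theta 1 (basic f (Suc (Suc d)) k) x = of_nat k * basic f (Suc d) (k - 1) x"
    proof (cases "k \<le> Suc d")
      case True
      then show ?thesis
        using *[of k 0 x] by (cases k) simp_all
    next
      case False
      then have "k = Suc (Suc d)"
        using Suc.prems by simp
      then show ?thesis
        using *[of "Suc d" 1 x] by (simp add: algebra_simps)
    qed
  qed
qed

text \<open>The recursion uses \<open>Phi 1\<close> only at k = d. For smaller k this says that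
  \<open>Phi 0\<close> and \<open>Phi 1\<close> commute on the basic functionals; both derivatives
  of the difference vanish, so \<open>theta_injective\<close> gives the claim.\<close>

lemma Phi_1_basic: "k \<le> d \<Longrightarrow> Phi 1 (basic f d k) = basic f (Suc d) (Suc k)"
proof (induction d arbitrary: k)
  case 0
  then show ?case by simp
next
  case (Suc d)
  show ?case
  proof (cases "k = Suc d")
    case True
    then show ?thesis by simp
  next
    case False
    with Suc.prems have k: "k \<le> d" by simp
    let ?g = "\<lambda>x. 1 * Phi 1 (basic f (Suc d) k) x + (- 1) * basic f (Suc (Suc d)) (Suc k) x"
    have g: "markov_functional (Suc (Suc d)) ?g"
      by (intro markov_functional_linear Phi_markov basic_markov)
    have 0: "theta 0 ?g x = 0" for x
      unfolding theta_linear theta_0_basic[of "Suc k" "Suc d", OF Suc_le_mono[THEN iffD2, OF le_SucI[OF k]]]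
      using theta_Phi[OF basic_markov, of 0 1 "Suc d" k x] theta_0_basic[of k d] Suc.IH[OF k] k
      by (simp add: Phi_scale del: basic.simps)
    have 1: "theta 1 ?g x = 0" for x
    proof -
      have "of_nat k * Phi 1 (basic f d (k - 1)) x = of_nat k * basic f (Suc d) k x"
        using Suc.IH[of "k - 1"] k by (cases k) (simp_all del: basic.simps)
      then show ?thesis
        unfolding theta_linear theta_1_basic[of "Suc k" "Suc d", OF Suc_le_mono[THEN iffD2, OF le_SucI[OF k]]]
        using theta_Phi[OF basic_markov, of 1 1 "Suc d" k x] theta_1_basic[of k d] k
        by (simp add: Phi_scale algebra_simps del: basic.simps)
    qed
    have "?g x = 0" for x
      using 0 1 by (intro theta_injective[OF g]) auto
    then show ?thesis
      by (simp add: fun_eq_iff del: basic.simps)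
  qed
qed

text \<open>Differentiating a linear relation lowers its degree. \<open>theta 0\<close> multiplies c
  k by d + 1 - k and controls k = 0; \<open>theta 1\<close> multiplies c k by k and controls all k >
  0. In degree 0 the relation is evaluated at 1.\<close>

lemma basic_independent:
  assumes "f 1 \<noteq> 0" "\<And>x. (\<Sum>k\<le>d. c k * basic f d k x) = 0" "k \<le> d"
  shows "c k = 0"
  using assms(2,3)
proof (induction d arbitrary: c k)
  case 0
  then show ?case
    using assms(1) 0(1)[of 1] by simp
next
  case (Suc d)
  have 0: "theta i (\<lambda>x. \<Sum>k\<le>Suc d. c k * basic f (Suc d) k x) = (\<lambda>x. 0)" for i
    using Suc.prems(1) theta_scale[of i 0 "\<lambda>x. 0"] by simp
  have 1: "(\<Sum>k\<le>d. (c k * of_nat (Suc d - k)) * basic f d k x) = 0" for x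
    using fun_cong[OF 0[of 0], of x] unfolding theta_sum
    by (simp add: theta_0_basic mult.assoc del: basic.simps)
  have 2: "(\<Sum>k\<le>d. (c (Suc k) * of_nat (Suc k)) * basic f d k x) = 0" for x
    using fun_cong[OF 0[of 1], of x] unfolding theta_sum
    by (simp add: theta_1_basic[unfolded One_nat_def] sum.atMost_Suc_shift mult.assoc del: basic.simps sum.atMost_Suc)
  show ?case
  proof (cases k)
    case 0
    then show ?thesis
      using Suc.IH[OF 1, of 0] by (simp del: of_nat_Suc)
  next
    case (Suc k')
    then have "c (Suc k') * of_nat (Suc k') = 0"
      using Suc.prems by (intro Suc.IH[OF 2]) simp
    then show ?thesis
      using Suc by (simp del: of_nat_Suc)
  qed
qed

end

text \<open>Euler's identity for functionals of degree \<open>d\<close>.\<close>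

lemma Phi_theta:
  "markov_functional d f \<Longrightarrow> 1 * Phi 0 (theta 0 f) x + 1 * Phi 1 (theta 1 f) x = of_nat d * f x"
proof (induction d arbitrary: f x)
  case 0
  then show ?case
    by (simp add: theta_degree_zero Phi_zero)
next
  case (Suc d)
  let ?s = "\<lambda>x. 1 * Phi 0 (theta 0 f) x + 1 * Phi 1 (theta 1 f) x"
  let ?g = "\<lambda>x. 1 * ?s x + (- of_nat (Suc d)) * f x"
  have m: "markov_functional d (theta i f)" for i
    using Suc.prems by (rule theta_markov)
  have g: "markov_functional (Suc d) ?g"
    by (intro markov_functional_linear Phi_markov m Suc.prems)
  \<comment> \<open>The defect \<open>?g\<close> is killed by both derivatives: by
    \<open>theta_Phi\<close> and commutation, \<open>theta i ?s\<close> is Euler's sum for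
    \<open>theta i f\<close> plus one extra \<open>theta i f\<close>, which turns the factor d into
    d + 1.\<close>
  have "theta i ?g x = 0" if "i = 0 \<or> i = 1" for i x
  proof -
    have "theta i (Phi j (theta j f)) x = Phi j (theta j (theta i f)) x + (if i = j then theta i f x else 0)"
      if "j \<le> 1" for j
      using theta_Phi[OF m, of i j j x] that \<open>i = 0 \<or> i = 1\<close> theta_commute[OF Suc.prems, of i j] by auto
    then have "theta i ?s x = 1 * Phi 0 (theta 0 (theta i f)) x + 1 * Phi 1 (theta 1 (theta i f)) x + theta i f x"
      using that unfolding theta_linear by auto
    also have "\<dots> = of_nat (Suc d) * theta i f x"
      unfolding Suc.IH[OF m] by (simp add: algebra_simps)
    finally show ?thesis
      unfolding theta_linear[of i 1 ?s] by (simp add: algebra_simps)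
  qed
  then have "?g x = 0"
    by (intro theta_injective[OF g]) auto
  then show ?case by (simp add: algebra_simps)
qed

text \<open>Both derivatives of g are combinations of basic functionals by induction, and Euler's
  identity integrates them back to g.\<close>

lemma basic_span:
  assumes f: "markov_functional 0 f" and unique: "\<And>g. markov_functional 0 g \<Longrightarrow> \<exists>c. \<forall>x. g x = c * f x"
    and g: "markov_functional d g"
  shows "\<exists>c. \<forall>x. g x = (\<Sum>k\<le>d. c k * basic f d k x)"
  using g
proof (induction d arbitrary: g)
  case 0
  then obtain c where "\<forall>x. g x = c * f x"
    using unique by blast
  then show ?case
    by (intro exI[of _ "\<lambda>k. c"]) simp
next
  case (Suc d)
  have "\<exists>c. \<forall>x. theta i g x = (\<Sum>k\<le>d. c k * basic f d k x)" for i
    using Suc.prems by (intro Suc.IH theta_markov)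
  then obtain c where "\<And>i x. theta i g x = (\<Sum>k\<le>d. c i k * basic f d k x)"
    by metis
  then have c: "theta i g = (\<lambda>x. \<Sum>k\<le>d. c i k * basic f d k x)" for i
    by blast
  have Phi_sum: "Phi j (\<lambda>x. \<Sum>k\<in>A. b k * h k x) = (\<lambda>x. \<Sum>k\<in>A. b k * Phi j (h k) x)"
    for j and A :: "nat set" and b h
  proof (induction A rule: infinite_finite_induct)
    case (insert k A)
    then show ?case
      using Phi_linear[of j "b k" "h k" 1 "\<lambda>x. \<Sum>k\<in>A. b k * h k x"] by simp
  qed (simp_all add: Phi_zero)
  \<comment> \<open>\<open>Phi 0\<close> keeps the index and \<open>Phi 1\<close> raises it by one,
    hence the shift in c 1. The denominator is the factor d + 1 of Euler's identity.\<close>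
  define b where "b k = ((if k \<le> d then c 0 k else 0) + (if k = 0 then 0 else c 1 (k - 1))) / of_nat (Suc d)" for k
  have "g x = (\<Sum>k\<le>Suc d. b k * basic f (Suc d) k x)" for x
  proof -
    have "of_nat (Suc d) * g x = (\<Sum>k\<le>d. c 0 k * basic f (Suc d) k x) + (\<Sum>k\<le>d. c 1 k * basic f (Suc d) (Suc k) x)"
      using Phi_theta[OF Suc.prems, of x] Phi_1_basic[OF f, of _ d] by (simp add: c Phi_sum)
    also have "(\<Sum>k\<le>d. c 0 k * basic f (Suc d) k x)
        = (\<Sum>k\<le>Suc d. (if k \<le> d then c 0 k else 0) * basic f (Suc d) k x)"
      by (simp del: basic.simps)
    also have "(\<Sum>k\<le>d. c 1 k * basic f (Suc d) (Suc k) x)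
        = (\<Sum>k\<le>Suc d. (if k = 0 then 0 else c 1 (k - 1)) * basic f (Suc d) k x)"
      by (simp add: sum.atMost_Suc_shift del: basic.simps sum.atMost_Suc)
    also have "(\<Sum>k\<le>Suc d. (if k \<le> d then c 0 k else 0) * basic f (Suc d) k x)
        + (\<Sum>k\<le>Suc d. (if k = 0 then 0 else c 1 (k - 1)) * basic f (Suc d) k x)
        = of_nat (Suc d) * (\<Sum>k\<le>Suc d. b k * basic f (Suc d) k x)"
      unfolding sum_distrib_left sum.distrib[symmetric]
      by (intro sum.cong) (auto simp: b_def add_divide_distrib distrib_right distrib_left simp del: basic.simps of_nat_Suc)
    finally show ?thesis
      by (simp del: basic.simps of_nat_Suc sum.atMost_Suc)
  qed
  then show ?case by blast
qed

section \<open>The Ocneanu trace\<close>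

lemma words_trivial: "n \<le> 1 \<Longrightarrow> w \<in> words n \<longleftrightarrow> w = []"
  by (cases w) auto

text \<open>A word on \<open>n + 1\<close> strands is reduced to words with at most one letter \<open>\<sigma>\<^sub>n\<close>, as in the
  computation of a spanning set of the Hecke algebra.\<close>

lemma braid_induct [consumes 1, case_names one cyclic square inverse stabilise]:
  assumes "x \<in> graded 0"
    and one: "Q 1"
    and cyclic: "\<And>x y. Q (x * y) \<Longrightarrow> Q (y * x)"
    and square: "\<And>k x y. 1 \<le> k \<Longrightarrow> Q (x * (sg k * y)) \<Longrightarrow> Q (x * y) \<Longrightarrow> Q (x * (sg k * (sg k * y)))"
    and inverse: "\<And>k x y. 1 \<le> k \<Longrightarrow> Q (x * (sg k * y)) \<Longrightarrow> Q (x * y) \<Longrightarrow> Q (x * (sgi k * y))"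
    and stabilise: "\<And>n x. 1 \<le> n \<Longrightarrow> x \<in> strands n \<Longrightarrow> Q x \<Longrightarrow> Q (x * sg n)"
  shows "Q x"
proof -
  define B where "B n = cls ` {w. w \<in> words n \<and> taus w = 0}" for n
  \<comment> \<open>Braids on n + 1 strands with at most one letter sigma_n, which moreover is not
    inverted.\<close>
  define N where "N n = B n \<union> {y * (sg n * y') | y y'. 1 \<le> n \<and> y \<in> B n \<and> y' \<in> B n}" for n
  have B1 [simp]: "1 \<in> B n" for n
    unfolding B_def by (rule image_eqI[of _ _ "[]"]) (auto simp: cls_Nil)
  have Bmult [simp]: "x * y \<in> B n" if "x \<in> B n" "y \<in> B n" for x y n
    using that unfolding B_def by (auto simp flip: cls_append)
  have Bgen [simp]: "sg k \<in> B n" "sgi k \<in> B n" if "1 \<le> k" "k < n" for k n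
    using that unfolding B_def sg_def sgi_def by auto
  have Bmono: "x \<in> B n" if "x \<in> B m" "m \<le> n" for x m n
    using that words_mono unfolding B_def by blast
  have Bstrands: "x \<in> strands n" if "x \<in> B n" for x n
    using that unfolding B_def strands_def by blast
  have N1: "y * (sg n * y') \<in> N n" if "1 \<le> n" "y \<in> B n" "y' \<in> B n" for n y y'
    using that unfolding N_def by blast
  have reduce: "Q (a * (x * b))" if "x \<in> B (Suc n)" "\<And>y. y \<in> N n \<Longrightarrow> Q (a * (y * b))" for x n a b
    using that
  proof (induction n arbitrary: x a b)
    case 0
    then have "x = 1"
      by (auto simp: B_def words_trivial cls_Nil)
    then show ?case
      using 0(2)[of 1] by (simp add: N_def)
  next
    case (Suc m)
    let ?n = "Suc m"
    have top: "Q (a * (sg ?n * (y * b)))" if y: "y \<in> N ?n" and hyp: "\<And>y. y \<in> N ?n \<Longrightarrow> Q (a * (y * b))" for y a b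
    proof (cases "y \<in> B ?n")
      case True
      then show ?thesis
        using hyp[OF N1[of ?n 1 y]] by (simp add: mult.assoc)
    next
      case False
      then obtain y1 y2 where y12: "y = y1 * (sg ?n * y2)" "y1 \<in> B ?n" "y2 \<in> B ?n"
        using y unfolding N_def by blast
      \<comment> \<open>Between the two letters sigma_n, the induction hypothesis lets y1 have at
        most one sigma_(n-1). With none, the sigma_n meet and \<open>square\<close> applies; with
        one, the braid relation leaves a single sigma_n.\<close>
      have "Q (a * sg ?n * (y1 * (sg ?n * (y2 * b))))"
      proof (rule Suc.IH[OF y12(2)])
        fix u
        assume "u \<in> N m"
        then consider "u \<in> B m" | v v' where "1 \<le> m" "u = v * (sg m * v')" "v \<in> B m" "v' \<in> B m"
          unfolding N_def by blast
        then show "Q (a * sg ?n * (u * (sg ?n * (y2 * b))))"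
        proof cases
          case 1
          then have u: "u \<in> B ?n" "sg ?n * u = u * sg ?n"
            using strands_commute(1)[OF Bstrands[OF 1], of ?n] Bmono[of u m ?n] by auto
          have "Q (a * u * (sg ?n * (sg ?n * (y2 * b))))"
            using hyp[OF N1[of ?n u y2]] hyp[of "u * y2"] u(1) y12
            by (intro square) (auto simp: mult.assoc N_def)
          also have "a * u * (sg ?n * (sg ?n * (y2 * b))) = a * sg ?n * (u * (sg ?n * (y2 * b)))"
            using u(2) by (metis mult.assoc)
          finally show ?thesis .
        next
          case 2
          have c: "sg ?n * v = v * sg ?n" "sg ?n * v' = v' * sg ?n"
            using strands_commute(1)[OF Bstrands, of _ m ?n] 2 by auto
          have B: "v * sg m \<in> B ?n" "sg m * (v' * y2) \<in> B ?n"
            using 2 y12 Bmono[of v m ?n] Bmono[of v' m ?n] by auto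
          have "sg ?n * (u * sg ?n) = v * (sg ?n * (sg m * sg ?n)) * v'"
            using c unfolding 2(2) by (metis mult.assoc)
          also have "\<dots> = v * (sg m * (sg ?n * sg m)) * v'"
            using braid_relation[OF 2(1)] by simp
          finally have "a * sg ?n * (u * (sg ?n * (y2 * b))) = a * (v * sg m * (sg ?n * (sg m * (v' * y2))) * b)"
            by (metis mult.assoc)
          then show ?thesis
            using hyp[OF N1[OF _ B]] by simp
        qed
      qed
      then show ?thesis
        by (simp add: y12(1) mult.assoc)
    qed
    have left: "Q (a * (l * (y * b)))"
      if "l \<in> {sg i, sgi i}" "1 \<le> i" "i < Suc ?n" "y \<in> N ?n" "\<And>y. y \<in> N ?n \<Longrightarrow> Q (a * (y * b))" for l i y a b
    proof (cases "i = ?n")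
      case True
      then show ?thesis
        using that top[OF that(4,5)] inverse[of ?n a "y * b"] by auto
    next
      case False
      then have l: "l \<in> B ?n"
        using that by auto
      have "l * y \<in> N ?n"
        using that(4) unfolding N_def
        by (auto simp: l) (metis Bmult l mult.assoc)
      then show ?thesis
        using that(5)[of "l * y"] by (simp add: mult.assoc)
    qed
    obtain w where w: "x = cls w" "w \<in> words (Suc ?n)" "taus w = 0"
      using Suc.prems(1) unfolding B_def by blast
    show ?case
      using w(2,3) Suc.prems(2) unfolding w(1)
    proof (induction w arbitrary: a)
      case Nil
      have "1 \<in> N ?n"
        by (simp add: N_def)
      from Nil(3)[OF this] show ?case
        by (simp add: cls_Nil)
    next
      case (Cons l w)
      have l: "cls [l] \<in> {sg (idx l), sgi (idx l)}" "1 \<le> idx l" "idx l < Suc ?n"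
        using Cons.prems by (cases l; auto simp: sg_def sgi_def)+
      have "Q (a * cls [l] * (cls w * b))"
        using Cons.prems left[OF l _ Cons.prems(3)] by (intro Cons.IH) (auto simp: mult.assoc split: if_splits)
      then show ?case
        by (simp add: cls_Cons[of l w] mult.assoc)
    qed
  qed
  have all: "x \<in> B n \<Longrightarrow> Q x" for x n
  proof (induction n arbitrary: x)
    case 0
    then show ?case
      using one by (auto simp: B_def words_trivial cls_Nil)
  next
    case (Suc n)
    have "Q y" if "y \<in> N n" for y
      using that unfolding N_def
    proof (elim UnE CollectE exE conjE)
      fix u v
      assume y: "y = u * (sg n * v)" "1 \<le> n" "u \<in> B n" "v \<in> B n"
      \<comment> \<open>Cyclicity moves the only sigma_n to the end, where \<open>stabilise\<close>
        drops it.\<close>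
      have "Q (v * u * sg n)"
        using y Suc.IH[of "v * u"] by (intro stabilise Bstrands) auto
      then show "Q y"
        using cyclic[of v "u * sg n"] by (simp add: y mult.assoc)
    qed (rule Suc.IH)
    then show ?case
      using reduce[OF Suc.prems, of 1 1] by simp
  qed
  obtain w where w: "x = cls w" "valid w" "taus w = 0"
    using assms(1) by (auto simp: graded_def)
  then obtain n where "w \<in> words n"
    using valid_words by blast
  then show "Q x"
    using w by (intro all[of _ n]) (auto simp: B_def)
qed

text \<open>The difference h vanishes at 1, and its zeros are closed under every rule of
  \<open>braid_induct\<close>.\<close>

lemma markov_functional_unique:
  assumes "markov_functional 0 f" "markov_functional 0 g" "g 1 = 1"
  shows "f x = f 1 * g x"
proof -
  define h where "h = (\<lambda>x. 1 * f x + (- f 1) * g x)"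
  interpret markov_functional 0 h
    unfolding h_def using assms(1,2) by (rule markov_functional_linear)
  have "h x = 0"
  proof (cases "x \<in> graded 0")
    case True
    then show ?thesis
    proof (induction rule: braid_induct)
      case one
      then show ?case by (simp add: h_def assms(3))
    next
      case (cyclic x y)
      then show ?case by (metis markov_functional.cyclic[OF markov_functional_axioms])
    qed (simp_all add: quadratic inverse_letter stabilise)
  qed (rule support)
  then show ?thesis
    by (simp add: h_def)
qed

text \<open>For every \<open>N\<close>, the Hecke algebra acts on functions of colourings of the strands by
  \<open>{0..<N}\<close>, and a weighted trace of this action is a Markov functional whose parameter \<open>z\<close>
  takes the value \<open>q^N / (1 + q + \<dots> + q^(N-1))\<close>. By \<open>braid_induct\<close> the trace of a braid is a
  polynomial in that value; interpolation gives the functional with generic \<open>z\<close>.\<close>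

definition swap :: "nat \<Rightarrow> (nat \<Rightarrow> nat) \<Rightarrow> nat \<Rightarrow> nat"
  where "swap k c = c(k := c (Suc k), Suc k := c k)"

text \<open>Jimbo's R-matrix for gl_N, normalised to the eigenvalues q and -1 and written as an
  operator on functions. Only the order of two colours enters; N appears later through
  \<open>colours\<close>.\<close>

definition sig_op :: "nat \<Rightarrow> ((nat \<Rightarrow> nat) \<Rightarrow> K) \<Rightarrow> (nat \<Rightarrow> nat) \<Rightarrow> K"
  where "sig_op k f c =
    (if c k = c (Suc k) then q_var * f c
     else if c k < c (Suc k) then q_var * f (swap k c) + (q_var - 1) * f c
     else f (swap k c))"

text \<open>Sending tau to 0 makes every relation that contains it hold, so the action is defined on
  the whole stable monoid although only braids matter.\<close>

primrec letter_op :: "letter \<Rightarrow> ((nat \<Rightarrow> nat) \<Rightarrow> K) \<Rightarrow> (nat \<Rightarrow> nat) \<Rightarrow> K"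
  where
    "letter_op (Sig k) f = sig_op k f"
  | "letter_op (SigInv k) f = (\<lambda>c. (sig_op k f c - (q_var - 1) * f c) / q_var)"
  | "letter_op (Tau k) f = (\<lambda>c. 0)"

lemma swap_simps [simp]:
  "swap k c k = c (Suc k)" "swap k c (Suc k) = c k"
  "i \<noteq> k \<Longrightarrow> i \<noteq> Suc k \<Longrightarrow> swap k c i = c i"
  "swap k (swap k c) = c"
  by (auto simp: swap_def)

lemma swap_braid: "swap k (swap (Suc k) (swap k c)) = swap (Suc k) (swap k (swap (Suc k) c))"
  by (auto simp: swap_def fun_eq_iff)

lemma swap_far: "Suc k < l \<Longrightarrow> swap k (swap l c) = swap l (swap k c)"
  by (auto simp: swap_def fun_eq_iff)

lemma q_var_nonzero [simp]: "q_var \<noteq> 0"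
  by (rule q_var_simps)

lemma sig_op_square: "sig_op k (sig_op k f) c = (q_var - 1) * sig_op k f c + q_var * f c"
  by (simp add: sig_op_def algebra_simps)

lemma sig_op_braid:
  "sig_op k (sig_op (Suc k) (sig_op k f)) c = sig_op (Suc k) (sig_op k (sig_op (Suc k) f)) c"
proof -
  have eq: "swap k c = c" if "c k = c (Suc k)" for k and c :: "nat \<Rightarrow> nat"
    using that by (auto simp: swap_def)
  consider "c k < c (Suc k)" | "c k = c (Suc k)" | "c k > c (Suc k)" by linarith
  then show ?thesis
    by cases
      (cases "c (Suc k)" "c (Suc (Suc k))" rule: linorder_cases;
       cases "c k" "c (Suc (Suc k))" rule: linorder_cases;
       simp add: sig_op_def swap_braid eq; simp add: algebra_simps)+
qed

lemma sig_op_far: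
  assumes "Suc k < l"
  shows "sig_op k (sig_op l f) c = sig_op l (sig_op k f) c"
  using assms swap_far[OF assms] by (auto simp: sig_op_def algebra_simps)

lemma sig_op_linear:
  "sig_op k (\<lambda>c. a * f c + b * g c) c = a * sig_op k f c + b * sig_op k g c"
  by (auto simp: sig_op_def algebra_simps)

lemma letter_op_inverse:
  "letter_op (Sig k) (letter_op (SigInv k) f) = f" "letter_op (SigInv k) (letter_op (Sig k) f) = f"
proof -
  have inv: "letter_op (SigInv k) f = (\<lambda>c. (1 / q_var) * sig_op k f c + (- (q_var - 1) / q_var) * f c)" for f
    by (simp add: fun_eq_iff field_simps)
  have 1: "(1 / q_var) * ((q_var - 1) * s + q_var * t) + (- (q_var - 1) / q_var) * s = t" for s t
    by (simp add: field_simps)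
  show "letter_op (Sig k) (letter_op (SigInv k) f) = f" "letter_op (SigInv k) (letter_op (Sig k) f) = f"
    by (simp_all only: inv letter_op.simps(1) fun_eq_iff sig_op_linear sig_op_square 1 simp_thms)
qed

definition word_op :: "word \<Rightarrow> ((nat \<Rightarrow> nat) \<Rightarrow> K) \<Rightarrow> (nat \<Rightarrow> nat) \<Rightarrow> K"
  where "word_op w = foldr letter_op w"

lemma word_op_simps [simp]:
  "word_op [] f = f" "word_op (x # w) f = letter_op x (word_op w f)"
  "word_op (u @ v) f = word_op u (word_op v f)"
  by (simp_all add: word_op_def)

lemma word_op_relation: "defining_relation n r s \<Longrightarrow> word_op r f = word_op s f"
proof (induction rule: defining_relation.induct)
  case (4 k l)
  then have "l = Suc k \<or> k = Suc l" by linarith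
  then show ?case
    using sig_op_braid by (auto simp: fun_eq_iff)
next
  case (6 k l)
  then have "Suc k < l \<or> Suc l < k" by linarith
  then show ?case
    using sig_op_far by (auto simp: fun_eq_iff)
qed (use letter_op_inverse in \<open>auto simp: fun_eq_iff sig_op_def\<close>)

lemma word_op_stable_eq: "stable_eq u v \<Longrightarrow> word_op u = word_op v"
proof (induction rule: stable_eq.induct)
  case (rel n r s a b)
  then show ?case
    by (simp add: fun_eq_iff word_op_relation[OF rel])
qed simp_all

lift_definition braid_op :: "sbraid \<Rightarrow> ((nat \<Rightarrow> nat) \<Rightarrow> K) \<Rightarrow> (nat \<Rightarrow> nat) \<Rightarrow> K" is word_op
  by (rule word_op_stable_eq)

lemma braid_op_cls: "braid_op (cls w) = word_op w"
  by transfer simp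

lemma braid_op_mult: "braid_op (x * y) f = braid_op x (braid_op y f)"
  by transfer simp

lemma braid_op_one: "braid_op 1 f = f"
  by transfer simp

lemma braid_op_sg: "braid_op (sg k) f = sig_op k f"
  by (simp add: sg_def braid_op_cls)

section \<open>Weighted traces of the matrix representation\<close>

text \<open>The value 0 outside 1, ..., n makes each colouring of n strands a unique function, so
  the set is finite.\<close>

definition colours :: "nat \<Rightarrow> nat \<Rightarrow> (nat \<Rightarrow> nat) set"
  where "colours N n = {c. (\<forall>i\<in>{1..n}. c i < N) \<and> (\<forall>i. i \<notin> {1..n} \<longrightarrow> c i = 0)}"

text \<open>The diagonal operator with entries q^j on every strand. It is the twist that makes the
  partial trace of sigma_n over the last strand a scalar.\<close>

definition weight :: "nat \<Rightarrow> (nat \<Rightarrow> nat) \<Rightarrow> K"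
  where "weight n c = q_var ^ (\<Sum>i=1..n. c i)"

definition entry :: "sbraid \<Rightarrow> (nat \<Rightarrow> nat) \<Rightarrow> (nat \<Rightarrow> nat) \<Rightarrow> K"
  where "entry x c c' = braid_op x (\<lambda>e. if e = c' then 1 else 0) c"

definition weighted_trace :: "nat \<Rightarrow> nat \<Rightarrow> sbraid \<Rightarrow> K"
  where "weighted_trace N n x = (\<Sum>c\<in>colours N n. weight n c * entry x c c)"

lemma colours_0: "colours N 0 = {\<lambda>i. 0}"
  by (auto simp: colours_def)

lemma colours_Suc: "colours N (Suc n) = (\<lambda>(c, j). c(Suc n := j)) ` (colours N n \<times> {..<N})"
proof (intro equalityI subsetI)
  fix c
  assume c: "c \<in> colours N (Suc n)"
  then have "c(Suc n := 0) \<in> colours N n" "c (Suc n) < N" "c = (c(Suc n := 0))(Suc n := c (Suc n))"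
    by (auto simp: colours_def)
  then show "c \<in> (\<lambda>(c, j). c(Suc n := j)) ` (colours N n \<times> {..<N})"
    by (intro image_eqI[of _ _ "(c(Suc n := 0), c (Suc n))"]) auto
qed (auto simp: colours_def)

lemma colours_Suc_inj: "inj_on (\<lambda>(c, j). c(Suc n := j)) (colours N n \<times> {..<N})"
proof -
  have "c = c'" if "c (Suc n) = 0" "c' (Suc n) = 0" "c(Suc n := j) = c'(Suc n := j')"
    for c c' :: "nat \<Rightarrow> nat" and j j'
    using that by (metis fun_upd_triv fun_upd_upd)
  then show ?thesis
    by (auto simp: inj_on_def colours_def dest: fun_cong[of _ _ "Suc n"])
qed

lemma finite_colours: "finite (colours N n)"
  by (induction n) (simp_all add: colours_0 colours_Suc)

lemma sum_colours_Suc: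
  "(\<Sum>c\<in>colours N (Suc n). g c) = (\<Sum>c\<in>colours N n. \<Sum>j<N. g (c(Suc n := j)))"
  unfolding colours_Suc by (subst sum.reindex[OF colours_Suc_inj]) (simp add: sum.cartesian_product case_prod_beta)

lemma swap_colours: "c \<in> colours N n \<Longrightarrow> 1 \<le> k \<Longrightarrow> k < n \<Longrightarrow> swap k c \<in> colours N n"
  by (auto simp: colours_def swap_def)

lemma weight_swap:
  assumes "1 \<le> k" "k < n"
  shows "weight n (swap k c) = weight n c"
proof -
  have split: "{1..n} = {k, Suc k} \<union> ({1..n} - {k, Suc k})"
    using assms by auto
  have "(\<Sum>i=1..n. g i) = g k + g (Suc k) + (\<Sum>i\<in>{1..n} - {k, Suc k}. g i)" for g :: "nat \<Rightarrow> nat"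
    by (subst split, subst sum.union_disjoint) auto
  moreover have "(\<Sum>i\<in>{1..n} - {k, Suc k}. swap k c i) = (\<Sum>i\<in>{1..n} - {k, Suc k}. c i)"
    by (intro sum.cong) auto
  ultimately show ?thesis
    by (simp add: weight_def add.commute)
qed

lemma letter_op_local:
  assumes "f c = g c" "f (swap (idx x) c) = g (swap (idx x) c)"
  shows "letter_op x f c = letter_op x g c"
  using assms by (cases x) (auto simp: sig_op_def)

lemma letter_op_scale: "letter_op x (\<lambda>c. a * f c) c = a * letter_op x f c"
  by (cases x) (auto simp: sig_op_def algebra_simps diff_divide_distrib)

lemma letter_op_sum: "letter_op x (\<lambda>c. \<Sum>i\<in>A. f i c) c = (\<Sum>i\<in>A. letter_op x (f i) c)"
  by (cases x)
    (auto simp: sig_op_def sum.distrib sum_distrib_left sum_subtractf simp flip: sum_divide_distrib)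

lemma mult_delta:
  "(if b then 1 else 0) * x = (if b then x else (0::K))" "x * (if b then 1 else 0) = (if b then x else (0::K))"
  by simp_all

text \<open>A letter on n strands evaluates its argument only at c and at a swap of c, both in the
  finite set \<open>colours N n\<close>; so the action there is given by a finite matrix.\<close>

lemma braid_op_entry:
  assumes "x \<in> strands n" "c \<in> colours N n"
  shows "braid_op x f c = (\<Sum>e\<in>colours N n. entry x c e * f e)"
proof -
  have "word_op w f c = (\<Sum>e\<in>colours N n. word_op w (\<lambda>e'. if e' = e then 1 else 0) c * f e)"
    if "w \<in> words n" for w
    using that assms(2)
  proof (induction w arbitrary: c)
    case Nil
    then show ?case
      by (simp add: finite_colours mult_delta)
  next
    case (Cons x w)
    let ?g = "\<lambda>c. \<Sum>e\<in>colours N n. f e * word_op w (\<lambda>e'. if e' = e then 1 else 0) c"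
    have eq: "word_op w f c = ?g c" if "c \<in> colours N n" for c
      using Cons.prems that by (subst Cons.IH) (auto simp: mult.commute)
    have "swap (idx x) c \<in> colours N n"
      using Cons.prems by (auto intro: swap_colours)
    then have "letter_op x (word_op w f) c = letter_op x ?g c"
      using Cons.prems(2) by (intro letter_op_local eq)
    then show ?case
      by (simp add: letter_op_sum letter_op_scale mult.commute)
  qed
  with assms(1) show ?thesis
    by (auto simp: strands_def braid_op_cls entry_def)
qed

text \<open>The weight is a symmetric function of the colours, hence commutes with the action. This
  makes the weighted trace cyclic.\<close>

lemma entry_weight:
  assumes "x \<in> strands n"
  shows "weight n c * entry x c c' = weight n c' * entry x c c'"
proof -
  have *: "word_op w (\<lambda>e. weight n e * f e) c = weight n c * word_op w f c" if "w \<in> words n" for w f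
    using that
  proof (induction w arbitrary: c)
    case (Cons x w)
    have "word_op (x # w) (\<lambda>e. weight n e * f e) c = letter_op x (\<lambda>e. weight n c * word_op w f e) c"
      using Cons by (auto simp: weight_swap intro!: letter_op_local)
    then show ?case
      by (simp add: letter_op_scale)
  qed simp
  obtain w where w: "x = cls w" "w \<in> words n"
    using assms by (auto simp: strands_def)
  have "weight n c * entry x c c' = word_op w (\<lambda>e. weight n e * (if e = c' then 1 else 0)) c"
    using *[OF w(2)] by (simp add: w entry_def braid_op_cls)
  also have "(\<lambda>e. weight n e * (if e = c' then 1 else 0)) = (\<lambda>e. weight n c' * (if e = c' then 1 else 0))"
    by auto
  also have "word_op w \<dots> c = weight n c' * word_op w (\<lambda>e. if e = c' then 1 else 0) c"
  proof (induction w arbitrary: c)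
    case (Cons x w)
    then have "word_op w (\<lambda>e. weight n c' * (if e = c' then 1 else 0)) =
        (\<lambda>c. weight n c' * word_op w (\<lambda>e. if e = c' then 1 else 0) c)"
      by blast
    then show ?case
      by (simp add: letter_op_scale)
  qed simp
  finally show ?thesis
    by (simp add: w entry_def braid_op_cls)
qed

lemma weighted_trace_mult:
  assumes "x \<in> strands n" "y \<in> strands n"
  shows "weighted_trace N n (x * y)
    = (\<Sum>c\<in>colours N n. \<Sum>e\<in>colours N n. weight n c * (entry x c e * entry y e c))"
proof -
  have "entry (x * y) c c = (\<Sum>e\<in>colours N n. entry x c e * entry y e c)" if "c \<in> colours N n" for c
    by (simp add: entry_def[of "x * y"] braid_op_mult braid_op_entry[OF assms(1) that] entry_def[of y])
  then show ?thesis
    by (simp add: weighted_trace_def sum_distrib_left)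
qed

lemma weighted_trace_cyclic:
  assumes "x \<in> strands n" "y \<in> strands n"
  shows "weighted_trace N n (x * y) = weighted_trace N n (y * x)"
proof -
  have *: "weight n e * (entry x e c * entry y c e) = weight n c * (entry y c e * entry x e c)" for c e
    by (simp only: mult.assoc[symmetric] entry_weight[OF assms(1), of e c]) (simp only: ac_simps)
  show ?thesis
    unfolding weighted_trace_mult[OF assms] weighted_trace_mult[OF assms(2,1)]
    by (subst sum.swap) (simp only: *)
qed

lemma weighted_trace_square:
  assumes "x \<in> strands n" "y \<in> strands n" "1 \<le> k" "k < n"
  shows "weighted_trace N n (x * (sg k * (sg k * y)))
    = (q_var - 1) * weighted_trace N n (x * (sg k * y)) + q_var * weighted_trace N n (x * y)"
proof -
  have *: "entry (x * (sg k * (sg k * y))) c c = (q_var - 1) * entry (x * (sg k * y)) c c + q_var * entry (x * y) c c"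
    if "c \<in> colours N n" for c
    using that
    by (simp add: entry_def[of "_ * _"] braid_op_mult braid_op_sg braid_op_entry[OF assms(1)] sig_op_square
        sum.distrib sum_subtractf sum_distrib_left algebra_simps)
  have "weighted_trace N n (x * (sg k * (sg k * y))) = (\<Sum>c\<in>colours N n.
      (q_var - 1) * (weight n c * entry (x * (sg k * y)) c c) + q_var * (weight n c * entry (x * y) c c))"
    unfolding weighted_trace_def
    by (rule sum.cong[OF HOL.refl], subst *, assumption) (simp add: distrib_left mult.left_commute)
  then show ?thesis
    unfolding weighted_trace_def sum_distrib_left sum.distrib[symmetric] .
qed

definition geometric :: "nat \<Rightarrow> K"
  where "geometric N = (\<Sum>j<N. q_var ^ j)"

lemma weight_Suc: "weight (Suc n) (c(Suc n := j)) = weight n c * q_var ^ j"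
proof -
  have "(\<Sum>i=1..n. (c(Suc n := j)) i) = (\<Sum>i=1..n. c i)"
    by (intro sum.cong) auto
  then show ?thesis
    by (simp add: weight_def power_add)
qed

lemma entry_Suc:
  assumes "x \<in> strands n" "c \<in> colours N n"
  shows "braid_op x f (c(Suc n := j)) = (\<Sum>e\<in>colours N n. entry x c e * f (e(Suc n := j)))"
proof -
  define u where "u e = e(Suc n := j)" for e :: "nat \<Rightarrow> nat"
  have "word_op w f (u c) = word_op w (\<lambda>e. f (u e)) c" if "w \<in> words n" for w
    using that
  proof (induction w arbitrary: c)
    case (Cons x w)
    then have k: "idx x < n" and IH: "\<And>c. word_op w f (u c) = word_op w (\<lambda>e. f (u e)) c"
      by auto
    have "swap (idx x) (u c) = u (swap (idx x) c)" "u c (idx x) = c (idx x)" "u c (Suc (idx x)) = c (Suc (idx x))"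
      using k by (auto simp: swap_def fun_eq_iff u_def)
    then show ?case
      by (cases x) (simp_all add: sig_op_def IH)
  qed simp
  with assms(1) have "braid_op x f (c(Suc n := j)) = braid_op x (\<lambda>e. f (e(Suc n := j))) c"
    by (auto simp: strands_def braid_op_cls simp flip: u_def)
  then show ?thesis
    by (simp add: braid_op_entry[OF assms])
qed

lemma colours_upd_eq_iff:
  assumes "c \<in> colours N n" "e \<in> colours N n"
  shows "e(Suc n := j) = c(Suc n := j') \<longleftrightarrow> e = c \<and> j = j'"
proof -
  have "c (Suc n) = 0" "e (Suc n) = 0"
    using assms by (auto simp: colours_def)
  then show ?thesis
    by (metis fun_upd_same fun_upd_triv fun_upd_upd)
qed

text \<open>A strand that x does not touch contributes the sum of its own weights, 1 + q + ... +
  q^(N-1).\<close>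

lemma weighted_trace_inclusion:
  assumes "x \<in> strands n"
  shows "weighted_trace N (Suc n) x = geometric N * weighted_trace N n x"
proof -
  have "entry x (c(Suc n := j)) (c(Suc n := j)) = entry x c c" if c: "c \<in> colours N n" for c j
    unfolding entry_def[of x "c(Suc n := j)"] entry_Suc[OF assms c]
    using c by (simp add: colours_upd_eq_iff finite_colours mult_delta)
  then show ?thesis
    unfolding weighted_trace_def sum_colours_Suc weight_Suc geometric_def
    by (simp add: sum_distrib_left sum_distrib_right algebra_simps cong: sum.cong)
qed

lemma geometric_sum_eq: "(q_var - 1) * geometric m = q_var ^ m - 1"
  by (induction m) (simp_all add: geometric_def algebra_simps)

text \<open>For the colour i on strand n, the partial trace over strand n + 1 is q^(i+1) + (q - 1)
  (q^(i+1) + ... + q^(N-1)) = q^N, whatever i is.\<close>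

lemma weighted_trace_stabilise:
  assumes "1 \<le> n" "x \<in> strands n"
  shows "weighted_trace N (Suc n) (x * sg n) = q_var ^ N * weighted_trace N n x"
proof -
  \<comment> \<open>The diagonal entry of sigma_n at the colours i, j of strands n and n +
    1.\<close>
  define h where "h i j = (if i = j then q_var else if i < j then q_var - 1 else 0)" for i j :: nat
  have sum_h: "(\<Sum>j<N. q_var ^ j * h i j) = q_var ^ N" if "i < N" for i
  proof -
    have below: "(\<Sum>j=0..<i. q_var ^ j * h i j) = 0"
      by (intro sum.neutral) (simp add: h_def)
    have above: "(\<Sum>j=Suc i..<N. q_var ^ j * h i j) = (q_var - 1) * (\<Sum>j=Suc i..<N. q_var ^ j)"
      unfolding sum_distrib_left by (intro sum.cong) (simp_all add: h_def mult.commute)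
    have split: "(\<Sum>j<N. q_var ^ j * h i j) = q_var ^ i * h i i + (q_var - 1) * (\<Sum>j=Suc i..<N. q_var ^ j)"
      using sum.atLeastLessThan_concat[of 0 i N "\<lambda>j. q_var ^ j * h i j"] below above that
      by (simp add: lessThan_atLeast0 sum.atLeast_Suc_lessThan[of i])
    have geo: "(\<Sum>j=Suc i..<N. q_var ^ j) = geometric N - geometric (Suc i)"
      using sum.atLeastLessThan_concat[of 0 "Suc i" N "\<lambda>j. q_var ^ j"] that
      by (simp add: geometric_def lessThan_atLeast0 eq_diff_eq add.commute del: sum.op_ivl_Suc)
    show ?thesis
      by (simp only: split geo right_diff_distrib[of "q_var - 1"] geometric_sum_eq) (simp add: h_def)
  qed
  have entry: "entry (x * sg n) (c(Suc n := j)) (c(Suc n := j)) = entry x c c * h (c n) j"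
    if c: "c \<in> colours N n" for c j
  proof -
    define d :: "(nat \<Rightarrow> nat) \<Rightarrow> K" where "d e = (if e = c(Suc n := j) then 1 else 0)" for e
    have "sig_op n d (e(Suc n := j)) = (if e = c then h (c n) j else 0)" if e: "e \<in> colours N n" for e
    proof -
      define u where "u = e(Suc n := j)"
      have u: "u n = e n" "u (Suc n) = j"
        by (simp_all add: u_def)
      have 1: "d u = (if e = c then 1 else 0)"
        using colours_upd_eq_iff[OF c e] by (simp add: d_def u_def)
      \<comment> \<open>After the swap strand n + 1 has the colour e n, while d requires the colour
        j there; unequal colours contribute only through the diagonal.\<close>
      have 2: "d (swap n u) = 0" if "e n \<noteq> j"
      proof -
        have "swap n u (Suc n) = e n" "(c(Suc n := j)) (Suc n) = j"
          using u by simp_all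
        with that have "swap n u \<noteq> c(Suc n := j)"
          by metis
        then show ?thesis
          by (simp add: d_def)
      qed
      have "sig_op n d u = (if e n = j then q_var * d u else if e n < j then (q_var - 1) * d u else 0)"
        using 2 by (simp add: sig_op_def u)
      then show ?thesis
        unfolding 1 u_def[symmetric] by (simp add: h_def)
    qed
    then show ?thesis
      using c by (simp add: entry_def[of "x * sg n"] braid_op_mult braid_op_sg entry_Suc[OF assms(2) c]
        finite_colours if_distrib[of "\<lambda>t. _ * t"] flip: d_def cong: sum.cong if_cong)
  qed
  have "weighted_trace N (Suc n) (x * sg n)
      = (\<Sum>c\<in>colours N n. weight n c * entry x c c * (\<Sum>j<N. q_var ^ j * h (c n) j))"
    unfolding weighted_trace_def sum_colours_Suc weight_Suc sum_distrib_left
    by (intro sum.cong HOL.refl) (simp add: entry algebra_simps)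
  also have "\<dots> = (\<Sum>c\<in>colours N n. weight n c * entry x c c * q_var ^ N)"
    using assms(1) by (intro sum.cong HOL.refl) (auto simp: colours_def sum_h)
  finally show ?thesis
    by (simp add: weighted_trace_def sum_distrib_left algebra_simps)
qed

lemma geometric_nonzero: "1 \<le> N \<Longrightarrow> geometric N \<noteq> 0"
  using geometric_sum_eq[of N] q_var_power_eq_iff[of N 0] by auto

definition z_value :: "nat \<Rightarrow> K"
  where "z_value N = q_var ^ N / geometric N"

text \<open>Cross-multiplication and the factor q - 1 turn equality into q^M (q^N - 1) = q^N (q^M -
  1), that is, q^M = q^N.\<close>

lemma z_value_inj:
  assumes "1 \<le> M" "1 \<le> N" "z_value M = z_value N"
  shows "M = N"
proof -
  have "q_var ^ M * geometric N = q_var ^ N * geometric M"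
    using assms geometric_nonzero by (simp add: z_value_def field_simps)
  then have "q_var ^ M * ((q_var - 1) * geometric N) = q_var ^ N * ((q_var - 1) * geometric M)"
    by (metis mult.left_commute)
  then have "q_var ^ M = q_var ^ N"
    unfolding geometric_sum_eq by (simp add: algebra_simps)
  then show ?thesis
    by (simp add: q_var_power_eq_iff)
qed

lemma poly_eq_by_z_values:
  assumes "\<And>N. 1 \<le> N \<Longrightarrow> poly p (z_value N) = poly r (z_value N)"
  shows "p = r"
proof (rule ccontr)
  assume "p \<noteq> r"
  then have "finite {x. poly (p - r) x = 0}"
    by (intro poly_roots_finite) simp
  moreover have "z_value ` {1..} \<subseteq> {x. poly (p - r) x = 0}"
    using assms by auto
  ultimately have "finite (z_value ` {1..})"
    by (rule rev_finite_subset)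
  moreover have "inj_on z_value {1..}"
    by (rule inj_onI) (auto intro: z_value_inj)
  ultimately have "finite {1::nat..}"
    by (rule finite_imageD)
  then show False
    by (simp add: infinite_Ici)
qed

section \<open>Normalised traces and interpolation in z\<close>

text \<open>Dividing by \<open>geometric N ^ n\<close> compensates
  \<open>weighted_trace_inclusion\<close> and makes the value independent of n; it also turns the
  stabilisation factor q^N into \<open>z_value N\<close>.\<close>

definition state_trace :: "nat \<Rightarrow> sbraid \<Rightarrow> K"
  where "state_trace N x =
    (let n = LEAST n. x \<in> strands n in weighted_trace N n x / geometric N ^ n)"

lemma state_trace_eq:
  assumes "1 \<le> N" "x \<in> strands n"
  shows "state_trace N x = weighted_trace N n x / geometric N ^ n"
proof -
  define m where "m = (LEAST n. x \<in> strands n)"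
  have m: "x \<in> strands m" "m \<le> n"
    unfolding m_def by (rule LeastI, fact assms) (rule Least_le, fact assms)
  have "weighted_trace N n x / geometric N ^ n = weighted_trace N m x / geometric N ^ m"
    using m(2)
  proof (induction n rule: dec_induct)
    case (step k)
    then show ?case
      using weighted_trace_inclusion[OF strands_mono[OF m(1), of k], of N] geometric_nonzero[OF assms(1)]
      by simp
  qed simp
  then show ?thesis
    by (simp add: state_trace_def Let_def flip: m_def)
qed

lemma state_trace_one: "1 \<le> N \<Longrightarrow> state_trace N 1 = 1"
  by (simp add: state_trace_eq[of N 1 0] weighted_trace_def colours_0 weight_def entry_def braid_op_one)

lemma state_trace_cyclic:
  assumes "1 \<le> N" "x * y \<in> graded d"
  shows "state_trace N (x * y) = state_trace N (y * x)"
proof -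
  obtain n where "x \<in> strands n" "y \<in> strands n"
    using common_strands[OF assms(2)] by blast
  then show ?thesis
    using assms(1) by (simp add: state_trace_eq[of N _ n] weighted_trace_cyclic[of x n y])
qed

lemma state_trace_square:
  assumes "1 \<le> N" "x * y \<in> graded d" "1 \<le> k"
  shows "state_trace N (x * (sg k * (sg k * y)))
    = (q_var - 1) * state_trace N (x * (sg k * y)) + q_var * state_trace N (x * y)"
proof -
  obtain n where "Suc k \<le> n" "x \<in> strands n" "y \<in> strands n"
    using common_strands[OF assms(2), of "Suc k"] by blast
  then show ?thesis
    using assms by (simp add: state_trace_eq[of N _ n] weighted_trace_square add_divide_distrib)
qed

lemma state_trace_stabilise:
  assumes "1 \<le> N" "1 \<le> n" "x \<in> strands n"
  shows "state_trace N (x * sg n) = z_value N * state_trace N x"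
  using assms strands_mono[of x n "Suc n"]
  by (simp add: state_trace_eq[of N _ n] state_trace_eq[of N "_ * _" "Suc n"] weighted_trace_stabilise
      z_value_def geometric_nonzero)

text \<open>The point is that one polynomial works for all N: every rule of
  \<open>braid_induct\<close> combines polynomials with coefficients independent of N, and
  stabilisation multiplies by the variable.\<close>

lemma state_trace_polynomial:
  assumes "x \<in> graded 0"
  shows "\<exists>p. \<forall>N\<ge>1. poly p (z_value N) = state_trace N x"
proof -
  \<comment> \<open>The rules of \<open>braid_induct\<close> speak of all elements, so membership in
    degree 0 is carried inside the predicate.\<close>
  have "x \<in> graded 0 \<longrightarrow> (\<exists>p. \<forall>N\<ge>1. poly p (z_value N) = state_trace N x)"
    using assms
  proof (induction rule: braid_induct)
    case one
    then show ?case
      by (intro impI exI[of _ 1]) (simp add: state_trace_one)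
  next
    case (cyclic x y)
    then show ?case
      using state_trace_cyclic[of _ x y 0] graded_mult_commute[of x y 0] by auto
  next
    case (square k x y)
    show ?case
    proof
      assume "x * (sg k * (sg k * y)) \<in> graded 0"
      then have g: "x * y \<in> graded 0" "x * (sg k * y) \<in> graded 0"
        using square(1) by (simp_all add: graded_insert_sg)
      with square obtain p p' where "\<forall>N\<ge>1. poly p (z_value N) = state_trace N (x * (sg k * y))"
        "\<forall>N\<ge>1. poly p' (z_value N) = state_trace N (x * y)"
        by blast
      then show "\<exists>p. \<forall>N\<ge>1. poly p (z_value N) = state_trace N (x * (sg k * (sg k * y)))"
        using state_trace_square[OF _ g(1) square(1)]
        by (intro exI[of _ "smult (q_var - 1) p + smult q_var p'"]) simp
    qed
  next
    case (inverse k x y)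
    show ?case
    proof
      assume "x * (sgi k * y) \<in> graded 0"
      then have g: "x * y \<in> graded 0" "x * (sg k * y) \<in> graded 0" "x * (sgi k * y) \<in> graded 0"
        using inverse(1) by (simp_all add: graded_insert_sg)
      with inverse obtain p p' where "\<forall>N\<ge>1. poly p (z_value N) = state_trace N (x * (sg k * y))"
        "\<forall>N\<ge>1. poly p' (z_value N) = state_trace N (x * y)"
        by blast
      then show "\<exists>p. \<forall>N\<ge>1. poly p (z_value N) = state_trace N (x * (sgi k * y))"
        using state_trace_square[OF _ g(3) inverse(1)] inverse(1)
        by (intro exI[of _ "smult (1 / q_var) (p - smult (q_var - 1) p')"]) (simp add: field_simps)
    qed
  next
    case (stabilise n x)
    show ?case
    proof
      assume "x * sg n \<in> graded 0"
      then have "x \<in> graded 0"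
        using graded_insert_sg(1)[of n x 1 0] stabilise(1) by simp
      with stabilise obtain p where "\<forall>N\<ge>1. poly p (z_value N) = state_trace N x"
        by blast
      then show "\<exists>p. \<forall>N\<ge>1. poly p (z_value N) = state_trace N (x * sg n)"
        using state_trace_stabilise[OF _ stabilise(1,2)] by (intro exI[of _ "[:0, 1:] * p"]) simp
    qed
  qed
  with assms show ?thesis by blast
qed

text \<open>The choice is unique, since infinitely many values are prescribed; see
  \<open>ocneanu_poly_eqI\<close>.\<close>

definition ocneanu_poly :: "sbraid \<Rightarrow> K poly"
  where "ocneanu_poly x = (if x \<in> graded 0 then SOME p. \<forall>N\<ge>1. poly p (z_value N) = state_trace N x else 0)"

lemma ocneanu_poly_eqI:
  assumes "x \<in> graded 0" "\<And>N. 1 \<le> N \<Longrightarrow> poly p (z_value N) = state_trace N x"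
  shows "ocneanu_poly x = p"
proof (rule poly_eq_by_z_values)
  fix N :: nat
  assume "1 \<le> N"
  then show "poly (ocneanu_poly x) (z_value N) = poly p (z_value N)"
    using someI_ex[OF state_trace_polynomial[OF assms(1)]] assms by (simp add: ocneanu_poly_def)
qed

lemma poly_ocneanu_poly:
  "x \<in> graded 0 \<Longrightarrow> 1 \<le> N \<Longrightarrow> poly (ocneanu_poly x) (z_value N) = state_trace N x"
  using someI_ex[OF state_trace_polynomial[of x]] by (simp add: ocneanu_poly_def)

definition ocneanu :: "sbraid \<Rightarrow> Kz"
  where "ocneanu x = to_fract (ocneanu_poly x)"

lemma ocneanu_one: "ocneanu 1 = 1"
proof -
  have "ocneanu_poly 1 = 1"
    using graded_generators(1)[of 1] by (intro ocneanu_poly_eqI) (simp_all add: state_trace_one)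
  then show ?thesis by (simp add: ocneanu_def)
qed

text \<open>Each condition is an identity between polynomials in z, checked at the values
  \<open>z_value N\<close> by the corresponding property of \<open>state_trace\<close>.\<close>

lemma ocneanu_markov: "markov_functional 0 ocneanu"
proof
  fix x
  show "x \<notin> graded 0 \<Longrightarrow> ocneanu x = 0"
    by (simp add: ocneanu_def ocneanu_poly_def)
next
  fix x y
  show "ocneanu (x * y) = ocneanu (y * x)"
  proof (cases "x * y \<in> graded 0")
    case True
    then have "ocneanu_poly (x * y) = ocneanu_poly (y * x)"
      using graded_mult_commute[of x y 0]
      by (intro ocneanu_poly_eqI) (simp_all add: poly_ocneanu_poly state_trace_cyclic[OF _ True])
    then show ?thesis by (simp add: ocneanu_def)
  next
    case False
    then show ?thesis
      using graded_mult_commute[of x y 0] by (simp add: ocneanu_def ocneanu_poly_def)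
  qed
next
  fix k :: nat and x y
  assume k: "1 \<le> k"
  show "ocneanu (x * (sg k * (sg k * y))) = (qq - 1) * ocneanu (x * (sg k * y)) + qq * ocneanu (x * y)"
  proof (cases "x * y \<in> graded 0")
    case True
    then have "ocneanu_poly (x * (sg k * (sg k * y)))
        = [:q_var - 1:] * ocneanu_poly (x * (sg k * y)) + [:q_var:] * ocneanu_poly (x * y)"
      using k by (intro ocneanu_poly_eqI)
        (simp_all add: poly_ocneanu_poly graded_insert_sg state_trace_square[OF _ True])
    moreover have "to_fract [:q_var - 1:] = qq - 1"
      unfolding K_to_Kz_def[symmetric] by simp
    ultimately show ?thesis
      unfolding ocneanu_def by (simp only: to_fract_add to_fract_mult) (simp add: K_to_Kz_def)
  next
    case False
    then show ?thesis
      using k by (simp add: ocneanu_def ocneanu_poly_def graded_insert_sg)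
  qed
next
  fix n :: nat and x
  assume n: "1 \<le> n" "x \<in> strands n"
  have iff: "x * sg n \<in> graded 0 \<longleftrightarrow> x \<in> graded 0"
    using graded_insert_sg(1)[of n x 1 0] n by simp
  show "ocneanu (x * sg n) = z_var * ocneanu x"
  proof (cases "x \<in> graded 0")
    case True
    then have "ocneanu_poly (x * sg n) = [:0, 1:] * ocneanu_poly x"
      by (intro ocneanu_poly_eqI) (simp_all add: iff poly_ocneanu_poly state_trace_stabilise[OF _ n])
    then show ?thesis
      unfolding ocneanu_def by (simp only: to_fract_mult z_var_def)
  next
    case False
    then show ?thesis
      by (simp add: ocneanu_def ocneanu_poly_def iff)
  qed
qed

section \<open>Monoid algebras\<close>

abbreviation (input) "lookup \<equiv> Poly_Mapping.lookup"
abbreviation (input) "keys \<equiv> Poly_Mapping.keys"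
abbreviation (input) "single \<equiv> Poly_Mapping.single"

text \<open>\<open>\<phi>\<close> receives key and coefficient together, so that codomains with
  different scalar actions of K are covered.\<close>

definition lin_ext :: "('m \<Rightarrow> 'k \<Rightarrow> 'v) \<Rightarrow> ('m \<Rightarrow>\<^sub>0 'k::zero) \<Rightarrow> 'v::comm_monoid_add"
  where "lin_ext \<phi> f = (\<Sum>x\<in>keys f. \<phi> x (lookup f x))"

definition additive_family :: "('m \<Rightarrow> 'k::plus \<Rightarrow> 'v::plus) \<Rightarrow> bool"
  where "additive_family \<phi> \<longleftrightarrow> (\<forall>x a b. \<phi> x (a + b) = \<phi> x a + \<phi> x b)"

lemma additive_family_0:
  fixes \<phi> :: "'m \<Rightarrow> 'k::monoid_add \<Rightarrow> 'v::cancel_comm_monoid_add"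
  assumes "additive_family \<phi>"
  shows "\<phi> x 0 = 0"
proof -
  have "\<phi> x (0 + 0) = \<phi> x 0 + \<phi> x 0"
    using assms unfolding additive_family_def by blast
  then show ?thesis by simp
qed

lemma lin_ext_superset:
  fixes \<phi> :: "'m \<Rightarrow> 'k::monoid_add \<Rightarrow> 'v::cancel_comm_monoid_add"
  assumes "additive_family \<phi>" "finite U" "keys f \<subseteq> U"
  shows "lin_ext \<phi> f = (\<Sum>x\<in>U. \<phi> x (lookup f x))"
  unfolding lin_ext_def using assms
  by (intro sum.mono_neutral_left) (auto simp: additive_family_0 in_keys_iff)

lemma lin_ext_add:
  fixes \<phi> :: "'m \<Rightarrow> 'k::monoid_add \<Rightarrow> 'v::cancel_comm_monoid_add"
  assumes "additive_family \<phi>"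
  shows "lin_ext \<phi> (f + g) = lin_ext \<phi> f + lin_ext \<phi> g"
proof -
  let ?U = "keys f \<union> keys g"
  have "keys (f + g) \<subseteq> ?U"
    by (rule keys_add)
  then show ?thesis
    using assms unfolding additive_family_def
    by (simp add: lin_ext_superset[OF assms, of ?U] lookup_add sum.distrib)
qed

lemma lin_ext_single:
  fixes \<phi> :: "'m \<Rightarrow> 'k::monoid_add \<Rightarrow> 'v::cancel_comm_monoid_add"
  assumes "additive_family \<phi>"
  shows "lin_ext \<phi> (single x a) = \<phi> x a"
  by (subst lin_ext_superset[OF assms, of "{x}"]) auto

lemma lin_ext_zero [simp]: "lin_ext \<phi> 0 = 0"
  by (simp add: lin_ext_def)

lemma keys_subset_induct [consumes 1, case_names zero add]:
  fixes f :: "'m \<Rightarrow>\<^sub>0 'k::comm_monoid_add"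
  assumes "keys f \<subseteq> S" "P 0"
    and "\<And>f x a. keys f \<subseteq> S \<Longrightarrow> P f \<Longrightarrow> x \<in> S \<Longrightarrow> P (f + single x a)"
  shows "P f"
proof -
  have "keys (\<Sum>x\<in>A. single x (lookup f x)) \<subseteq> S \<and> P (\<Sum>x\<in>A. single x (lookup f x))" if "A \<subseteq> keys f" for A
    using finite_subset[OF that finite_keys] that
  proof (induction A rule: finite_induct)
    case (insert x A)
    let ?s = "\<Sum>x\<in>A. single x (lookup f x)"
    have *: "keys ?s \<subseteq> S" "P ?s" "x \<in> S"
      using insert assms(1) by auto
    moreover have "keys (?s + single x (lookup f x)) \<subseteq> S"
      using keys_add[of ?s "single x (lookup f x)"] * by (auto split: if_splits)
    ultimately show ?case
      using assms(3)[OF *] insert by (simp add: add.commute)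
  qed (use assms in simp)
  moreover have "(\<Sum>x\<in>keys f. single x (lookup f x)) = f"
    by (rule poly_mapping_eqI)
      (simp add: lookup_sum lookup_single when_def in_keys_iff)
  ultimately show ?thesis
    by (metis order_refl)
qed

lemma additive_unique:
  fixes L L' :: "('m \<Rightarrow>\<^sub>0 'k::comm_monoid_add) \<Rightarrow> 'v::cancel_comm_monoid_add"
  assumes "keys f \<subseteq> S"
    and "\<And>f g. L (f + g) = L f + L g" "\<And>f g. L' (f + g) = L' f + L' g"
    and "\<And>x a. x \<in> S \<Longrightarrow> L (single x a) = L' (single x a)"
  shows "L f = L' f"
  using assms(1)
proof (induction rule: keys_subset_induct)
  case zero
  show ?case
    using assms(2)[of 0 0] assms(3)[of 0 0] by simp
qed (simp add: assms)

lemma monoid_algebra_simps: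
  "carrier (monoid_algebra M) = {f. keys f \<subseteq> carrier M}"
  "\<zero>\<^bsub>monoid_algebra M\<^esub> = 0"
  "\<one>\<^bsub>monoid_algebra M\<^esub> = single \<one>\<^bsub>M\<^esub> 1"
  "f \<oplus>\<^bsub>monoid_algebra M\<^esub> g = f + g"
  by (simp_all add: monoid_algebra_def)

lemma monoid_algebra_mult:
  "f \<otimes>\<^bsub>monoid_algebra M\<^esub> g = lin_ext (\<lambda>u a. lin_ext (\<lambda>v b. single (u \<otimes>\<^bsub>M\<^esub> v) (a * b)) g) f"
  by (simp add: monoid_algebra_def lin_ext_def)

context
  fixes M :: "('m, 'x) monoid_scheme"
begin

lemma additive_mult:
  fixes a :: "'k::comm_ring_1"
  shows "additive_family (\<lambda>v b. single (u \<otimes>\<^bsub>M\<^esub> v) (a * b))"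
    "additive_family (\<lambda>u a. lin_ext (\<lambda>v b. single (u \<otimes>\<^bsub>M\<^esub> v) (a * b)) (g :: 'm \<Rightarrow>\<^sub>0 'k))"
  unfolding additive_family_def lin_ext_def by (simp_all add: distrib_left distrib_right single_add sum.distrib)

lemma monoid_algebra_distrib:
  fixes f g h :: "'m \<Rightarrow>\<^sub>0 'k::comm_ring_1"
  shows "(f + g) \<otimes>\<^bsub>monoid_algebra M\<^esub> h = f \<otimes>\<^bsub>monoid_algebra M\<^esub> h + g \<otimes>\<^bsub>monoid_algebra M\<^esub> h"
    "h \<otimes>\<^bsub>monoid_algebra M\<^esub> (f + g) = h \<otimes>\<^bsub>monoid_algebra M\<^esub> f + h \<otimes>\<^bsub>monoid_algebra M\<^esub> g"
  unfolding monoid_algebra_mult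
  by (simp add: lin_ext_add additive_mult)
    (simp add: lin_ext_add additive_mult lin_ext_def[of _ h] sum.distrib)

lemma monoid_algebra_single:
  "single u a \<otimes>\<^bsub>monoid_algebra M\<^esub> single v b = single (u \<otimes>\<^bsub>M\<^esub> v) (a * b :: 'k::comm_ring_1)"
  unfolding monoid_algebra_mult
  by (subst lin_ext_single, rule additive_mult, subst lin_ext_single, rule additive_mult) (rule HOL.refl)

lemma monoid_algebra_zero_mult:
  fixes f :: "'m \<Rightarrow>\<^sub>0 'k::comm_ring_1"
  shows "0 \<otimes>\<^bsub>monoid_algebra M\<^esub> f = 0" "f \<otimes>\<^bsub>monoid_algebra M\<^esub> 0 = 0"
  by (simp_all add: monoid_algebra_mult) (simp add: lin_ext_def)

end

lemma keys_add_subset: "keys f \<subseteq> S \<Longrightarrow> keys g \<subseteq> S \<Longrightarrow> keys (f + g) \<subseteq> S"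
  for f g :: "'m \<Rightarrow>\<^sub>0 'k::monoid_add"
  using keys_add[of f g] by blast

lemma keys_single_subset: "x \<in> S \<Longrightarrow> keys (single x a) \<subseteq> S"
  by simp

lemma monoid_algebra_closed:
  fixes f g :: "'m \<Rightarrow>\<^sub>0 'k::comm_ring_1"
  assumes "monoid M" "keys f \<subseteq> carrier M" "keys g \<subseteq> carrier M"
  shows "keys (f \<otimes>\<^bsub>monoid_algebra M\<^esub> g) \<subseteq> carrier M"
  using assms(2)
proof (induction rule: keys_subset_induct)
  case (add f u a)
  have "keys (single u a \<otimes>\<^bsub>monoid_algebra M\<^esub> g) \<subseteq> carrier M"
    using assms(3)
  proof (induction rule: keys_subset_induct)
    case (add g v b)
    then show ?case
      unfolding monoid_algebra_distrib monoid_algebra_single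
      using monoid.m_closed[OF assms(1) \<open>u \<in> carrier M\<close>]
      by (intro keys_add_subset keys_single_subset)
  qed (simp add: monoid_algebra_zero_mult)
  with add show ?case
    by (simp add: monoid_algebra_distrib keys_add_subset)
qed (simp add: monoid_algebra_zero_mult)

lemma ring_monoid_algebra:
  assumes "monoid M"
  shows "ring (monoid_algebra M :: ('m \<Rightarrow>\<^sub>0 'k::comm_ring_1) ring)"
proof (rule ringI)
  interpret monoid M by fact
  let ?A = "monoid_algebra M :: ('m \<Rightarrow>\<^sub>0 'k) ring"
  show "abelian_group ?A"
  proof (rule abelian_groupI)
    fix f
    assume "f \<in> carrier ?A"
    then show "\<exists>g\<in>carrier ?A. g \<oplus>\<^bsub>?A\<^esub> f = \<zero>\<^bsub>?A\<^esub>"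
      by (intro bexI[of _ "- f"]) (auto simp: monoid_algebra_simps)
  qed (auto simp: monoid_algebra_simps add.assoc add.commute dest: keys_add_subset)
  have A: "\<And>f. f \<in> carrier ?A \<longleftrightarrow> keys f \<subseteq> carrier M"
    by (simp add: monoid_algebra_simps)
  show "Group.monoid ?A"
  proof
    fix f g
    assume "f \<in> carrier ?A" "g \<in> carrier ?A"
    then show "f \<otimes>\<^bsub>?A\<^esub> g \<in> carrier ?A"
      unfolding A using monoid_algebra_closed[OF assms] by blast
  next
    show "\<one>\<^bsub>?A\<^esub> \<in> carrier ?A"
      by (simp add: monoid_algebra_simps)
  next
    fix f g h
    assume "f \<in> carrier ?A" "g \<in> carrier ?A" "h \<in> carrier ?A"
    then have fgh: "keys f \<subseteq> carrier M" "keys g \<subseteq> carrier M" "keys h \<subseteq> carrier M"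
      by (simp_all add: A)
    have 1: "single u a \<otimes>\<^bsub>?A\<^esub> single v b \<otimes>\<^bsub>?A\<^esub> h = single u a \<otimes>\<^bsub>?A\<^esub> (single v b \<otimes>\<^bsub>?A\<^esub> h)"
      if "u \<in> carrier M" "v \<in> carrier M" for u v a b
      using fgh(3) by (rule additive_unique)
        (use that in \<open>simp_all add: monoid_algebra_distrib monoid_algebra_single m_assoc mult.assoc\<close>)
    have 2: "single u a \<otimes>\<^bsub>?A\<^esub> g \<otimes>\<^bsub>?A\<^esub> h = single u a \<otimes>\<^bsub>?A\<^esub> (g \<otimes>\<^bsub>?A\<^esub> h)"
      if "u \<in> carrier M" for u a
      using fgh(2) by (rule additive_unique) (use that 1 in \<open>simp_all add: monoid_algebra_distrib\<close>)
    show "f \<otimes>\<^bsub>?A\<^esub> g \<otimes>\<^bsub>?A\<^esub> h = f \<otimes>\<^bsub>?A\<^esub> (g \<otimes>\<^bsub>?A\<^esub> h)"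
      using fgh(1) by (rule additive_unique) (use 2 in \<open>simp_all add: monoid_algebra_distrib\<close>)
  next
    fix f
    assume "f \<in> carrier ?A"
    then have f: "keys f \<subseteq> carrier M"
      by (simp add: A)
    show "\<one>\<^bsub>?A\<^esub> \<otimes>\<^bsub>?A\<^esub> f = f" "f \<otimes>\<^bsub>?A\<^esub> \<one>\<^bsub>?A\<^esub> = f"
      using f by (rule additive_unique;
          simp add: monoid_algebra_distrib monoid_algebra_single monoid_algebra_simps(3))+
  qed
qed (simp_all add: monoid_algebra_simps monoid_algebra_distrib)


section \<open>The singular Hecke algebra\<close>

lemma braid_eq_append:
  assumes "braid_eq n u u'" "braid_eq n v v'"
  shows "braid_eq n (u @ v) (u' @ v')"
proof -
  have "braid_eq n (a @ u @ b) (a @ v @ b)" if "braid_eq n u v" "a \<in> words n" "b \<in> words n" for u v a b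
    using that
  proof (induction rule: braid_eq.induct)
    case (rel a' b' r s)
    then show ?case
      using braid_eq.rel[of "a @ a'" n "b' @ b" r s] by simp
  qed (auto intro: braid_eq.intros)
  from this[OF assms(1), of "[]" v] this[OF assms(2), of u' "[]"] show ?thesis
    using braid_eq_words assms by (auto intro: braid_eq.trans)
qed

lemma braid_eq_mono: "braid_eq m u v \<Longrightarrow> m \<le> n \<Longrightarrow> braid_eq n u v"
  by (induction rule: braid_eq.induct)
    (auto intro: braid_eq.intros words_mono defining_relation_mono)

lemma braid_class_self: "w \<in> words n \<Longrightarrow> w \<in> braid_class n w"
  by (simp add: braid_class_def braid_eq.refl)

lemma braid_class_eqI: "v \<in> braid_class n w \<Longrightarrow> braid_class n v = braid_class n w"
  unfolding braid_class_def using braid_eq.trans[of n v w] braid_eq.trans[of n w v] braid_eq.sym[of n w v]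
  by blast

lemma braid_class_eq_iff: "v \<in> words n \<Longrightarrow> braid_class n u = braid_class n v \<longleftrightarrow> braid_eq n u v"
  using braid_class_self[of v n] braid_class_eqI[of v n u] by (auto simp: braid_class_def)

lemma SB_carrier: "carrier (SB n) = braid_class n ` words n"
  by (simp add: SB_def)

lemma SB_mult:
  assumes "u \<in> words n" "v \<in> words n"
  shows "braid_class n u \<otimes>\<^bsub>SB n\<^esub> braid_class n v = braid_class n (u @ v)"
proof -
  have "braid_class n (u' @ v') = braid_class n (u @ v)" if "u' \<in> braid_class n u" "v' \<in> braid_class n v" for u' v'
    using that braid_eq_append[of n u u' v v'] by (intro braid_class_eqI) (auto simp: braid_class_def)
  then have "braid_class n u \<otimes>\<^bsub>SB n\<^esub> braid_class n v
      = (\<Union>u'\<in>braid_class n u. \<Union>v'\<in>braid_class n v. braid_class n (u @ v))"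
    unfolding SB_def by simp
  also have "\<dots> = braid_class n (u @ v)"
    using braid_class_self[OF assms(1)] braid_class_self[OF assms(2)] by blast
  finally show ?thesis .
qed

lemma SB_one: "\<one>\<^bsub>SB n\<^esub> = braid_class n []"
  by (simp add: SB_def)

lemma monoid_SB: "monoid (SB n)"
  by standard (auto simp: SB_carrier SB_mult SB_one)

lemma SB_inclusion_class:
  assumes "w \<in> words n"
  shows "SB_inclusion n (braid_class n w) = braid_class (n + 1) w"
proof -
  have "braid_class (n + 1) v = braid_class (n + 1) w" if "v \<in> braid_class n w" for v
    using that braid_eq_mono[of n w v "n + 1"] by (intro braid_class_eqI) (auto simp: braid_class_def)
  then have "SB_inclusion n (braid_class n w) = (\<Union>v\<in>braid_class n w. braid_class (n + 1) w)"
    unfolding SB_inclusion_def by (intro SUP_cong) auto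
  then show ?thesis
    using braid_class_self[OF assms] by blast
qed

lemma ring_KSB: "ring (KSB n)"
  by (rule ring_monoid_algebra) (rule monoid_SB)

lemma KSB_carrier: "carrier (KSB n) = {f. keys f \<subseteq> braid_class n ` words n}"
  by (simp add: monoid_algebra_simps SB_carrier)

lemma KSB_single: "w \<in> words n \<Longrightarrow> single (braid_class n w) c \<in> carrier (KSB n)"
  by (auto simp: KSB_carrier)

lemma KSB_add: "f \<in> carrier (KSB n) \<Longrightarrow> g \<in> carrier (KSB n) \<Longrightarrow> f + g \<in> carrier (KSB n)"
  by (simp add: KSB_carrier keys_add_subset)

lemma KSB_diff: "f \<in> carrier (KSB n) \<Longrightarrow> g \<in> carrier (KSB n) \<Longrightarrow> f - g \<in> carrier (KSB n)"
  using keys_diff[of f g] by (auto simp: KSB_carrier)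

lemma KSB_minus: "f \<in> carrier (KSB n) \<Longrightarrow> g \<in> carrier (KSB n) \<Longrightarrow> f \<ominus>\<^bsub>KSB n\<^esub> g = f - g"
proof -
  assume fg: "f \<in> carrier (KSB n)" "g \<in> carrier (KSB n)"
  interpret ring "KSB n" by (rule ring_KSB)
  have "- g \<in> carrier (KSB n)"
    using fg by (simp add: KSB_carrier)
  then have "\<ominus>\<^bsub>KSB n\<^esub> g = - g"
    using fg minus_equality[of "- g" g] by (simp add: monoid_algebra_simps(2,4))
  then show ?thesis
    by (simp add: a_minus_def monoid_algebra_simps(4))
qed

section \<open>The ideal of quadratic relations, explicitly\<close>

definition quadratic_element :: "nat \<Rightarrow> word \<Rightarrow> nat \<Rightarrow> word \<Rightarrow> K \<Rightarrow> word set \<Rightarrow>\<^sub>0 K"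
  where "quadratic_element n u k v c = single (braid_class n (u @ [Sig k, Sig k] @ v)) c
    - (single (braid_class n (u @ [Sig k] @ v)) (c * (q_var - 1)) + single (braid_class n (u @ v)) (c * q_var))"

text \<open>An additive description of the two-sided ideal: monoid elements span the algebra, so it
  suffices to multiply the generators by words on both sides and by a scalar. Additive maps can then
  be tested on \<open>quadratic_element\<close> alone.\<close>

inductive quadratic_span :: "nat \<Rightarrow> (word set \<Rightarrow>\<^sub>0 K) \<Rightarrow> bool" for n
  where
    zero: "quadratic_span n 0"
  | add: "quadratic_span n f \<Longrightarrow> 1 \<le> k \<Longrightarrow> k < n \<Longrightarrow> u \<in> words n \<Longrightarrow> v \<in> words n
      \<Longrightarrow> quadratic_span n (f + quadratic_element n u k v c)"

lemma quadratic_element_carrier: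
  assumes "1 \<le> k" "k < n" "u \<in> words n" "v \<in> words n"
  shows "quadratic_element n u k v c \<in> carrier (KSB n)"
  unfolding quadratic_element_def using assms
  by (intro KSB_diff KSB_add KSB_single) auto

lemma hecke_ideal_generator:
  "quadratic_element n [] k [] 1 = single (braid_class n [Sig k, Sig k]) 1
    - (single (braid_class n [Sig k]) (q_var - 1) + single (braid_class n []) q_var)"
  by (simp add: quadratic_element_def)

lemma hecke_ideal_alt:
  "hecke_ideal n = Idl\<^bsub>KSB n\<^esub> {quadratic_element n [] k [] 1 | k. 1 \<le> k \<and> k < n}"
  by (simp add: hecke_ideal_def hecke_ideal_generator)

lemma ideal_hecke_ideal: "ideal (hecke_ideal n) (KSB n)"
  unfolding hecke_ideal_alt
  by (intro ring.genideal_ideal ring_KSB) (auto intro: quadratic_element_carrier)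

lemma KSB_mult_diff:
  fixes f g h :: "word set \<Rightarrow>\<^sub>0 K"
  shows "(f - g) \<otimes>\<^bsub>KSB n\<^esub> h = f \<otimes>\<^bsub>KSB n\<^esub> h - g \<otimes>\<^bsub>KSB n\<^esub> h"
    "h \<otimes>\<^bsub>KSB n\<^esub> (f - g) = h \<otimes>\<^bsub>KSB n\<^esub> f - h \<otimes>\<^bsub>KSB n\<^esub> g"
  using monoid_algebra_distrib(1)[of "SB n" "f - g" g h] monoid_algebra_distrib(2)[of "SB n" h "f - g" g]
  by simp_all

lemma quadratic_element_mult:
  assumes "1 \<le> k" "k < n" "u \<in> words n" "v \<in> words n" "w \<in> words n"
  shows "single (braid_class n w) a \<otimes>\<^bsub>KSB n\<^esub> quadratic_element n u k v c = quadratic_element n (w @ u) k v (a * c)"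
    "quadratic_element n u k v c \<otimes>\<^bsub>KSB n\<^esub> single (braid_class n w) a = quadratic_element n u k (v @ w) (a * c)"
  using assms
  by (simp_all add: quadratic_element_def KSB_mult_diff monoid_algebra_distrib monoid_algebra_single SB_mult
      mult.assoc mult.commute[of _ a])

lemma quadratic_span_add: "quadratic_span n g \<Longrightarrow> quadratic_span n f \<Longrightarrow> quadratic_span n (f + g)"
  by (induction rule: quadratic_span.induct) (auto simp flip: add.assoc intro: quadratic_span.add)

lemma quadratic_span_carrier: "quadratic_span n f \<Longrightarrow> f \<in> carrier (KSB n)"
proof (induction rule: quadratic_span.induct)
  case (add f k u v c)
  then have "quadratic_element n u k v c \<in> carrier (KSB n)"
    by (intro quadratic_element_carrier)
  with add show ?case
    by (simp add: KSB_carrier keys_add_subset)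
qed (simp add: KSB_carrier)

lemma quadratic_span_uminus: "quadratic_span n f \<Longrightarrow> quadratic_span n (- f)"
proof (induction rule: quadratic_span.induct)
  case (add f k u v c)
  have "- quadratic_element n u k v c = quadratic_element n u k v (- c)"
    by (rule poly_mapping_eqI)
      (simp add: quadratic_element_def lookup_single lookup_minus lookup_uminus lookup_add when_def algebra_simps)
  then have "- (f + quadratic_element n u k v c) = - f + quadratic_element n u k v (- c)"
    by (simp add: algebra_simps)
  then show ?case
    using quadratic_span.add[OF add.IH add.hyps(2-5), of "- c"] by simp
qed (simp add: quadratic_span.zero)

lemma quadratic_span_mult:
  assumes "quadratic_span n f" "g \<in> carrier (KSB n)"
  shows "quadratic_span n (g \<otimes>\<^bsub>KSB n\<^esub> f)" "quadratic_span n (f \<otimes>\<^bsub>KSB n\<^esub> g)"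
proof -
  have "quadratic_span n (single (braid_class n w) a \<otimes>\<^bsub>KSB n\<^esub> f) \<and> quadratic_span n (f \<otimes>\<^bsub>KSB n\<^esub> single (braid_class n w) a)"
    if "w \<in> words n" for w a
    using assms(1)
  proof (induction rule: quadratic_span.induct)
    case zero
    then show ?case
      by (simp add: monoid_algebra_zero_mult quadratic_span.zero)
  next
    case (add f k u v c)
    with that show ?case
      by (simp add: monoid_algebra_distrib quadratic_element_mult quadratic_span.add)
  qed
  note * = this
  have "keys g \<subseteq> braid_class n ` words n"
    using assms(2) by (simp add: KSB_carrier)
  then have "quadratic_span n (g \<otimes>\<^bsub>KSB n\<^esub> f) \<and> quadratic_span n (f \<otimes>\<^bsub>KSB n\<^esub> g)"
  proof (induction rule: keys_subset_induct)
    case zero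
    then show ?case
      by (simp add: monoid_algebra_zero_mult quadratic_span.zero)
  next
    case (add g x a)
    with * show ?case
      by (auto simp: monoid_algebra_distrib intro!: quadratic_span_add)
  qed
  then show "quadratic_span n (g \<otimes>\<^bsub>KSB n\<^esub> f)" "quadratic_span n (f \<otimes>\<^bsub>KSB n\<^esub> g)"
    by auto
qed

lemma hecke_ideal_span:
  assumes "f \<in> hecke_ideal n"
  shows "quadratic_span n f"
proof -
  interpret ring "KSB n" by (rule ring_KSB)
  have "ideal {f. quadratic_span n f} (KSB n)"
  proof (rule idealI)
    show "subgroup {f. quadratic_span n f} (add_monoid (KSB n))"
    proof (rule add.subgroupI)
      fix f
      assume "f \<in> {f. quadratic_span n f}"
      then have f: "quadratic_span n f" "f \<in> carrier (KSB n)"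
        by (auto simp: quadratic_span_carrier)
      have "\<ominus>\<^bsub>KSB n\<^esub> f = - f"
        using KSB_minus[of 0 n f] f by (simp add: a_minus_def monoid_algebra_simps(4)) (simp add: KSB_carrier)
      then show "\<ominus>\<^bsub>KSB n\<^esub> f \<in> {f. quadratic_span n f}"
        using f by (simp add: quadratic_span_uminus)
    qed (auto simp: quadratic_span_carrier monoid_algebra_simps(4) intro: quadratic_span.zero quadratic_span_add)
  qed (auto simp: ring_axioms quadratic_span_mult)
  moreover have "quadratic_span n (quadratic_element n [] k [] 1)" if "1 \<le> k" "k < n" for k
    using quadratic_span.add[OF quadratic_span.zero that, of "[]" "[]" 1] by simp
  ultimately have "hecke_ideal n \<subseteq> {f. quadratic_span n f}"
    unfolding hecke_ideal_alt by (intro genideal_minimal) auto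
  with assms show ?thesis by auto
qed

lemma quadratic_element_ideal:
  assumes "1 \<le> k" "k < n" "u \<in> words n" "v \<in> words n"
  shows "quadratic_element n u k v c \<in> hecke_ideal n"
proof -
  interpret I: ideal "hecke_ideal n" "KSB n" by (rule ideal_hecke_ideal)
  have "quadratic_element n [] k [] 1 \<in> hecke_ideal n"
    unfolding hecke_ideal_alt using assms
    by (intro subsetD[OF I.genideal_self]) (auto intro: quadratic_element_carrier)
  then have "single (braid_class n u) c \<otimes>\<^bsub>KSB n\<^esub> quadratic_element n [] k [] 1
      \<otimes>\<^bsub>KSB n\<^esub> single (braid_class n v) 1 \<in> hecke_ideal n"
    using assms by (intro I.I_r_closed I.I_l_closed KSB_single)
  then show ?thesis
    using assms by (simp add: quadratic_element_mult)
qed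

lemma hecke_ideal_additive_image:
  assumes "f \<in> hecke_ideal n"
    and "P (L 0)" "\<And>x y. P x \<Longrightarrow> P y \<Longrightarrow> P (x + y)" "\<And>f g. L (f + g) = L f + L g"
    and "\<And>k u v c. 1 \<le> k \<Longrightarrow> k < n \<Longrightarrow> u \<in> words n \<Longrightarrow> v \<in> words n \<Longrightarrow> P (L (quadratic_element n u k v c))"
  shows "P (L f)"
  using hecke_ideal_span[OF assms(1)]
  by (induction rule: quadratic_span.induct) (simp_all add: assms)

lemma ring_hecke: "ring (hecke n)"
  unfolding hecke_def by (rule ideal.quotient_is_ring[OF ideal_hecke_ideal])

lemma hecke_proj_hom: "hecke_proj n \<in> ring_hom (KSB n) (hecke n)"
  using ideal.rcos_ring_hom[OF ideal_hecke_ideal[of n]] by (simp add: hecke_proj_def[abs_def] hecke_def)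

lemma hecke_proj_simps:
  assumes "f \<in> carrier (KSB n)"
  shows "hecke_proj n f \<in> carrier (hecke n)"
    "g \<in> carrier (KSB n) \<Longrightarrow> hecke_proj n f \<oplus>\<^bsub>hecke n\<^esub> hecke_proj n g = hecke_proj n (f + g)"
    "g \<in> carrier (KSB n) \<Longrightarrow> hecke_proj n f \<otimes>\<^bsub>hecke n\<^esub> hecke_proj n g = hecke_proj n (f \<otimes>\<^bsub>KSB n\<^esub> g)"
  using ring_hom_memE[OF hecke_proj_hom[of n]] assms by (auto simp: monoid_algebra_simps(4))

lemma hecke_proj_eq_iff:
  assumes "f \<in> carrier (KSB n)" "g \<in> carrier (KSB n)"
  shows "hecke_proj n f = hecke_proj n g \<longleftrightarrow> f - g \<in> hecke_ideal n"
  using ring.quotient_eq_iff_same_a_r_cos[OF ring_KSB ideal_hecke_ideal assms] assms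
  by (simp add: hecke_proj_def KSB_minus)

lemma hecke_proj_mem:
  assumes "f \<in> carrier (KSB n)"
  shows "f \<in> hecke_proj n f"
    "g \<in> hecke_proj n f \<Longrightarrow> g \<in> carrier (KSB n) \<and> g - f \<in> hecke_ideal n"
proof -
  interpret ideal "hecke_ideal n" "KSB n" by (rule ideal_hecke_ideal)
  show "f \<in> hecke_proj n f"
    unfolding hecke_proj_def using assms by (rule a_rcos_self)
  assume g: "g \<in> hecke_proj n f"
  then have "g \<in> carrier (KSB n)"
    unfolding hecke_proj_def using a_elemrcos_carrier[OF assms] by blast
  moreover have "hecke_proj n g = hecke_proj n f"
    using g a_repr_independence[OF _ assms a_subgroup] unfolding hecke_proj_def by blast
  ultimately show "g \<in> carrier (KSB n) \<and> g - f \<in> hecke_ideal n"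
    using hecke_proj_eq_iff[OF _ assms] by blast
qed

lemma hecke_ideal_add: "f \<in> hecke_ideal n \<Longrightarrow> g \<in> hecke_ideal n \<Longrightarrow> f + g \<in> hecke_ideal n"
  using additive_subgroup.a_closed[OF ideal.axioms(1)[OF ideal_hecke_ideal[of n]]]
  by (simp add: monoid_algebra_simps(4))

lemma hecke_ideal_zero: "0 \<in> hecke_ideal n"
  using additive_subgroup.zero_closed[OF ideal.axioms(1)[OF ideal_hecke_ideal[of n]]]
  by (simp add: monoid_algebra_simps(2))

text \<open>An additive map respecting the ideals is constant modulo the target ideal on each coset,
  so the united cosets coincide. Serves both \<open>hecke_smult\<close> and
  \<open>hecke_incl\<close>.\<close>

lemma union_over_coset:
  assumes "f \<in> carrier (KSB n)" and H: "\<And>g. g \<in> carrier (KSB n) \<Longrightarrow> L g \<in> carrier (KSB m)"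
    and add: "\<And>g h. L (g + h) = L g + L h"
    and quad: "\<And>k u v c. 1 \<le> k \<Longrightarrow> k < n \<Longrightarrow> u \<in> words n \<Longrightarrow> v \<in> words n
      \<Longrightarrow> L (quadratic_element n u k v c) \<in> hecke_ideal m"
  shows "(\<Union>g\<in>hecke_proj n f. hecke_proj m (L g)) = hecke_proj m (L f)"
proof -
  have L0: "L 0 = 0"
    using add[of 0 0] by simp
  have "hecke_proj m (L g) = hecke_proj m (L f)" if g: "g \<in> hecke_proj n f" for g
  proof -
    have "g \<in> carrier (KSB n)" and d: "g - f \<in> hecke_ideal n"
      using hecke_proj_mem(2)[OF assms(1) g] by auto
    moreover have "L (g - f) \<in> hecke_ideal m"
      using d by (rule hecke_ideal_additive_image)
        (auto simp: L0 add quad intro: hecke_ideal_zero hecke_ideal_add)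
    moreover have "L (g - f) = L g - L f"
      using add[of "g - f" f] by simp
    ultimately show ?thesis
      using assms(1) H by (simp add: hecke_proj_eq_iff)
  qed
  then have "(\<Union>g\<in>hecke_proj n f. hecke_proj m (L g)) = (\<Union>g\<in>hecke_proj n f. hecke_proj m (L f))"
    by (intro SUP_cong) auto
  then show ?thesis
    using hecke_proj_mem(1)[OF assms(1)] by blast
qed

abbreviation (input) "scale c \<equiv> Poly_Mapping.map ((*) c)"

lemma lookup_scale: "lookup (scale c f) x = c * lookup f x" for c :: "'k::comm_ring_1"
  by (simp add: Poly_Mapping.map.rep_eq when_def)

lemma scale_add: "scale c (f + g) = scale c f + scale c g" for c :: "'k::comm_ring_1"
  by (rule poly_mapping_eqI) (simp add: lookup_scale lookup_add distrib_left)

lemma scale_diff: "scale c (f - g) = scale c f - scale c g" for c :: "'k::comm_ring_1"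
  by (rule poly_mapping_eqI) (simp add: lookup_scale lookup_minus right_diff_distrib)

lemma scale_zero: "scale c 0 = 0" for c :: "'k::comm_ring_1"
  by (rule poly_mapping_eqI) (simp add: lookup_scale)

lemma keys_scale: "keys (scale c f) \<subseteq> keys f" for c :: "'k::comm_ring_1"
  by (auto simp: in_keys_iff lookup_scale)

lemma scale_single: "scale c (single x a) = single x (c * a)" for c :: "'k::comm_ring_1"
  by (rule poly_mapping_eqI) (simp add: lookup_scale lookup_single when_def)

lemma hecke_smult_proj:
  assumes "f \<in> carrier (KSB n)"
  shows "hecke_smult n c (hecke_proj n f) = hecke_proj n (scale c f)"
  unfolding hecke_smult_def using assms
proof (rule union_over_coset)
  fix k u v a
  assume "1 \<le> k" "k < n" "u \<in> words n" "v \<in> words n"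
  moreover have "scale c (quadratic_element n u k v a) = quadratic_element n u k v (c * a)"
    unfolding quadratic_element_def by (simp add: scale_diff scale_add scale_single mult.assoc)
  ultimately show "scale c (quadratic_element n u k v a) \<in> hecke_ideal n"
    by (simp add: quadratic_element_ideal)
qed (use keys_scale in \<open>force simp: KSB_carrier scale_add\<close>)+

definition incl_ext :: "nat \<Rightarrow> (word set \<Rightarrow>\<^sub>0 K) \<Rightarrow> word set \<Rightarrow>\<^sub>0 K"
  where "incl_ext n = lin_ext (\<lambda>x a. single (SB_inclusion n x) a)"

lemma additive_incl_ext: "additive_family (\<lambda>x a. single (SB_inclusion n x) (a::K))"
  by (simp add: additive_family_def single_add)

lemma incl_ext_simps:
  "incl_ext n (f + g) = incl_ext n f + incl_ext n g"
  "w \<in> words n \<Longrightarrow> incl_ext n (single (braid_class n w) a) = single (braid_class (n + 1) w) a"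
  by (simp_all add: incl_ext_def lin_ext_add lin_ext_single additive_incl_ext SB_inclusion_class)

lemma incl_ext_diff: "incl_ext n (f - g) = incl_ext n f - incl_ext n g"
  using incl_ext_simps(1)[of n "f - g" g] by simp

lemma incl_ext_keys:
  assumes "keys f \<subseteq> S" "\<And>x. x \<in> S \<Longrightarrow> SB_inclusion n x \<in> T"
  shows "keys (incl_ext n f) \<subseteq> T"
  using assms(1)
proof (induction rule: keys_subset_induct)
  case zero
  then show ?case by (simp add: incl_ext_def)
next
  case (add f x a)
  have "incl_ext n (single x a) = single (SB_inclusion n x) a"
    by (simp add: incl_ext_def lin_ext_single additive_incl_ext)
  with add show ?case
    unfolding incl_ext_simps(1) by (intro keys_add_subset) (auto intro: assms(2))
qed

lemma hecke_incl_alt: "hecke_incl n X = (\<Union>f\<in>X. hecke_proj (n + 1) (incl_ext n f))"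
  by (simp add: hecke_incl_def incl_ext_def lin_ext_def)

lemma hecke_incl_proj:
  assumes "f \<in> carrier (KSB n)"
  shows "hecke_incl n (hecke_proj n f) = hecke_proj (n + 1) (incl_ext n f)"
  unfolding hecke_incl_alt using assms
proof (rule union_over_coset)
  fix k u v a
  assume k: "1 \<le> k" "k < n" "u \<in> words n" "v \<in> words n"
  then have w: "u \<in> words (n + 1)" "v \<in> words (n + 1)"
    by (auto intro: words_mono)
  have "incl_ext n (quadratic_element n u k v a) = quadratic_element (n + 1) u k v a"
    unfolding quadratic_element_def incl_ext_diff incl_ext_simps(1) using k by (simp add: incl_ext_simps(2))
  then show "incl_ext n (quadratic_element n u k v a) \<in> hecke_ideal (n + 1)"
    using k w quadratic_element_ideal[of k "n + 1" u v a] by simp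
next
  fix g
  assume "g \<in> carrier (KSB n)"
  then have g: "keys g \<subseteq> braid_class n ` words n"
    by (simp add: KSB_carrier)
  have incl: "SB_inclusion n x \<in> braid_class (n + 1) ` words (n + 1)" if "x \<in> braid_class n ` words n" for x
    using that words_mono[of _ n "n + 1"] by (auto simp: SB_inclusion_class)
  show "incl_ext n g \<in> carrier (KSB (n + 1))"
    unfolding KSB_carrier using incl_ext_keys[OF g incl] by simp
qed (rule incl_ext_simps)

lemma SdB_alt: "SdB d n = {braid_class n w | w. w \<in> words n \<and> taus w = d}"
  by (simp add: SdB_def taus_def)

lemma SdB_carrier: "keys f \<subseteq> SdB d n \<Longrightarrow> f \<in> carrier (KSB n)"
  by (auto simp: KSB_carrier SdB_alt)

lemma SdB_class: "w \<in> words n \<Longrightarrow> braid_class n w \<in> SdB (taus w) n"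
  by (auto simp: SdB_alt)

lemma SdB_inclusion: "x \<in> SdB d n \<Longrightarrow> SB_inclusion n x \<in> SdB d (n + 1)"
  using SdB_class[of _ "n + 1"] words_mono[of _ n "n + 1"] unfolding SdB_alt[of d n]
  by (auto simp: SB_inclusion_class)

lemma SdB_single: "w \<in> words n \<Longrightarrow> taus w = d \<Longrightarrow> keys (single (braid_class n w) a) \<subseteq> SdB d n"
  using SdB_class by auto

lemma HSd_proj: "keys f \<subseteq> SdB d n \<Longrightarrow> hecke_proj n f \<in> HSd d n"
  by (auto simp: HSd_def)

lemma HSdE:
  assumes "X \<in> HSd d n"
  obtains f where "keys f \<subseteq> SdB d n" "X = hecke_proj n f"
  using assms by (auto simp: HSd_def)


section \<open>Markov traces and Markov functionals\<close>

definition stable :: "word set \<Rightarrow> sbraid"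
  where "stable x = cls (SOME w. w \<in> x)"

lemma stable_class: "w \<in> words n \<Longrightarrow> stable (braid_class n w) = cls w"
proof -
  assume "w \<in> words n"
  then have "(SOME v. v \<in> braid_class n w) \<in> braid_class n w"
    by (intro someI) (rule braid_class_self)
  then show ?thesis
    unfolding stable_def cls_eq_iff
    by (auto simp: braid_class_def intro: stable_eq.sym braid_eq_stable_eq)
qed

definition functional_ext :: "(sbraid \<Rightarrow> Kz) \<Rightarrow> (word set \<Rightarrow>\<^sub>0 K) \<Rightarrow> Kz"
  where "functional_ext f = lin_ext (\<lambda>x a. K_to_Kz a * f (stable x))"

lemma functional_ext_simps:
  "functional_ext f (g + h) = functional_ext f g + functional_ext f h"
  "functional_ext f 0 = 0"
  "w \<in> words n \<Longrightarrow> functional_ext f (single (braid_class n w) a) = K_to_Kz a * f (cls w)"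
proof -
  have *: "additive_family (\<lambda>x a. K_to_Kz a * f (stable x))"
    by (simp add: additive_family_def distrib_right)
  show "functional_ext f (g + h) = functional_ext f g + functional_ext f h" "functional_ext f 0 = 0"
    "w \<in> words n \<Longrightarrow> functional_ext f (single (braid_class n w) a) = K_to_Kz a * f (cls w)"
    unfolding functional_ext_def by (simp_all add: lin_ext_add[OF *] lin_ext_single[OF *] stable_class)
qed

lemma functional_ext_diff: "functional_ext f (g - h) = functional_ext f g - functional_ext f h"
  using functional_ext_simps(1)[of f "g - h" h] by simp

lemma functional_ext_scale: "functional_ext f (scale c g) = K_to_Kz c * functional_ext f g"
proof (rule additive_unique[of g UNIV])
  fix x a
  have *: "additive_family (\<lambda>x a. K_to_Kz a * f (stable x))"
    by (simp add: additive_family_def distrib_right)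
  show "functional_ext f (scale c (single x a)) = K_to_Kz c * functional_ext f (single x a)"
    unfolding functional_ext_def scale_single by (simp add: lin_ext_single[OF *] mult.assoc)
qed (simp_all add: scale_add functional_ext_simps distrib_left)

lemma functional_ext_linear:
  "functional_ext (\<lambda>x. c * f x + c' * g x) h = c * functional_ext f h + c' * functional_ext g h"
  unfolding functional_ext_def lin_ext_def
  by (simp add: sum_distrib_left algebra_simps sum.distrib)

lemma functional_ext_incl_ext:
  assumes "keys g \<subseteq> SdB d n"
  shows "functional_ext f (incl_ext n g) = functional_ext f g"
  using assms
proof (rule additive_unique)
  fix x a
  assume "x \<in> SdB d n"
  then obtain w where "x = braid_class n w" "w \<in> words n"
    by (auto simp: SdB_alt)
  then show "functional_ext f (incl_ext n (single x a)) = functional_ext f (single x a)"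
    using words_mono[of w n "n + 1"] by (simp add: incl_ext_simps(2) functional_ext_simps(3)[of _ "n + 1", simplified] functional_ext_simps)
qed (simp_all add: incl_ext_simps functional_ext_simps)

lemma functional_ext_ideal:
  assumes "markov_functional d f" "g \<in> hecke_ideal n"
  shows "functional_ext f g = 0"
  using assms(2)
proof (rule hecke_ideal_additive_image[where P = "\<lambda>t. t = 0"])
  fix k u v c
  assume k: "1 \<le> k" "k < n" "u \<in> words n" "v \<in> words n"
  interpret markov_functional d f by fact
  show "functional_ext f (quadratic_element n u k v c) = 0"
    using k
    by (simp add: quadratic_element_def functional_ext_diff functional_ext_simps cls_append cls_simps quadratic)
      (simp add: algebra_simps)
qed (simp_all add: functional_ext_simps)

definition trace_of :: "nat \<Rightarrow> (sbraid \<Rightarrow> Kz) \<Rightarrow> trace_family"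
  where "trace_of d f = (\<lambda>n X. if 1 \<le> n \<and> X \<in> HSd d n then functional_ext f (SOME g. g \<in> X) else 0)"

lemma trace_of_proj:
  assumes "markov_functional d f" "1 \<le> n" "keys g \<subseteq> SdB d n"
  shows "trace_of d f n (hecke_proj n g) = functional_ext f g"
proof -
  let ?h = "SOME h. h \<in> hecke_proj n g"
  have "?h \<in> hecke_proj n g"
    using hecke_proj_mem(1)[OF SdB_carrier[OF assms(3)]] by (rule someI)
  then have "?h - g \<in> hecke_ideal n"
    using hecke_proj_mem(2)[OF SdB_carrier[OF assms(3)]] by blast
  then have "functional_ext f ?h = functional_ext f g"
    using functional_ext_ideal[OF assms(1)] functional_ext_diff[of f ?h g] by simp
  then show ?thesis
    using assms(2) HSd_proj[OF assms(3)] by (simp add: trace_of_def)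
qed

lemma trace_of_hecke_of:
  assumes "markov_functional d f" "1 \<le> n" "w \<in> words n" "taus w = d"
  shows "trace_of d f n (hecke_of n (braid_class n w)) = f (cls w)"
  unfolding hecke_of_def using assms
  by (simp add: trace_of_proj SdB_single del: keys_single) (simp add: functional_ext_simps)

lemma trace_of_TR:
  assumes "markov_functional d f"
  shows "trace_of d f \<in> TR d"
proof -
  interpret markov_functional d f by fact
  note tr = trace_of_proj[OF assms]
  have t1: "trace_of d f n x = 0" if "n = 0 \<or> x \<notin> HSd d n" for n x
    using that by (auto simp: trace_of_def)
  have t2: "trace_of d f n (x \<oplus>\<^bsub>hecke n\<^esub> y) = trace_of d f n x + trace_of d f n y"
    if n: "1 \<le> n" and x: "x \<in> HSd d n" and y: "y \<in> HSd d n" for n x y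
  proof -
    obtain g h where gh: "keys g \<subseteq> SdB d n" "x = hecke_proj n g" "keys h \<subseteq> SdB d n" "y = hecke_proj n h"
      using x y by (elim HSdE)
    then show ?thesis
      using n keys_add_subset[OF gh(1,3)] by (simp add: hecke_proj_simps SdB_carrier tr functional_ext_simps)
  qed
  have t3: "trace_of d f n (hecke_smult n c x) = K_to_Kz c * trace_of d f n x"
    if n: "1 \<le> n" and x: "x \<in> HSd d n" for n c x
  proof -
    obtain g where g: "keys g \<subseteq> SdB d n" "x = hecke_proj n g"
      using x by (elim HSdE)
    moreover have "keys (scale c g) \<subseteq> SdB d n"
      using g keys_scale[of c g] by blast
    ultimately show ?thesis
      using n by (simp add: hecke_smult_proj SdB_carrier tr functional_ext_scale)
  qed
  have t4: "trace_of d f n (hecke_of n (\<alpha> \<otimes>\<^bsub>SB n\<^esub> \<beta>)) = trace_of d f n (hecke_of n (\<beta> \<otimes>\<^bsub>SB n\<^esub> \<alpha>))"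
    if "1 \<le> n" "k + l = d" "\<alpha> \<in> SdB k n" "\<beta> \<in> SdB l n" for n k l \<alpha> \<beta>
  proof -
    obtain u v where "\<alpha> = braid_class n u" "u \<in> words n" "taus u = k" "\<beta> = braid_class n v" "v \<in> words n" "taus v = l"
      using \<open>\<alpha> \<in> SdB k n\<close> \<open>\<beta> \<in> SdB l n\<close> unfolding SdB_alt by blast
    then show ?thesis
      using that cyclic[of "cls u" "cls v"]
      by (simp add: SB_mult trace_of_hecke_of[OF assms] cls_append)
  qed
  have t5: "trace_of d f (n + 1) (hecke_incl n x) = trace_of d f n x"
    if n: "1 \<le> n" and x: "x \<in> HSd d n" for n x
  proof -
    obtain g where g: "keys g \<subseteq> SdB d n" "x = hecke_proj n g"
      using x by (elim HSdE)
    moreover have "keys (incl_ext n g) \<subseteq> SdB d (n + 1)"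
      using g(1) by (rule incl_ext_keys) (rule SdB_inclusion)
    ultimately show ?thesis
      using n tr[of "n + 1" "incl_ext n g"] by (simp add: hecke_incl_proj SdB_carrier tr functional_ext_incl_ext)
  qed
  have t6: "trace_of d f (n + 1) (hecke_incl n (hecke_of n \<beta>) \<otimes>\<^bsub>hecke (n + 1)\<^esub> hecke_of (n + 1) (braid_class (n + 1) [Sig n]))
      = z_var * trace_of d f n (hecke_of n \<beta>)"
    if n: "1 \<le> n" and b: "\<beta> \<in> SdB d n" for n \<beta>
  proof -
    obtain w where w: "\<beta> = braid_class n w" "w \<in> words n" "taus w = d"
      using b by (auto simp: SdB_alt)
    then have w': "w \<in> words (n + 1)" "[Sig n] \<in> words (n + 1)"
      using n by (auto intro: words_mono)
    have "hecke_incl n (hecke_of n \<beta>) \<otimes>\<^bsub>hecke (n + 1)\<^esub> hecke_of (n + 1) (braid_class (n + 1) [Sig n])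
        = hecke_of (n + 1) (braid_class (n + 1) (w @ [Sig n]))"
      unfolding hecke_of_def w(1) hecke_incl_proj[OF KSB_single[OF w(2)]] incl_ext_simps(2)[OF w(2)]
      by (subst hecke_proj_simps(3)[OF KSB_single[OF w'(1)] KSB_single[OF w'(2)]])
        (use SB_mult[OF w'] in \<open>simp add: monoid_algebra_single\<close>)
    then show ?thesis
      using n w w' stabilise[OF n cls_strands[OF w(2)]]
      by (simp add: trace_of_hecke_of[OF assms] cls_append sg_def)
  qed
  show ?thesis
    unfolding TR_def
    by (intro CollectI conjI allI impI ballI; (rule t1 t2 t3 t4 t5 t6; assumption))
qed

lemma TR_D:
  assumes "tr \<in> TR d"
  shows "n = 0 \<or> x \<notin> HSd d n \<Longrightarrow> tr n x = 0"
    "1 \<le> n \<Longrightarrow> x \<in> HSd d n \<Longrightarrow> y \<in> HSd d n \<Longrightarrow> tr n (x \<oplus>\<^bsub>hecke n\<^esub> y) = tr n x + tr n y"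
    "1 \<le> n \<Longrightarrow> x \<in> HSd d n \<Longrightarrow> tr n (hecke_smult n c x) = K_to_Kz c * tr n x"
    "1 \<le> n \<Longrightarrow> k + l = d \<Longrightarrow> \<alpha> \<in> SdB k n \<Longrightarrow> \<beta> \<in> SdB l n \<Longrightarrow>
      tr n (hecke_of n (\<alpha> \<otimes>\<^bsub>SB n\<^esub> \<beta>)) = tr n (hecke_of n (\<beta> \<otimes>\<^bsub>SB n\<^esub> \<alpha>))"
    "1 \<le> n \<Longrightarrow> x \<in> HSd d n \<Longrightarrow> tr (n + 1) (hecke_incl n x) = tr n x"
    "1 \<le> n \<Longrightarrow> \<beta> \<in> SdB d n \<Longrightarrow>
      tr (n + 1) (hecke_incl n (hecke_of n \<beta>) \<otimes>\<^bsub>hecke (n + 1)\<^esub> hecke_of (n + 1) (braid_class (n + 1) [Sig n]))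
        = z_var * tr n (hecke_of n \<beta>)"
proof -
  note tr = CollectD[OF assms[unfolded TR_def]]
  note 1 = conjunct2[OF tr, THEN spec, THEN mp]
  note 2 = 1[THEN conjunct2] note 3 = 2[THEN conjunct2] note 4 = 3[THEN conjunct2]
  show "n = 0 \<or> x \<notin> HSd d n \<Longrightarrow> tr n x = 0"
    by (rule conjunct1[OF tr, rule_format])
  show "1 \<le> n \<Longrightarrow> x \<in> HSd d n \<Longrightarrow> y \<in> HSd d n \<Longrightarrow> tr n (x \<oplus>\<^bsub>hecke n\<^esub> y) = tr n x + tr n y"
    by (rule 1[THEN conjunct1, rule_format])
  show "1 \<le> n \<Longrightarrow> x \<in> HSd d n \<Longrightarrow> tr n (hecke_smult n c x) = K_to_Kz c * tr n x"
    by (rule 2[THEN conjunct1, rule_format])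
  show "1 \<le> n \<Longrightarrow> k + l = d \<Longrightarrow> \<alpha> \<in> SdB k n \<Longrightarrow> \<beta> \<in> SdB l n \<Longrightarrow>
      tr n (hecke_of n (\<alpha> \<otimes>\<^bsub>SB n\<^esub> \<beta>)) = tr n (hecke_of n (\<beta> \<otimes>\<^bsub>SB n\<^esub> \<alpha>))"
    by (rule 3[THEN conjunct1, rule_format])
  show "1 \<le> n \<Longrightarrow> x \<in> HSd d n \<Longrightarrow> tr (n + 1) (hecke_incl n x) = tr n x"
    by (rule 4[THEN conjunct1, rule_format])
  show "1 \<le> n \<Longrightarrow> \<beta> \<in> SdB d n \<Longrightarrow>
      tr (n + 1) (hecke_incl n (hecke_of n \<beta>) \<otimes>\<^bsub>hecke (n + 1)\<^esub> hecke_of (n + 1) (braid_class (n + 1) [Sig n]))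
        = z_var * tr n (hecke_of n \<beta>)"
    by (rule 4[THEN conjunct2, rule_format])
qed

text \<open>The representative of x need not be a word at the level where x was given, so some level
  containing it is chosen; \<open>functional_of_cls\<close> removes both choices.\<close>

definition functional_of :: "nat \<Rightarrow> trace_family \<Rightarrow> sbraid \<Rightarrow> Kz"
  where "functional_of d tr x =
    (if x \<in> graded d
     then let n = SOME n. 1 \<le> n \<and> rep_sbraid x \<in> words n in tr n (hecke_of n (braid_class n (rep_sbraid x)))
     else 0)"

context
  fixes d :: nat and tr :: trace_family
  assumes tr: "tr \<in> TR d"
begin

lemma trace_level:
  assumes "1 \<le> m" "m \<le> n" "w \<in> words m" "taus w = d"
  shows "tr n (hecke_of n (braid_class n w)) = tr m (hecke_of m (braid_class m w))"
  using assms(2)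
proof (induction n rule: dec_induct)
  case (step n)
  have w: "w \<in> words n" "1 \<le> n"
    using words_mono[OF assms(3) step(1)] step(1) assms(1) by auto
  have "tr (n + 1) (hecke_incl n (hecke_of n (braid_class n w))) = tr n (hecke_of n (braid_class n w))"
    unfolding hecke_of_def using w assms(4) by (intro TR_D(5)[OF tr] HSd_proj SdB_single)
  then show ?case
    using step w by (simp add: hecke_of_def hecke_incl_proj KSB_single incl_ext_simps)
qed simp

lemma functional_of_cls:
  assumes "1 \<le> n" "w \<in> words n" "taus w = d"
  shows "functional_of d tr (cls w) = tr n (hecke_of n (braid_class n w))"
proof -
  define r where "r = rep_sbraid (cls w)"
  have eq: "stable_eq r w"
    unfolding r_def by (rule stable_eq_rep)
  have r: "valid r" "taus r = d"
    using stable_eq_invariants[OF eq] words_valid[OF assms(2)] assms(3) by auto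
  define m where "m = (SOME n. 1 \<le> n \<and> r \<in> words n)"
  have "\<exists>n. 1 \<le> n \<and> r \<in> words n"
    using valid_words[OF r(1)] by blast
  then have m: "1 \<le> m" "r \<in> words m"
    unfolding m_def using someI_ex[of "\<lambda>n. 1 \<le> n \<and> r \<in> words n"] by blast+
  \<comment> \<open>The two words are known to be equivalent only at high levels;
    \<open>trace_level\<close> carries both values up to a common level j.\<close>
  obtain k where k: "\<forall>j\<ge>k. braid_eq j r w"
    using stable_eq_braid_eq[OF eq r(1)] by blast
  define j where "j = max k (max m n)"
  have "w \<in> words j"
    using words_mono[OF assms(2), of j] by (simp add: j_def)
  then have "braid_class j r = braid_class j w"
    using k by (simp add: braid_class_eq_iff j_def)
  then have "tr m (hecke_of m (braid_class m r)) = tr n (hecke_of n (braid_class n w))"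
    using trace_level[of m j r] trace_level[of n j w] m r assms by (simp add: j_def)
  then show ?thesis
    using words_valid[OF assms(2)] assms(3)
    unfolding functional_of_def Let_def r_def[symmetric] m_def[symmetric] by simp
qed

lemma trace_quadratic:
  assumes "1 \<le> k" "k < n" "u \<in> words n" "v \<in> words n" "taus u + taus v = d"
  shows "tr n (hecke_of n (braid_class n (u @ [Sig k, Sig k] @ v)))
    = (qq - 1) * tr n (hecke_of n (braid_class n (u @ [Sig k] @ v))) + qq * tr n (hecke_of n (braid_class n (u @ v)))"
proof -
  let ?s = "\<lambda>w a. single (braid_class n w) (a :: K)"
  let ?t = "\<lambda>w. tr n (hecke_of n (braid_class n w))"
  define w2 w1 w0 where "w2 = u @ [Sig k, Sig k] @ v" and "w1 = u @ [Sig k] @ v" and "w0 = u @ v"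
  have n: "1 \<le> n"
    using assms by simp
  have w: "w2 \<in> words n" "w1 \<in> words n" "w0 \<in> words n" "taus w2 = d" "taus w1 = d" "taus w0 = d"
    using assms by (simp_all add: w2_def w1_def w0_def)
  have c: "?s w2 a \<in> carrier (KSB n)" "?s w1 a \<in> carrier (KSB n)" "?s w0 a \<in> carrier (KSB n)" for a
    using KSB_single[OF w(1)] KSB_single[OF w(2)] KSB_single[OF w(3)] by blast+
  have scaled: "tr n (hecke_proj n (?s w a)) = K_to_Kz a * ?t w" if "w \<in> words n" "taus w = d" for w a
  proof -
    have "hecke_proj n (?s w a) = hecke_smult n a (hecke_of n (braid_class n w))"
      unfolding hecke_of_def hecke_smult_proj[OF KSB_single[OF that(1)]] scale_single by simp
    moreover have "hecke_of n (braid_class n w) \<in> HSd d n"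
      unfolding hecke_of_def using that by (intro HSd_proj SdB_single)
    ultimately show ?thesis
      using TR_D(3)[OF tr n] by simp
  qed
  have "?s w2 1 - (?s w1 (q_var - 1) + ?s w0 q_var) \<in> hecke_ideal n"
    using quadratic_element_ideal[OF assms(1-4), of 1]
    by (simp add: quadratic_element_def w2_def w1_def w0_def)
  then have "hecke_proj n (?s w2 1) = hecke_proj n (?s w1 (q_var - 1) + ?s w0 q_var)"
    using hecke_proj_eq_iff[OF c(1) KSB_add[OF c(2,3)]] by blast
  also have "\<dots> = hecke_proj n (?s w1 (q_var - 1)) \<oplus>\<^bsub>hecke n\<^esub> hecke_proj n (?s w0 q_var)"
    by (rule hecke_proj_simps(2)[OF c(2,3), symmetric])
  finally have "?t w2 = tr n (hecke_proj n (?s w1 (q_var - 1)) \<oplus>\<^bsub>hecke n\<^esub> hecke_proj n (?s w0 q_var))"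
    by (simp only: hecke_of_def)
  also have "\<dots> = tr n (hecke_proj n (?s w1 (q_var - 1))) + tr n (hecke_proj n (?s w0 q_var))"
    using w by (intro TR_D(2)[OF tr n] HSd_proj SdB_single)
  finally have "?t w2 = (qq - 1) * ?t w1 + qq * ?t w0"
    by (simp add: scaled[OF w(2,5)] scaled[OF w(3,6)])
  then show ?thesis
    by (simp add: w2_def w1_def w0_def)
qed

lemma functional_of_markov: "markov_functional d (functional_of d tr)"
proof
  fix x
  show "x \<notin> graded d \<Longrightarrow> functional_of d tr x = 0"
    by (simp add: functional_of_def)
next
  fix x y
  obtain u v where w: "x = cls u" "y = cls v"
    by (metis cls_rep)
  show "functional_of d tr (x * y) = functional_of d tr (y * x)"
  proof (cases "x * y \<in> graded d")
    case True
    then have uv: "valid (u @ v)" "taus u + taus v = d"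
      by (simp_all add: w flip: cls_append)
    then obtain n where n: "1 \<le> n" "u \<in> words n" "v \<in> words n"
      using valid_words[of "u @ v"] by auto
    then show ?thesis
      using TR_D(4)[OF tr n(1) uv(2) SdB_class[OF n(2)] SdB_class[OF n(3)]] uv
      by (simp add: w functional_of_cls[of n] SB_mult flip: cls_append)
  next
    case False
    then show ?thesis
      using graded_mult_commute[of x y d] by (simp add: functional_of_def)
  qed
next
  fix k :: nat and x y
  assume k: "1 \<le> k"
  obtain u v where w: "x = cls u" "y = cls v"
    by (metis cls_rep)
  have prod: "x * (sg k * (sg k * y)) = cls (u @ [Sig k, Sig k] @ v)"
    "x * (sg k * y) = cls (u @ [Sig k] @ v)" "x * y = cls (u @ v)"
    by (simp_all add: w cls_append cls_simps)
  show "functional_of d tr (x * (sg k * (sg k * y)))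
      = (qq - 1) * functional_of d tr (x * (sg k * y)) + qq * functional_of d tr (x * y)"
  proof (cases "x * y \<in> graded d")
    case True
    then have uv: "valid (u @ v)" "taus u + taus v = d"
      by (simp_all add: w flip: cls_append)
    then obtain m where "\<forall>n\<ge>m. u \<in> words n \<and> v \<in> words n"
      using valid_words[of "u @ v"] by auto
    then have n: "1 \<le> max m (Suc k)" "u \<in> words (max m (Suc k))" "v \<in> words (max m (Suc k))" "k < max m (Suc k)"
      by auto
    then show ?thesis
      unfolding prod using trace_quadratic[OF k n(4,2,3) uv(2)] k uv
      by (simp add: functional_of_cls[OF n(1)])
  next
    case False
    then show ?thesis
      using k graded_insert_sg(1)[OF k, of x _ d] by (simp add: functional_of_def)
  qed
next
  fix n :: nat and x
  assume n: "1 \<le> n" and "x \<in> strands n"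
  then obtain w where w: "x = cls w" "w \<in> words n"
    by (auto simp: strands_def)
  have iff: "x * sg n \<in> graded d \<longleftrightarrow> x \<in> graded d"
    using graded_insert_sg(1)[of n x 1 d] n by simp
  show "functional_of d tr (x * sg n) = z_var * functional_of d tr x"
  proof (cases "x \<in> graded d")
    case True
    then have d: "taus w = d"
      by (simp add: w)
    have w': "w \<in> words (n + 1)" "[Sig n] \<in> words (n + 1)"
      using n w by (auto intro: words_mono)
    have "hecke_incl n (hecke_of n (braid_class n w)) \<otimes>\<^bsub>hecke (n + 1)\<^esub> hecke_of (n + 1) (braid_class (n + 1) [Sig n])
        = hecke_of (n + 1) (braid_class (n + 1) (w @ [Sig n]))"
      unfolding hecke_of_def hecke_incl_proj[OF KSB_single[OF w(2)]] incl_ext_simps(2)[OF w(2)]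
      by (subst hecke_proj_simps(3)[OF KSB_single[OF w'(1)] KSB_single[OF w'(2)]])
        (use SB_mult[OF w'] in \<open>simp add: monoid_algebra_single\<close>)
    then have "tr (n + 1) (hecke_of (n + 1) (braid_class (n + 1) (w @ [Sig n]))) = z_var * tr n (hecke_of n (braid_class n w))"
      using TR_D(6)[OF tr n] SdB_class[OF w(2)] d by metis
    moreover have "x * sg n = cls (w @ [Sig n])"
      by (simp add: w cls_append sg_def)
    ultimately show ?thesis
      using n w w' d functional_of_cls[of "n + 1" "w @ [Sig n]"] functional_of_cls[of n w] by simp
  next
    case False
    then show ?thesis
      using iff by (simp add: functional_of_def)
  qed
qed

text \<open>Together with \<open>functional_of_trace_of\<close> this makes the passage between
  \<open>TR d\<close> and the functionals a bijection. A trace is determined on words because their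
  classes span \<open>HSd d n\<close>.\<close>

lemma trace_of_functional_of: "trace_of d (functional_of d tr) = tr"
proof (intro ext)
  fix n X
  show "trace_of d (functional_of d tr) n X = tr n X"
  proof (cases "1 \<le> n \<and> X \<in> HSd d n")
    case True
    then obtain g where n: "1 \<le> n" and g: "keys g \<subseteq> SdB d n" "X = hecke_proj n g"
      by (auto elim: HSdE)
    have single: "tr n (hecke_proj n (single x a)) = functional_ext (functional_of d tr) (single x a)"
      if x: "x \<in> SdB d n" for x a
    proof -
      obtain w where w: "x = braid_class n w" "w \<in> words n" "taus w = d"
        using x by (auto simp: SdB_alt)
      have "hecke_proj n (single x a) = hecke_smult n a (hecke_of n x)"
        unfolding hecke_of_def w(1) by (simp add: hecke_smult_proj[OF KSB_single[OF w(2)]] scale_single)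
      then show ?thesis
        using TR_D(3)[OF tr n, of "hecke_of n x" a] x w n
        by (simp add: functional_ext_simps functional_of_cls hecke_of_def HSd_proj)
    qed
    have "tr n (hecke_proj n g) = functional_ext (functional_of d tr) g"
      using g(1)
    proof (induction rule: keys_subset_induct)
      case zero
      \<comment> \<open>Homogeneity for the scalar 0 forces the trace to vanish at the class of
        0.\<close>
      have "hecke_smult n 0 (hecke_proj n 0) = hecke_proj n 0"
        by (subst hecke_smult_proj) (simp_all add: KSB_carrier scale_zero)
      then show ?case
        using TR_D(3)[OF tr n, of "hecke_proj n 0" 0] by (simp add: functional_ext_simps HSd_proj)
    next
      case (add g x a)
      have x: "keys (single x a) \<subseteq> SdB d n"
        using add by simp
      have "hecke_proj n (g + single x a) = hecke_proj n g \<oplus>\<^bsub>hecke n\<^esub> hecke_proj n (single x a)"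
        using add x SdB_carrier by (intro hecke_proj_simps(2)[symmetric]) blast+
      then show ?case
        using TR_D(2)[OF tr n HSd_proj[OF add.hyps(1)] HSd_proj[OF x]] add single
        by (simp add: functional_ext_simps)
    qed
    then show ?thesis
      using n g by (simp add: trace_of_proj[OF functional_of_markov])
  next
    case False
    then show ?thesis
      using TR_D(1)[OF tr, of n X] by (auto simp: trace_of_def)
  qed
qed

end

lemma functional_of_trace_of:
  assumes "markov_functional d f"
  shows "functional_of d (trace_of d f) = f"
proof
  fix x
  obtain w where w: "x = cls w"
    by (metis cls_rep)
  show "functional_of d (trace_of d f) x = f x"
  proof (cases "x \<in> graded d")
    case True
    then obtain n where "1 \<le> n" "w \<in> words n" "taus w = d"
      using w valid_words[of w] by auto
    then show ?thesis
      using assms by (simp add: w functional_of_cls[OF trace_of_TR[OF assms]] trace_of_hecke_of)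
  next
    case False
    then show ?thesis
      by (simp add: functional_of_def markov_functional.support[OF assms])
  qed
qed

lemma trace_of_linear:
  "trace_of d (\<lambda>x. c * f x + c' * g x) = trace_scale c (trace_of d f) + trace_scale c' (trace_of d g)"
  by (auto simp: trace_of_def trace_scale_def fun_eq_iff functional_ext_linear)

section \<open>The maps between degrees\<close>

text \<open>Lifts the maps \<open>g_map\<close> to the monoid algebra; by
  \<open>resolve_sum_braid_eq\<close> the chosen representative is immaterial.\<close>

definition resolve_ext :: "nat \<Rightarrow> nat \<Rightarrow> (word set \<Rightarrow>\<^sub>0 K) \<Rightarrow> word set \<Rightarrow>\<^sub>0 K"
  where "resolve_ext \<epsilon> n =
    lin_ext (\<lambda>x a. resolve_sum \<epsilon> (\<lambda>v. single (braid_class n v) a) (SOME w. w \<in> x))"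

lemma resolve_ext_simps:
  "resolve_ext \<epsilon> n (f + g) = resolve_ext \<epsilon> n f + resolve_ext \<epsilon> n g"
  "resolve_ext \<epsilon> n 0 = 0"
  "w \<in> words n \<Longrightarrow>
    resolve_ext \<epsilon> n (single (braid_class n w) a) = resolve_sum \<epsilon> (\<lambda>v. single (braid_class n v) a) w"
proof -
  have *: "additive_family (\<lambda>x a. resolve_sum \<epsilon> (\<lambda>v. single (braid_class n v) (a::K)) (SOME w. w \<in> x))"
    by (simp add: additive_family_def resolve_sum_def single_add sum.distrib)
  show "resolve_ext \<epsilon> n (f + g) = resolve_ext \<epsilon> n f + resolve_ext \<epsilon> n g" "resolve_ext \<epsilon> n 0 = 0"
    unfolding resolve_ext_def by (simp_all add: lin_ext_add[OF *])
  assume w: "w \<in> words n"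
  define r where "r = (SOME v. v \<in> braid_class n w)"
  have "r \<in> braid_class n w"
    unfolding r_def using braid_class_self[OF w] by (rule someI)
  then have "braid_eq n w r"
    by (simp add: braid_class_def)
  then have "resolve_sum \<epsilon> (\<lambda>v. single (braid_class n v) a) w = resolve_sum \<epsilon> (\<lambda>v. single (braid_class n v) a) r"
    by (rule resolve_sum_braid_eq) (metis braid_class_eq_iff braid_eq_words)
  then show "resolve_ext \<epsilon> n (single (braid_class n w) a) = resolve_sum \<epsilon> (\<lambda>v. single (braid_class n v) a) w"
    unfolding resolve_ext_def lin_ext_single[OF *] by (simp add: r_def)
qed

lemma resolve_ext_diff: "resolve_ext \<epsilon> n (f - g) = resolve_ext \<epsilon> n f - resolve_ext \<epsilon> n g"
  using resolve_ext_simps(1)[of \<epsilon> n "f - g" g] by simp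

lemma hecke_ideal_sum: "(\<And>j. j \<in> J \<Longrightarrow> g j \<in> hecke_ideal n) \<Longrightarrow> (\<Sum>j\<in>J. g j) \<in> hecke_ideal n"
  by (induction J rule: infinite_finite_induct) (simp_all add: hecke_ideal_zero hecke_ideal_add)

lemma resolve_sum_ideal:
  assumes "w \<in> words n" "\<And>v. v \<in> words n \<Longrightarrow> g v \<in> hecke_ideal n"
  shows "resolve_sum \<epsilon> g w \<in> hecke_ideal n"
  unfolding resolve_sum_def using assms by (intro hecke_ideal_sum) (auto intro: desingularize_invariants(2))

text \<open>The singular points of a translated quadratic relation lie in the outer words u and v,
  so resolving one gives another translate.\<close>

lemma resolve_ext_ideal:
  assumes "f \<in> hecke_ideal n"
  shows "resolve_ext \<epsilon> n f \<in> hecke_ideal n"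
  using assms
proof (rule hecke_ideal_additive_image[where P = "\<lambda>x. x \<in> hecke_ideal n" and L = "resolve_ext \<epsilon> n"])
  fix k u v c
  assume k: "1 \<le> k" "k < n" "u \<in> words n" "v \<in> words n"
  have "resolve_ext \<epsilon> n (quadratic_element n u k v c) =
      resolve_sum \<epsilon> (\<lambda>x. quadratic_element n x k v c) u + resolve_sum \<epsilon> (\<lambda>y. quadratic_element n u k y c) v"
    unfolding quadratic_element_def resolve_ext_diff resolve_ext_simps(1) using k
    by (simp add: resolve_ext_simps(3) resolve_sum_append)
      (simp add: resolve_sum_def sum_subtractf sum.distrib)
  then show "resolve_ext \<epsilon> n (quadratic_element n u k v c) \<in> hecke_ideal n"
    using k by (auto intro!: hecke_ideal_add resolve_sum_ideal quadratic_element_ideal)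
qed (auto simp: resolve_ext_simps hecke_ideal_zero hecke_ideal_add)

lemma keys_sum_subset:
  fixes g :: "'j \<Rightarrow> 'm \<Rightarrow>\<^sub>0 'k::comm_monoid_add"
  shows "(\<And>j. j \<in> J \<Longrightarrow> keys (g j) \<subseteq> S) \<Longrightarrow> keys (\<Sum>j\<in>J. g j) \<subseteq> S"
  by (induction J rule: infinite_finite_induct) (simp_all add: keys_add_subset)

lemma resolve_ext_keys:
  assumes "keys f \<subseteq> SdB (d + 1) n"
  shows "keys (resolve_ext \<epsilon> n f) \<subseteq> SdB d n"
  using assms
proof (induction rule: keys_subset_induct)
  case (add f x a)
  then obtain w where w: "x = braid_class n w" "w \<in> words n" "taus w = d + 1"
    by (auto simp: SdB_alt)
  have "keys (single (braid_class n (desingularize \<epsilon> w j)) a) \<subseteq> SdB d n"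
    if "j < length w" "is_Tau (w ! j)" for j
    using desingularize_invariants(2,3)[OF that] w by (intro SdB_single) fastforce+
  then have "keys (resolve_ext \<epsilon> n (single x a)) \<subseteq> SdB d n"
    unfolding w(1) resolve_ext_simps(3)[OF w(2)] resolve_sum_def by (intro keys_sum_subset) auto
  with add show ?case
    unfolding resolve_ext_simps(1) by (intro keys_add_subset)
qed (simp add: resolve_ext_simps)

lemma resolve_ext_proj:
  assumes "keys f \<subseteq> SdB (d + 1) n" "keys g \<subseteq> SdB (d + 1) n" "hecke_proj n f = hecke_proj n g"
  shows "hecke_proj n (resolve_ext \<epsilon> n f) = hecke_proj n (resolve_ext \<epsilon> n g)"
  using assms hecke_proj_eq_iff[of f n g] resolve_ext_ideal[of "f - g" n \<epsilon>]
    hecke_proj_eq_iff[of "resolve_ext \<epsilon> n f" n "resolve_ext \<epsilon> n g"]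
    SdB_carrier[OF resolve_ext_keys[of _ d n \<epsilon>]] SdB_carrier[of _ "d + 1" n]
  by (simp add: resolve_ext_diff)

lemma scale_sum: "scale c (\<Sum>j\<in>J. g j) = (\<Sum>j\<in>J. scale c (g j))" for c :: "'k::comm_ring_1"
  by (induction J rule: infinite_finite_induct) (simp_all add: scale_zero scale_add)

lemma resolve_ext_scale: "keys f \<subseteq> braid_class n ` words n \<Longrightarrow>
    resolve_ext \<epsilon> n (scale c f) = scale c (resolve_ext \<epsilon> n f)"
proof (induction rule: keys_subset_induct)
  case (add f x a)
  then show ?case
    by (auto simp: scale_add resolve_ext_simps scale_single resolve_sum_def scale_sum)
qed (simp add: scale_zero resolve_ext_simps)

lemma finsum_hecke_proj:
  assumes "finite J" "\<And>j. j \<in> J \<Longrightarrow> g j \<in> carrier (KSB n)"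
  shows "(\<Oplus>\<^bsub>hecke n\<^esub>j\<in>J. hecke_proj n (g j)) = hecke_proj n (\<Sum>j\<in>J. g j)
    \<and> (\<Sum>j\<in>J. g j) \<in> carrier (KSB n)"
proof -
  interpret H: ring "hecke n" by (rule ring_hecke)
  have zero: "hecke_proj n 0 = \<zero>\<^bsub>hecke n\<^esub>"
    using ring_hom_zero[OF hecke_proj_hom ring_KSB ring_hecke] by (simp add: monoid_algebra_simps)
  show ?thesis
    using assms
  proof (induction J rule: finite_induct)
    case empty
    then show ?case
      by (simp add: zero KSB_carrier)
  next
    case (insert j J)
    then have c: "g j \<in> carrier (KSB n)" "(\<Sum>j\<in>J. g j) \<in> carrier (KSB n)"
      by auto
    have "(\<Oplus>\<^bsub>hecke n\<^esub>j\<in>insert j J. hecke_proj n (g j))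
        = hecke_proj n (g j) \<oplus>\<^bsub>hecke n\<^esub> (\<Oplus>\<^bsub>hecke n\<^esub>j\<in>J. hecke_proj n (g j))"
      using insert by (intro H.finsum_insert) (auto intro: hecke_proj_simps(1))
    also have "\<dots> = hecke_proj n (g j + (\<Sum>j\<in>J. g j))"
      using insert hecke_proj_simps(2)[OF c] by simp
    finally show ?case
      using insert KSB_add[OF c] by simp
  qed
qed

text \<open>Justifies the definite description: resolution on representatives satisfies the
  specification, and additivity and homogeneity determine any solution from the classes of
  words.\<close>

lemma g_map_proj:
  assumes "keys f \<subseteq> SdB (d + 1) n"
  shows "g_map \<epsilon> d n (hecke_proj n f) = hecke_proj n (resolve_ext \<epsilon> n f)"
proof -
  let ?H = "HSd (d + 1) n"
  define P where "P h \<longleftrightarrow> h \<in> ?H \<rightarrow>\<^sub>E HSd d n \<and>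
    (\<forall>x\<in>?H. \<forall>y\<in>?H. h (x \<oplus>\<^bsub>hecke n\<^esub> y) = h x \<oplus>\<^bsub>hecke n\<^esub> h y) \<and>
    (\<forall>c. \<forall>x\<in>?H. h (hecke_smult n c x) = hecke_smult n c (h x)) \<and>
    (\<forall>w\<in>words n. length (filter is_Tau w) = d + 1 \<longrightarrow>
      h (hecke_of n (braid_class n w)) =
        (\<Oplus>\<^bsub>hecke n\<^esub>j\<in>{j. j < length w \<and> is_Tau (w ! j)}.
           hecke_of n (braid_class n (desingularize \<epsilon> w j))))" for h
  have generator: "(\<Oplus>\<^bsub>hecke n\<^esub>j\<in>{j. j < length w \<and> is_Tau (w ! j)}. hecke_of n (braid_class n (desingularize \<epsilon> w j)))
      = hecke_proj n (resolve_ext \<epsilon> n (single (braid_class n w) 1))" if "w \<in> words n" for w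
    unfolding resolve_ext_simps(3)[OF that] resolve_sum_def hecke_of_def
    using that by (intro finsum_hecke_proj[THEN conjunct1] KSB_single desingularize_invariants(2)) auto
  \<comment> \<open>The witness; the restriction gives \<open>undefined\<close> outside the domain,
    as extensionality of the specification demands.\<close>
  define h0 where "h0 = restrict (\<lambda>X. hecke_proj n (resolve_ext \<epsilon> n
    (SOME f. keys f \<subseteq> SdB (d + 1) n \<and> X = hecke_proj n f))) ?H"
  have h0: "h0 (hecke_proj n f) = hecke_proj n (resolve_ext \<epsilon> n f)" if f: "keys f \<subseteq> SdB (d + 1) n" for f
  proof -
    define g where "g = (SOME g. keys g \<subseteq> SdB (d + 1) n \<and> hecke_proj n f = hecke_proj n g)"
    have g: "keys g \<subseteq> SdB (d + 1) n \<and> hecke_proj n f = hecke_proj n g"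
      unfolding g_def by (rule someI[of _ f]) (use f in simp)
    have "h0 (hecke_proj n f) = hecke_proj n (resolve_ext \<epsilon> n g)"
      unfolding h0_def g_def using HSd_proj[OF f] by simp
    then show ?thesis
      using resolve_ext_proj[of g d n f \<epsilon>] f g by simp
  qed
  have P_h0: "P h0"
    unfolding P_def
  proof (intro conjI ballI allI impI)
    have "h0 X \<in> HSd d n" if X: "X \<in> ?H" for X
    proof -
      obtain g where "keys g \<subseteq> SdB (d + 1) n" "X = hecke_proj n g"
        using X by (elim HSdE)
      then show ?thesis
        using h0 HSd_proj[OF resolve_ext_keys] by simp
    qed
    then show "h0 \<in> ?H \<rightarrow>\<^sub>E HSd d n"
      by (auto simp: h0_def)
  next
    fix x y
    assume "x \<in> ?H" "y \<in> ?H"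
    then obtain f g where fg: "keys f \<subseteq> SdB (d + 1) n" "keys g \<subseteq> SdB (d + 1) n"
      "x = hecke_proj n f" "y = hecke_proj n g"
      by (elim HSdE)
    note c = SdB_carrier[OF fg(1)] SdB_carrier[OF fg(2)]
      SdB_carrier[OF resolve_ext_keys[OF fg(1)]] SdB_carrier[OF resolve_ext_keys[OF fg(2)]]
    show "h0 (x \<oplus>\<^bsub>hecke n\<^esub> y) = h0 x \<oplus>\<^bsub>hecke n\<^esub> h0 y"
      unfolding fg(3,4) hecke_proj_simps(2)[OF c(1,2)] h0[OF fg(1)] h0[OF fg(2)]
        h0[OF keys_add_subset[OF fg(1,2)]] hecke_proj_simps(2)[OF c(3,4)] resolve_ext_simps(1) by (rule HOL.refl)
  next
    fix a x
    assume "x \<in> ?H"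
    then obtain f where f: "keys f \<subseteq> SdB (d + 1) n" "x = hecke_proj n f"
      by (elim HSdE)
    have s: "keys (scale a f) \<subseteq> SdB (d + 1) n"
      using f keys_scale[of a f] by blast
    have "keys f \<subseteq> braid_class n ` words n"
      using SdB_carrier[OF f(1)] by (simp add: KSB_carrier)
    then show "h0 (hecke_smult n a x) = hecke_smult n a (h0 x)"
      unfolding f(2) hecke_smult_proj[OF SdB_carrier[OF f(1)]] h0[OF f(1)] h0[OF s]
        hecke_smult_proj[OF SdB_carrier[OF resolve_ext_keys[OF f(1)]]] by (simp add: resolve_ext_scale)
  next
    fix w
    assume w: "w \<in> words n" "length (filter is_Tau w) = d + 1"
    then show "h0 (hecke_of n (braid_class n w)) = (\<Oplus>\<^bsub>hecke n\<^esub>j\<in>{j. j < length w \<and> is_Tau (w ! j)}.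
        hecke_of n (braid_class n (desingularize \<epsilon> w j)))"
      unfolding generator[OF w(1)] unfolding hecke_of_def by (intro h0 SdB_single) (auto simp: taus_def)
  qed
  have P_proj: "h (hecke_proj n f) = hecke_proj n (resolve_ext \<epsilon> n f)"
    if h: "P h" and f: "keys f \<subseteq> SdB (d + 1) n" for h f
    using f
  proof (induction rule: keys_subset_induct)
    case zero
    have z: "hecke_proj n 0 \<in> ?H"
      by (rule HSd_proj) simp
    then have "h (hecke_proj n 0) \<in> HSd d n"
      using h by (auto simp: P_def)
    then obtain g where g: "keys g \<subseteq> SdB d n" "h (hecke_proj n 0) = hecke_proj n g"
      by (elim HSdE)
    have 0: "scale 0 g = (0 :: word set \<Rightarrow>\<^sub>0 K)" for g
      by (rule poly_mapping_eqI) (simp add: lookup_scale)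
    \<comment> \<open>Homogeneity for the scalar 0 gives h 0 = 0, the start of the
      induction.\<close>
    have "hecke_smult n 0 (hecke_proj n 0) = hecke_proj n 0"
      by (subst hecke_smult_proj) (simp_all add: KSB_carrier 0)
    then have "h (hecke_proj n 0) = hecke_smult n 0 (h (hecke_proj n 0))"
      using h z unfolding P_def by metis
    also have "\<dots> = hecke_proj n 0"
      unfolding g(2) hecke_smult_proj[OF SdB_carrier[OF g(1)]] 0 by (rule HOL.refl)
    finally show ?case
      by (simp add: resolve_ext_simps)
  next
    case (add f x a)
    then obtain w where w: "x = braid_class n w" "w \<in> words n" "taus w = d + 1"
      by (auto simp: SdB_alt)
    have s: "keys (single x a) \<subseteq> SdB (d + 1) n" "keys (single x 1) \<subseteq> SdB (d + 1) n" for a :: K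
      using add by simp_all
    have sx: "single x a = scale a (single x 1)"
      by (simp add: scale_single)
    have "hecke_proj n (single x a) = hecke_smult n a (hecke_of n x)"
      unfolding sx hecke_of_def using SdB_carrier[OF s(2)] by (simp only: hecke_smult_proj)
    moreover have "hecke_of n x \<in> ?H"
      unfolding hecke_of_def by (rule HSd_proj[OF s(2)])
    moreover have "h (hecke_of n x) = hecke_proj n (resolve_ext \<epsilon> n (single x 1))"
      using h w generator[OF w(2)] unfolding P_def taus_def w(1) by simp
    ultimately have "h (hecke_proj n (single x a)) = hecke_smult n a (hecke_proj n (resolve_ext \<epsilon> n (single x 1)))"
      using h unfolding P_def by simp
    also have "\<dots> = hecke_proj n (resolve_ext \<epsilon> n (single x a))"
      unfolding sx using SdB_carrier[OF resolve_ext_keys[OF s(2)]] w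
      by (subst resolve_ext_scale) (auto simp: hecke_smult_proj)
    finally have single: "h (hecke_proj n (single x a)) = hecke_proj n (resolve_ext \<epsilon> n (single x a))" .
    have "h (hecke_proj n (f + single x a)) = h (hecke_proj n f) \<oplus>\<^bsub>hecke n\<^esub> h (hecke_proj n (single x a))"
      using h HSd_proj[OF add.hyps(1)] HSd_proj[OF s(1)]
      unfolding P_def hecke_proj_simps(2)[OF SdB_carrier[OF add.hyps(1)] SdB_carrier[OF s(1)], symmetric] by blast
    then show ?case
      unfolding add.IH single resolve_ext_simps(1)
      using hecke_proj_simps(2)[OF SdB_carrier[OF resolve_ext_keys[OF add.hyps(1)]] SdB_carrier[OF resolve_ext_keys[OF s(1)]]]
      by simp
  qed
  have "h = h0" if h: "P h" for h
  proof
    fix X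
    show "h X = h0 X"
    proof (cases "X \<in> ?H")
      case True
      then obtain g where "keys g \<subseteq> SdB (d + 1) n" "X = hecke_proj n g"
        by (elim HSdE)
      then show ?thesis
        using P_proj[OF h] P_proj[OF P_h0] by simp
    next
      case False
      then show ?thesis
        using h P_h0 unfolding P_def by (auto simp: PiE_def extensional_def)
    qed
  qed
  with P_h0 have "(THE h. P h) = h0"
    by (intro the_equality)
  then have "g_map \<epsilon> d n = h0"
    unfolding g_map_def P_def .
  then show ?thesis
    using h0[OF assms] by simp
qed

lemma Phi_trace_of:
  assumes "markov_functional d f"
  shows "\<Phi> \<epsilon> d (trace_of d f) = trace_of (Suc d) (Phi \<epsilon> f)"
proof (intro ext)
  fix n X
  show "\<Phi> \<epsilon> d (trace_of d f) n X = trace_of (Suc d) (Phi \<epsilon> f) n X"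
  proof (cases "1 \<le> n \<and> X \<in> HSd (d + 1) n")
    case True
    then obtain g where n: "1 \<le> n" and g: "keys g \<subseteq> SdB (d + 1) n" "X = hecke_proj n g"
      by (auto elim: HSdE)
    have "functional_ext f (resolve_ext \<epsilon> n g) = functional_ext (Phi \<epsilon> f) g"
      using g(1)
    proof (rule additive_unique)
      fix x a
      assume "x \<in> SdB (d + 1) n"
      then obtain w where w: "x = braid_class n w" "w \<in> words n"
        by (auto simp: SdB_alt)
      have sum: "functional_ext f (\<Sum>j\<in>J. h j) = (\<Sum>j\<in>J. functional_ext f (h j))" for J :: "nat set" and h
        by (induction J rule: infinite_finite_induct) (simp_all add: functional_ext_simps)
      have "functional_ext f (resolve_ext \<epsilon> n (single x a)) = resolve_sum \<epsilon> (\<lambda>v. K_to_Kz a * f (cls v)) w"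
        unfolding w(1) resolve_ext_simps(3)[OF w(2)] resolve_sum_def sum using w(2)
        by (intro sum.cong) (auto simp: functional_ext_simps(3)[OF desingularize_invariants(2)])
      also have "\<dots> = functional_ext (Phi \<epsilon> f) (single x a)"
        using words_valid[OF w(2)] by (simp add: w functional_ext_simps Phi_cls resolve_sum_scale)
      finally show "functional_ext f (resolve_ext \<epsilon> n (single x a)) = functional_ext (Phi \<epsilon> f) (single x a)" .
    qed (simp_all add: resolve_ext_simps functional_ext_simps)
    then show ?thesis
      using n g HSd_proj[OF g(1)] trace_of_proj[OF assms n resolve_ext_keys[OF g(1)]]
        trace_of_proj[OF Phi_markov[OF assms] n, of g \<epsilon>]
      by (simp add: \<Phi>_def g_map_proj[OF g(1), simplified])
  next
    case False
    then show ?thesis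
      by (auto simp: \<Phi>_def trace_of_def)
  qed
qed

section \<open>The basic traces form a basis\<close>

lemma one_hecke: "\<one>\<^bsub>hecke 1\<^esub> = hecke_of 1 (braid_class 1 [])"
  using ring_hom_one[OF hecke_proj_hom[of 1]] by (simp add: hecke_of_def monoid_algebra_simps SB_one)

text \<open>Existence comes from the interpolated functional; uniqueness is transported from
  \<open>markov_functional_unique\<close> through the correspondence.\<close>

lemma ocneanu_trace_eq: "ocneanu_trace = trace_of 0 ocneanu"
  unfolding ocneanu_trace_def
proof (rule the_equality)
  have "trace_of 0 ocneanu 1 \<one>\<^bsub>hecke 1\<^esub> = 1"
    unfolding one_hecke by (subst trace_of_hecke_of[OF ocneanu_markov]) (simp_all add: cls_Nil ocneanu_one)
  then show "trace_of 0 ocneanu \<in> TR 0 \<and> trace_of 0 ocneanu 1 \<one>\<^bsub>hecke 1\<^esub> = 1"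
    using trace_of_TR[OF ocneanu_markov] by simp
next
  fix tr
  assume tr: "tr \<in> TR 0 \<and> tr 1 \<one>\<^bsub>hecke 1\<^esub> = 1"
  let ?f = "functional_of 0 tr"
  have m: "markov_functional 0 ?f"
    using tr by (intro functional_of_markov) simp
  have "?f 1 = 1"
    using tr functional_of_cls[of tr 0 1 "[]"] unfolding one_hecke by (simp add: cls_Nil)
  then have "?f x = ocneanu x" for x
    using markov_functional_unique[OF m ocneanu_markov ocneanu_one, of x] by (metis mult_1_left)
  then have "?f = ocneanu" ..
  then show "tr = trace_of 0 ocneanu"
    using trace_of_functional_of[of tr 0] tr by simp
qed

lemma T_trace_eq: "T_trace d k = trace_of d (basic ocneanu d k)"
proof (induction d arbitrary: k)
  case 0
  show ?case by (simp add: ocneanu_trace_eq)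
next
  case (Suc d)
  then show ?case
    using Phi_trace_of[OF basic_markov[OF ocneanu_markov]] by simp
qed

lemma trace_of_zero: "trace_of d (\<lambda>x. 0) = 0"
  using trace_of_linear[of d 0 "\<lambda>x. 0" 0 "\<lambda>x. 0"] by simp

lemma markov_functional_zero: "markov_functional d (\<lambda>x. 0)"
  using markov_functional_scale[OF basic_markov[OF ocneanu_markov], of d 0 0] by simp

lemma trace_of_sum:
  "trace_of d (\<lambda>x. \<Sum>k\<in>A. c k * f k x) = (\<Sum>k\<in>A. trace_scale (c k) (trace_of d (f k)))"
proof (induction A rule: infinite_finite_induct)
  case (insert k A)
  then show ?case
    using trace_of_linear[of d "c k" "f k" 1 "\<lambda>x. \<Sum>k\<in>A. c k * f k x"] by simp
qed (simp_all add: trace_of_zero)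

theorem theorem4p7:
  fixes d :: nat
  shows "traces.subspace (TR d)
    \<and> traces.dim (TR d) = d + 1
    \<and> inj_on (T_trace d) {0..d}
    \<and> traces.independent (T_trace d ` {0..d})
    \<and> traces.span (T_trace d ` {0..d}) = TR d"
proof -
  let ?b = "basic ocneanu d"
  have TR: "TR d = trace_of d ` {f. markov_functional d f}"
    using trace_of_TR functional_of_markov trace_of_functional_of by (auto simp: image_iff) metis
  \<comment> \<open>Independence is stated for the indexed family, so that injectivity of
    \<open>T_trace d\<close> and independence of its image both follow.\<close>
  have zero: "c k = 0" if "(\<Sum>k\<le>d. trace_scale (c k) (T_trace d k)) = 0" "k \<le> d" for c k
  proof -
    let ?g = "\<lambda>x. \<Sum>k\<le>d. c k * ?b k x"
    have m: "markov_functional d (\<lambda>x. \<Sum>k\<in>A. c k * ?b k x)" for A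
    proof (induction A rule: infinite_finite_induct)
      case (insert k A)
      then show ?case
        using markov_functional_linear[OF basic_markov[OF ocneanu_markov] insert.IH, of "c k" k 1] by simp
    qed (simp_all add: markov_functional_zero)
    have "trace_of d ?g = (\<Sum>k\<le>d. trace_scale (c k) (T_trace d k))"
      by (simp only: trace_of_sum T_trace_eq)
    then have "trace_of d ?g = trace_of d (\<lambda>x. 0)"
      using that(1) by (simp only: trace_of_zero)
    then have "functional_of d (trace_of d ?g) = functional_of d (trace_of d (\<lambda>x. 0))"
      by (rule arg_cong)
    then have "?g = (\<lambda>x. 0)"
      by (simp only: functional_of_trace_of[OF m] functional_of_trace_of[OF markov_functional_zero])
    from fun_cong[OF this] have "?g x = 0" for x .
    with that(2) show ?thesis
      by (intro basic_independent[OF ocneanu_markov, of c d]) (simp_all add: ocneanu_one)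
  qed
  have inj: "inj_on (T_trace d) {0..d}"
  proof (rule inj_onI, rule ccontr)
    fix i j
    assume ij: "i \<in> {0..d}" "j \<in> {0..d}" "T_trace d i = T_trace d j" "i \<noteq> j"
    \<comment> \<open>Two equal members with different indices would give the relation with
      coefficients 1 at i and -1 at j.\<close>
    let ?c = "\<lambda>k. (if k = i then 1 else 0) - (if k = j then 1 else 0) :: Kz"
    have "trace_scale (if k = i then 1 else 0) t = (if k = i then t else 0)" for i k :: nat and t
      by simp
    then have "(\<Sum>k\<le>d. trace_scale (?c k) (T_trace d k)) = 0"
      using ij by (simp add: traces.scale_left_diff_distrib sum_subtractf)
    from zero[OF this, of i] ij show False
      by simp
  qed
  have indep: "traces.independent (T_trace d ` {0..d})"
  proof (rule traces.independent_if_scalars_zero)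
    fix c x
    assume c: "(\<Sum>x\<in>T_trace d ` {0..d}. trace_scale (c x) x) = 0" and "x \<in> T_trace d ` {0..d}"
    then obtain k where "x = T_trace d k" "k \<le> d"
      by auto
    moreover have "(\<Sum>k\<le>d. trace_scale (c (T_trace d k)) (T_trace d k)) = 0"
      using c by (simp add: sum.reindex[OF inj] atMost_atLeast0)
    ultimately show "c x = 0"
      using zero[of "\<lambda>k. c (T_trace d k)" k] by simp
  qed simp
  have sub: "traces.subspace (TR d)"
    unfolding traces.subspace_def TR
  proof (intro conjI ballI allI)
    show "0 \<in> trace_of d ` {f. markov_functional d f}"
      using trace_of_zero[of d] markov_functional_zero[of d] by (intro image_eqI[of _ _ "\<lambda>x. 0"]) auto
  next
    fix s t
    assume "s \<in> trace_of d ` {f. markov_functional d f}" "t \<in> trace_of d ` {f. markov_functional d f}"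
    then obtain f g where "s = trace_of d f" "t = trace_of d g" "markov_functional d f" "markov_functional d g"
      by blast
    then show "s + t \<in> trace_of d ` {f. markov_functional d f}"
      using trace_of_linear[of d 1 f 1 g] markov_functional_linear[of d f g 1 1]
      by (intro image_eqI[of _ _ "\<lambda>x. f x + g x"]) simp_all
  next
    fix c t
    assume "t \<in> trace_of d ` {f. markov_functional d f}"
    then obtain f where "t = trace_of d f" "markov_functional d f"
      by blast
    then show "trace_scale c t \<in> trace_of d ` {f. markov_functional d f}"
      using trace_of_linear[of d c f 0 f] markov_functional_scale[of d f c]
      by (intro image_eqI[of _ _ "\<lambda>x. c * f x"]) simp_all
  qed
  have span: "traces.span (T_trace d ` {0..d}) = TR d"
  proof (rule equalityI)
    show "traces.span (T_trace d ` {0..d}) \<subseteq> TR d"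
      using sub trace_of_TR[OF basic_markov[OF ocneanu_markov]]
      by (intro traces.span_minimal) (auto simp: T_trace_eq)
    show "TR d \<subseteq> traces.span (T_trace d ` {0..d})"
    proof
      fix t
      assume "t \<in> TR d"
      then obtain f where f: "t = trace_of d f" "markov_functional d f"
        unfolding TR by blast
      have "\<exists>c. \<forall>x. g x = c * ocneanu x" if "markov_functional 0 g" for g
        using markov_functional_unique[OF that ocneanu_markov ocneanu_one] by blast
      then obtain c where "\<forall>x. f x = (\<Sum>k\<le>d. c k * ?b k x)"
        using basic_span[OF ocneanu_markov _ f(2)] by blast
      then have "f = (\<lambda>x. \<Sum>k\<le>d. c k * ?b k x)"
        by (simp add: fun_eq_iff)
      then have t: "t = (\<Sum>k\<le>d. trace_scale (c k) (T_trace d k))"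
        unfolding f(1) by (simp only: trace_of_sum T_trace_eq)
      show "t \<in> traces.span (T_trace d ` {0..d})"
        unfolding t by (intro traces.span_sum traces.span_scale traces.span_base) auto
    qed
  qed
  have "traces.dim (TR d) = d + 1"
    using traces.dim_span_eq_card_independent[OF indep] card_image[OF inj] by (simp add: span)
  with sub inj indep span show ?thesis
    by blast
qed

end
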